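(* Let $\alpha$ be irrational with a semi-regular expansion $(a_i,\varepsilon_i)$ (as in the context) for which $R:=\liminf_{i\to\infty}a_i$ is finite and $R\ge4$, and let $\gamma$ be real with $M(\alpha,\gamma)>M(\alpha,\gamma_* )-R_*^{-3}$, where $\gamma_*$ is formed from the same expansion. Let $t_i$ be the integers determined by $\gamma$ and the expansion as in the context. (a) If the expansion is the nearest integer expansion of $\alpha$ (with $0<\alpha<\tfrac12$), then $|t_i|<3a_i/R$ for all but finitely many $i$; in particular, for all but finitely many $k$ with $a_k=R$, one has $t_k=\pm1$ if $a_k$ is odd and $t_k\in\{0,\pm2\}$ if $a_k$ is even. (b) If the expansion is the regular continued fraction expansion of $\alpha$, then $|t_i|<2a_i/(R_*-1)$ for all but finitely many $i$; in particular, for all but finitely many $k$ with $a_k=R$, one has $t_k=\pm1$ if $a_k$ is odd and $t_k=0$ if $a_k$ is even.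
   Context: For real $x$, $\|x\|$ is the distance to the nearest integer and $\{x\}$ its fractional part. $M(\alpha,\gamma):=\liminf_{|n|\to\infty}|n|\,\|n\alpha-\gamma\|$ ($n\in\mathbb Z$). A semi-regular expansion is $\alpha=a_0+\cfrac{\varepsilon_1}{a_1+\cfrac{\varepsilon_2}{a_2+\cdots}}$, $\varepsilon_i\in\{\pm1\}$; put $\alpha_i:=\cfrac{1}{a_{i+1}+\cfrac{\varepsilon_{i+2}}{a_{i+2}+\cdots}}$ ($i\ge0$). The regular expansion has all $\varepsilon_i=1$, $a_0=\lfloor\alpha\rfloor$. The nearest integer expansion of irrational $\alpha\in(0,\tfrac12)$: $a_0=0,\varepsilon_1=1,\alpha_0=\alpha$; for $i\ge0$, if $\|1/\alpha_i\|=\{1/\alpha_i\}$ then $a_{i+1}=\lfloor1/\alpha_i\rfloor,\varepsilon_{i+2}=1$, else $a_{i+1}=\lceil1/\alpha_i\rceil,\varepsilon_{i+2}=-1$; $\alpha_{i+1}=\|1/\alpha_i\|$. Convergents $p_{-1}=1,q_{-1}=0,p_0=a_0,q_0=1$, $p_i=a_ip_{i-1}+\varepsilon_ip_{i-2}$, $q_i=a_iq_{i-1}+\varepsilon_iq_{i-2}$; $D_i:=|q_i\alpha-p_i|$. $\lambda_i=0$ if $a_i$ is even, $\lambda_i=(-1)^j$ if $a_i$ is the $j$-th odd term among $a_1,a_2,\dots$; $\gamma_*:=\sum_{i\ge1}\tfrac12(a_i-1+\varepsilon_i+\lambda_i)D_{i-1}$. Alpha-expansion of $\gamma$: $\gamma_0:=\{\gamma\}$,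 and for $i\ge0$, $c_{i+1}:=\lfloor\gamma_i/\alpha_i\rfloor$, $\gamma_{i+1}:=\{\gamma_i/\alpha_i\}$ (so $\{\gamma\}=\sum_{i\ge1}c_iD_{i-1}$). The integers $t_i$ are defined by $c_i=\tfrac12(a_i-1+\varepsilon_i+t_i)$. $R_*:=R$ if $R$ is odd, $R+1$ if $R$ is even.
   Formalization: The formal theorem additionally assumes that γ is not of the form m+nα with integers m, n; without this the claim fails, e.g. for α=√5−2 (all a_i=4, ε_i=1) and γ=0, where M(α,0)=M(α,γ_* )=1/√20 but t_i=−4 for all i. *)

theory Defs
  imports "HOL-Analysis.Analysis"
begin

definition nint_dist :: "real \<Rightarrow> real" where
  "nint_dist x = \<bar>x - of_int (round x)\<bar>"

definition inhom_const :: "real \<Rightarrow> real \<Rightarrow> ereal" where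
  "inhom_const \<alpha> \<gamma> =
     Liminf (filtercomap (\<lambda>n::int. \<bar>n\<bar>) at_top)
       (\<lambda>n. ereal (of_int \<bar>n\<bar> * nint_dist (of_int n * \<alpha> - \<gamma>)))"

(* The homogeneous values of gamma. They have to be kept out of results that bound the digits t_i
   from a lower bound on M(alpha,gamma): for alpha = sqrt 5 - 2 (a_i = 4 and eps_i = 1 for all
   i >= 1) one has gamma_star = (1 + alpha)/2 and M(alpha,0) = M(alpha,gamma_star) = 1/sqrt 20,
   while gamma = 0 has all c_i = 0 and hence all t_i = -4. *)
definition homogeneous_values :: "real \<Rightarrow> real set" where
  "homogeneous_values \<alpha> = {of_int m + of_int n * \<alpha> | m n. True}"

text \<open>Expansions are given by sequences \<open>a\<^sub>0, a\<^sub>1, \<dots>\<close> and \<open>\<epsilon>\<^sub>1, \<epsilon>\<^sub>2, \<dots>\<close>; the value \<open>\<epsilon> 0\<close> is never used.\<close>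

(* cf_trunc a eps i n = 1/(a_{i+1} + eps_{i+2}/(a_{i+2} + ... + eps_{i+n+1}/a_{i+n+1})) *)
fun cf_trunc :: "(nat \<Rightarrow> int) \<Rightarrow> (nat \<Rightarrow> int) \<Rightarrow> nat \<Rightarrow> nat \<Rightarrow> real" where
  "cf_trunc a \<epsilon> i 0 = 1 / of_int (a (i + 1))"
| "cf_trunc a \<epsilon> i (Suc n) =
     1 / (of_int (a (i + 1)) + of_int (\<epsilon> (i + 2)) * cf_trunc a \<epsilon> (i + 1) n)"

definition cf_tail :: "(nat \<Rightarrow> int) \<Rightarrow> (nat \<Rightarrow> int) \<Rightarrow> nat \<Rightarrow> real" where
  "cf_tail a \<epsilon> i = lim (cf_trunc a \<epsilon> i)"

(* The inequalities on a_i + eps_{i+1} are the customary ones for semi-regular continued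
   fractions; regular and nearest integer expansions satisfy them automatically. *)
definition semi_regular_expansion :: "(nat \<Rightarrow> int) \<Rightarrow> (nat \<Rightarrow> int) \<Rightarrow> real \<Rightarrow> bool" where
  "semi_regular_expansion a \<epsilon> \<alpha> \<longleftrightarrow>
     (\<forall>i\<ge>1. \<epsilon> i \<in> {1, -1}) \<and>
     (\<forall>i\<ge>1. a i \<ge> 1 \<and> a i + \<epsilon> (i + 1) \<ge> 1) \<and>
     (\<exists>\<^sub>F i in sequentially. a i + \<epsilon> (i + 1) \<ge> 2) \<and>
     (\<lambda>n. of_int (a 0) + of_int (\<epsilon> 1) * cf_trunc a \<epsilon> 0 n) \<longlonglongrightarrow> \<alpha>"

definition regular_expansion :: "(nat \<Rightarrow> int) \<Rightarrow> (nat \<Rightarrow> int) \<Rightarrow> real \<Rightarrow> bool" where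
  "regular_expansion a \<epsilon> \<alpha> \<longleftrightarrow>
     semi_regular_expansion a \<epsilon> \<alpha> \<and> (\<forall>i\<ge>1. \<epsilon> i = 1) \<and> a 0 = \<lfloor>\<alpha>\<rfloor>"

fun ni_remainder :: "real \<Rightarrow> nat \<Rightarrow> real" where
  "ni_remainder \<alpha> 0 = \<alpha>"
| "ni_remainder \<alpha> (Suc i) = nint_dist (1 / ni_remainder \<alpha> i)"

definition nearest_integer_expansion :: "(nat \<Rightarrow> int) \<Rightarrow> (nat \<Rightarrow> int) \<Rightarrow> real \<Rightarrow> bool" where
  "nearest_integer_expansion a \<epsilon> \<alpha> \<longleftrightarrow>
     0 < \<alpha> \<and> \<alpha> < 1/2 \<and> a 0 = 0 \<and> \<epsilon> 1 = 1 \<and>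
     (\<forall>i. if nint_dist (1 / ni_remainder \<alpha> i) = frac (1 / ni_remainder \<alpha> i)
          then a (i + 1) = \<lfloor>1 / ni_remainder \<alpha> i\<rfloor> \<and> \<epsilon> (i + 2) = 1
          else a (i + 1) = \<lceil>1 / ni_remainder \<alpha> i\<rceil> \<and> \<epsilon> (i + 2) = -1)"

(* The clauses for index 1 have p_{-1} = 1 and q_{-1} = 0 substituted. *)
fun conv_num :: "(nat \<Rightarrow> int) \<Rightarrow> (nat \<Rightarrow> int) \<Rightarrow> nat \<Rightarrow> int" where
  "conv_num a \<epsilon> 0 = a 0"
| "conv_num a \<epsilon> (Suc 0) = a 1 * a 0 + \<epsilon> 1"
| "conv_num a \<epsilon> (Suc (Suc i)) =
     a (i + 2) * conv_num a \<epsilon> (Suc i) + \<epsilon> (i + 2) * conv_num a \<epsilon> i"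

fun conv_den :: "(nat \<Rightarrow> int) \<Rightarrow> (nat \<Rightarrow> int) \<Rightarrow> nat \<Rightarrow> int" where
  "conv_den a \<epsilon> 0 = 1"
| "conv_den a \<epsilon> (Suc 0) = a 1"
| "conv_den a \<epsilon> (Suc (Suc i)) =
     a (i + 2) * conv_den a \<epsilon> (Suc i) + \<epsilon> (i + 2) * conv_den a \<epsilon> i"

definition conv_err :: "(nat \<Rightarrow> int) \<Rightarrow> (nat \<Rightarrow> int) \<Rightarrow> real \<Rightarrow> nat \<Rightarrow> real" where
  "conv_err a \<epsilon> \<alpha> i = \<bar>of_int (conv_den a \<epsilon> i) * \<alpha> - of_int (conv_num a \<epsilon> i)\<bar>"

definition odd_sign :: "(nat \<Rightarrow> int) \<Rightarrow> nat \<Rightarrow> int" where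
  "odd_sign a i = (if even (a i) then 0 else (-1) ^ card {k \<in> {1..i}. odd (a k)})"

(* The summation index is shifted: the term with index i belongs to a_{i+1} and D_i. *)
definition gamma_star :: "(nat \<Rightarrow> int) \<Rightarrow> (nat \<Rightarrow> int) \<Rightarrow> real \<Rightarrow> real" where
  "gamma_star a \<epsilon> \<alpha> =
     (\<Sum>i. 1/2 * of_int (a (i + 1) - 1 + \<epsilon> (i + 1) + odd_sign a (i + 1)) * conv_err a \<epsilon> \<alpha> i)"

fun gamma_rem :: "(nat \<Rightarrow> int) \<Rightarrow> (nat \<Rightarrow> int) \<Rightarrow> real \<Rightarrow> nat \<Rightarrow> real" where
  "gamma_rem a \<epsilon> \<gamma> 0 = frac \<gamma>"
| "gamma_rem a \<epsilon> \<gamma> (Suc i) = frac (gamma_rem a \<epsilon> \<gamma> i / cf_tail a \<epsilon> i)"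

(* Meaningful for i >= 1 only; likewise t_digit. *)
definition c_digit :: "(nat \<Rightarrow> int) \<Rightarrow> (nat \<Rightarrow> int) \<Rightarrow> real \<Rightarrow> nat \<Rightarrow> int" where
  "c_digit a \<epsilon> \<gamma> i = \<lfloor>gamma_rem a \<epsilon> \<gamma> (i - 1) / cf_tail a \<epsilon> (i - 1)\<rfloor>"

(* The solution t_i of c_i = (a_i - 1 + eps_i + t_i)/2. *)
definition t_digit :: "(nat \<Rightarrow> int) \<Rightarrow> (nat \<Rightarrow> int) \<Rightarrow> real \<Rightarrow> nat \<Rightarrow> int" where
  "t_digit a \<epsilon> \<gamma> i = 2 * c_digit a \<epsilon> \<gamma> i - (a i - 1 + \<epsilon> i)"

definition odd_ceil :: "int \<Rightarrow> int" where
  "odd_ceil R = (if odd R then R else R + 1)"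

end

theory Submission
  imports Defs
begin

text \<open>In terms of the digits \<open>t\<^sub>i\<close> the inhomogeneous problem at level \<open>k\<close> is the product of two
  inhomogeneous linear forms evaluated at pairs of odd integers; the four pairs \<open>(\<plusminus>1, \<plusminus>1)\<close> are
  called vertices. If \<open>M(\<alpha>, \<gamma>)\<close> is large, so are all vertex values from some level on; then the
  relevant factors are positive, and four vertex values from two consecutive levels add up to
  \<open>a\<^sub>k - t\<^sub>k\<close>, another four to \<open>a\<^sub>k + t\<^sub>k\<close>; the minimum is at most the mean, which bounds \<open>\<bar>t\<^sub>k\<bar>\<close>. For
  \<open>\<gamma>\<^sub>*\<close> the digits are \<open>0\<close> and alternately \<open>\<plusminus>1\<close>, so the vertex values can be estimated from below
  directly, and every other lattice point is dominated by a vertex because its product of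
  coordinates is concave between vertices.\<close>

section \<open>Semi-regular continued fractions and inhomogeneous forms\<close>

text \<open>The sums a_k - t_k and a_k + t_k arise only once every absolute value has been resolved,
  and the digits do not force the signs: a priori the factor \<open>E\<close> can be negative or
  exceed 1. One numerical contradiction removes this obstacle. A wrong sign at some level yields
  numbers e and g with -2/5 \<le> e \<le> 7/5 and 0 \<le> g \<le> 1 for which both |e| g and |1 - e|
  (1 - g) exceed 1/3, which is impossible. For this the normalised vertex values must exceed 1/3,
  that is \<open>4/3 \<le> T * S k\<close>, and \<open>E\<close> needs a priori bounds.

  The level T for \<gamma> is dictated by the wanted digit bound, because the mean argument yields
  |t| < a - T S. The vertices of \<gamma>_* must then exceed this level by enough to cover the
  permitted loss R_*^{-3}. That leaves little room: bounds that ignore parity are too weak for small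
  R, so the estimates for \<gamma>_* distinguish the parity of a digit and of its
  neighbours.\<close>

locale semi_regular =
  fixes a \<epsilon> :: "nat \<Rightarrow> int" and \<alpha> :: real
  assumes irrational: "\<alpha> \<notin> \<rat>"
    and expansion: "semi_regular_expansion a \<epsilon> \<alpha>"
begin

abbreviation \<theta> :: "nat \<Rightarrow> real" where "\<theta> \<equiv> cf_tail a \<epsilon>"
abbreviation q :: "nat \<Rightarrow> real" where "q k \<equiv> real_of_int (conv_den a \<epsilon> k)"
abbreviation p :: "nat \<Rightarrow> real" where "p k \<equiv> real_of_int (conv_num a \<epsilon> k)"
abbreviation ra :: "nat \<Rightarrow> real" where "ra k \<equiv> real_of_int (a k)"
abbreviation re :: "nat \<Rightarrow> real" where "re k \<equiv> real_of_int (\<epsilon> k)"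

definition \<beta> :: "nat \<Rightarrow> real" where
  "\<beta> k = (if k = 0 then 0 else q (k - 1) / q k)"

text \<open>The indices of \<open>\<sigma>\<close> and \<open>err\<close> are shifted by one:
  \<open>err k\<close> is D_{k-1} and \<open>\<sigma> k\<close> is the sign of q_{k-1} \<alpha> -
  p_{k-1}, so that level 0 belongs to q_{-1} = 0 and p_{-1} = 1.\<close>

definition \<sigma> :: "nat \<Rightarrow> real" where
  "\<sigma> k = - (\<Prod>i<k. - re (Suc i))"

definition err :: "nat \<Rightarrow> real" where
  "err k = (\<Prod>i<k. \<theta> i)"

text \<open>The link between consecutive levels: \<open>\<Delta> k\<close> is \<theta>_k S_k and
  \<open>\<Delta> (Suc k)\<close> is \<beta>_{k+1} S_k, so vertex values of both levels can be
  compared in units of \<open>S k\<close>.\<close>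

definition S :: "nat \<Rightarrow> real" where
  "S k = ra (Suc k) + re (Suc (Suc k)) * \<theta> (Suc k) + re (Suc k) * \<beta> k"

text \<open>The determinant of the two forms X - \<beta>_k Y and Y + \<epsilon>_{k+1} \<theta>_k
  X.\<close>

definition \<Delta> :: "nat \<Rightarrow> real" where
  "\<Delta> k = 1 + re (Suc k) * \<theta> k * \<beta> k"

section \<open>Tails of the expansion: convergence and irrationality\<close>

lemma eps_cases: "\<epsilon> (Suc k) = 1 \<or> \<epsilon> (Suc k) = -1"
  using expansion by (auto simp: semi_regular_expansion_def)

lemma re_cases: "re (Suc k) = 1 \<or> re (Suc k) = -1"
  using eps_cases[of k] by auto

lemma re_square: "re (Suc k) * re (Suc k) = 1"
  using re_cases[of k] by auto

lemma digit_ge_one: "a (Suc k) \<ge> 1" "a (Suc k) + \<epsilon> (Suc (Suc k)) \<ge> 1"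
  using expansion by (auto simp: semi_regular_expansion_def)

lemma cf_trunc_bounds: "0 < cf_trunc a \<epsilon> i n \<and> cf_trunc a \<epsilon> i n \<le> 1"
proof (induction n arbitrary: i)
  case 0
  then show ?case using digit_ge_one[of i] by (simp add: divide_simps)
next
  case (Suc n)
  define c where "c = cf_trunc a \<epsilon> (Suc i) n"
  have c: "0 < c" "c \<le> 1" using Suc[of "Suc i"] by (auto simp: c_def)
  have "ra (Suc i) + re (Suc (Suc i)) * c \<ge> 1"
    using eps_cases[of "Suc i"] digit_ge_one[of i] c by auto
  then show ?case by (simp add: c_def divide_simps)
qed

text \<open>The hypothesis gives convergence of the truncations at index 0 only. Solving the
  recursion for the inner truncation passes to the next index; the irrationality of the limit is
  carried along because it keeps the divisor away from 0.\<close>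

lemma cf_trunc_converges: "\<exists>l. cf_trunc a \<epsilon> i \<longlonglongrightarrow> l \<and> l \<notin> \<rat>"
proof (induction i)
  case 0
  have "(\<lambda>n. re 1 * ((ra 0 + re 1 * cf_trunc a \<epsilon> 0 n) - ra 0)) \<longlonglongrightarrow> re 1 * (\<alpha> - ra 0)"
    using expansion unfolding semi_regular_expansion_def by (intro tendsto_intros) auto
  moreover have "(\<lambda>n. re 1 * ((ra 0 + re 1 * cf_trunc a \<epsilon> 0 n) - ra 0)) = cf_trunc a \<epsilon> 0"
    using re_square[of 0] by (simp add: mult.assoc[symmetric])
  ultimately have lim: "cf_trunc a \<epsilon> 0 \<longlonglongrightarrow> re 1 * (\<alpha> - ra 0)" by (simp only:)
  have "re 1 * (\<alpha> - ra 0) \<notin> \<rat>"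
  proof
    assume "re 1 * (\<alpha> - ra 0) \<in> \<rat>"
    from Rats_add[OF Rats_mult[OF Rats_of_int this] Rats_of_int]
    have "re 1 * (re 1 * (\<alpha> - ra 0)) + ra 0 \<in> \<rat>" .
    then show False using irrational re_square[of 0] by (simp add: mult.assoc[symmetric])
  qed
  then show ?case using lim by blast
next
  case (Suc i)
  then obtain l where l: "cf_trunc a \<epsilon> i \<longlonglongrightarrow> l" "l \<notin> \<rat>" by blast
  have "l \<noteq> 0" using l by auto
  have eq: "cf_trunc a \<epsilon> (Suc i) n
      = re (Suc (Suc i)) * (1 / cf_trunc a \<epsilon> i (Suc n) - ra (Suc i))" for n
    using re_square[of "Suc i"] by (simp add: mult.assoc[symmetric])
  have "cf_trunc a \<epsilon> (Suc i) \<longlonglongrightarrow> re (Suc (Suc i)) * (1 / l - ra (Suc i))"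
    unfolding eq using l(1) \<open>l \<noteq> 0\<close> by (intro tendsto_intros LIMSEQ_Suc) auto
  moreover have "re (Suc (Suc i)) * (1 / l - ra (Suc i)) \<notin> \<rat>"
  proof
    assume "re (Suc (Suc i)) * (1 / l - ra (Suc i)) \<in> \<rat>"
    from Rats_divide[OF Rats_1 Rats_add[OF Rats_mult[OF Rats_of_int this] Rats_of_int]]
    have "1 / (re (Suc (Suc i)) * (re (Suc (Suc i)) * (1 / l - ra (Suc i))) + ra (Suc i)) \<in> \<rat>" .
    then show False
      using l(2) re_square[of "Suc i"] by (simp add: mult.assoc[symmetric])
  qed
  ultimately show ?case by blast
qed

lemma tail_lim: "cf_trunc a \<epsilon> i \<longlonglongrightarrow> \<theta> i" and tail_irrational: "\<theta> i \<notin> \<rat>"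
proof -
  obtain l where l: "cf_trunc a \<epsilon> i \<longlonglongrightarrow> l" "l \<notin> \<rat>"
    using cf_trunc_converges by blast
  then have "\<theta> i = l" unfolding cf_tail_def by (intro limI)
  then show "cf_trunc a \<epsilon> i \<longlonglongrightarrow> \<theta> i" "\<theta> i \<notin> \<rat>" using l by simp_all
qed

lemma tail_pos: "0 < \<theta> i" and tail_less_one: "\<theta> i < 1"
proof -
  have "0 \<le> \<theta> i" by (rule LIMSEQ_le_const[OF tail_lim]) (use cf_trunc_bounds less_imp_le in blast)
  moreover have "\<theta> i \<le> 1" by (rule LIMSEQ_le_const2[OF tail_lim]) (use cf_trunc_bounds in blast)
  moreover have "\<theta> i \<noteq> 0" "\<theta> i \<noteq> 1" using tail_irrational[of i] by auto
  ultimately show "0 < \<theta> i" "\<theta> i < 1" by auto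
qed

lemma tail_rec: "1 / \<theta> k = ra (Suc k) + re (Suc (Suc k)) * \<theta> (Suc k)"
proof -
  have "(\<lambda>n. 1 / cf_trunc a \<epsilon> k (Suc n)) \<longlonglongrightarrow> 1 / \<theta> k"
    using tail_pos[of k] by (intro tendsto_intros LIMSEQ_Suc tail_lim) auto
  moreover have "(\<lambda>n. ra (Suc k) + re (Suc (Suc k)) * cf_trunc a \<epsilon> (Suc k) n)
      \<longlonglongrightarrow> ra (Suc k) + re (Suc (Suc k)) * \<theta> (Suc k)"
    by (intro tendsto_intros tail_lim)
  ultimately show ?thesis by (simp add: LIMSEQ_unique)
qed

lemma tail_mult: "\<theta> k * (ra (Suc k) + re (Suc (Suc k)) * \<theta> (Suc k)) = 1"
  using tail_rec[of k] tail_pos[of k] by (simp add: field_simps)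

lemma alpha_eq: "\<alpha> = ra 0 + re 1 * \<theta> 0"
proof -
  have "(\<lambda>n. ra 0 + re 1 * cf_trunc a \<epsilon> 0 n) \<longlonglongrightarrow> ra 0 + re 1 * \<theta> 0"
    by (intro tendsto_intros tail_lim)
  then show ?thesis
    using expansion LIMSEQ_unique unfolding semi_regular_expansion_def by blast
qed

text \<open>A minus sign could destroy positivity, so the induction also carries strict growth just
  before a minus sign. There a + \<epsilon> \<ge> 1 forces the preceding partial quotient to be at
  least 2.\<close>

lemma conv_den_pos_aux:
  "conv_den a \<epsilon> k > 0 \<and> conv_den a \<epsilon> (Suc k) > 0 \<and>
   (\<epsilon> (Suc (Suc k)) = -1 \<longrightarrow> conv_den a \<epsilon> (Suc k) > conv_den a \<epsilon> k)"
proof (induction k)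
  case 0
  then show ?case using digit_ge_one[of 0] by auto
next
  case (Suc k)
  let ?q = "conv_den a \<epsilon>"
  have q: "?q (Suc (Suc k)) = a (Suc (Suc k)) * ?q (Suc k) + \<epsilon> (Suc (Suc k)) * ?q k"
    by simp
  define P where "P = a (Suc (Suc k)) * ?q (Suc k)"
  have "P \<ge> 1 * ?q (Suc k)"
    unfolding P_def using Suc digit_ge_one(1)[of "Suc k"] by (intro mult_right_mono) auto
  then have pos: "?q (Suc (Suc k)) > 0"
    using Suc eps_cases[of "Suc k"] unfolding q P_def[symmetric] by auto
  have "?q (Suc (Suc k)) > ?q (Suc k)" if "\<epsilon> (Suc (Suc (Suc k))) = -1"
  proof -
    have "P \<ge> 2 * ?q (Suc k)"
      unfolding P_def using Suc digit_ge_one(2)[of "Suc k"] that by (intro mult_right_mono) auto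
    then show ?thesis using Suc eps_cases[of "Suc k"] unfolding q P_def[symmetric] by auto
  qed
  then show ?case using Suc pos by auto
qed

lemma q_pos: "q k > 0"
  using conv_den_pos_aux[of k] by simp

lemma beta_0 [simp]: "\<beta> 0 = 0"
  by (simp add: \<beta>_def)

lemma beta_nonneg: "\<beta> k \<ge> 0"
  using q_pos[of k] q_pos[of "k - 1"] by (simp add: \<beta>_def)

lemma beta_Suc_pos: "\<beta> (Suc k) > 0"
  using q_pos[of k] q_pos[of "Suc k"] by (simp add: \<beta>_def)

lemma beta_less_one: "\<epsilon> (Suc k) = -1 \<Longrightarrow> \<beta> k < 1"
  using conv_den_pos_aux[of "k - 1"] by (cases k) (auto simp: \<beta>_def)

lemma q_beta: "q (Suc k) * \<beta> (Suc k) = q k"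
  using q_pos[of "Suc k"] by (simp add: \<beta>_def)

lemma q_Suc: "q (Suc k) = q k * (ra (Suc k) + re (Suc k) * \<beta> k)"
proof (cases k)
  case (Suc j)
  have "q (Suc k) = ra (Suc k) * q k + re (Suc k) * q j" by (simp add: Suc)
  moreover have "q j = q k * \<beta> k" using q_beta[of j] Suc by simp
  ultimately show ?thesis by (simp add: algebra_simps)
qed auto

lemma beta_mult: "\<beta> (Suc k) * (ra (Suc k) + re (Suc k) * \<beta> k) = 1"
proof -
  have "q k * (\<beta> (Suc k) * (ra (Suc k) + re (Suc k) * \<beta> k)) = q k"
    using q_beta[of k] q_Suc[of k] by (simp add: mult_ac)
  then show ?thesis using q_pos[of k] by simp
qed

lemma beta_rec: "1 / \<beta> (Suc k) = ra (Suc k) + re (Suc k) * \<beta> k"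
  using beta_mult[of k] beta_Suc_pos[of k] by (simp add: field_simps)

lemma Delta_eq_tail: "\<Delta> k = \<theta> k * S k"
  using tail_mult[of k] by (simp add: \<Delta>_def S_def algebra_simps)

lemma Delta_eq_beta: "\<Delta> (Suc k) = \<beta> (Suc k) * S k"
  using beta_mult[of k] by (simp add: \<Delta>_def S_def algebra_simps)

section \<open>Signed errors of the convergents and the determinant identity\<close>

lemma sigma_0 [simp]: "\<sigma> 0 = -1"
  by (simp add: \<sigma>_def)

lemma sigma_Suc: "\<sigma> (Suc k) = - re (Suc k) * \<sigma> k"
  by (simp add: \<sigma>_def)

lemma abs_sigma: "\<bar>\<sigma> k\<bar> = 1"
proof (induction k)
  case (Suc k)
  then show ?case using re_cases[of k] by (auto simp: sigma_Suc abs_mult)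
qed simp

lemma err_0 [simp]: "err 0 = 1"
  by (simp add: err_def)

lemma err_Suc: "err (Suc k) = err k * \<theta> k"
  by (simp add: err_def)

lemma err_pos: "err k > 0"
  unfolding err_def by (intro prod_pos) (auto simp: tail_pos)

lemma convergent_error: "q k * \<alpha> - p k = \<sigma> (Suc k) * err (Suc k)"
proof (induction k rule: induct_nat_012)
  case 0
  then show ?case using alpha_eq by (simp add: sigma_Suc err_Suc)
next
  case 1
  have "ra 1 * \<theta> 0 = 1 - re 2 * \<theta> 1 * \<theta> 0"
    using tail_mult[of 0] by (simp add: algebra_simps numeral_2_eq_2)
  then have "re 1 * (ra 1 * \<theta> 0) = re 1 * (1 - re 2 * \<theta> 1 * \<theta> 0)" by simp
  moreover have "q 1 * \<alpha> - p 1 = re 1 * (ra 1 * \<theta> 0) - re 1"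
    by (subst alpha_eq) (simp add: algebra_simps)
  ultimately show ?case
    by (simp add: sigma_Suc err_Suc algebra_simps numeral_2_eq_2)
next
  case (ge2 k)
  let ?k = "Suc (Suc k)"
  have "q ?k * \<alpha> - p ?k = ra ?k * (q (Suc k) * \<alpha> - p (Suc k)) + re ?k * (q k * \<alpha> - p k)"
    by (simp add: algebra_simps)
  also have "\<dots> = \<sigma> ?k * err (Suc k) * (ra ?k * \<theta> (Suc k)) + re ?k * (\<sigma> (Suc k) * err (Suc k))"
    unfolding ge2 by (simp add: err_Suc)
  also have "ra ?k * \<theta> (Suc k) = 1 - re (Suc ?k) * \<theta> ?k * \<theta> (Suc k)"
    using tail_mult[of "Suc k"] by (simp add: algebra_simps)
  also have "\<sigma> ?k * err (Suc k) * (1 - re (Suc ?k) * \<theta> ?k * \<theta> (Suc k))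
      + re ?k * (\<sigma> (Suc k) * err (Suc k)) = \<sigma> (Suc ?k) * err (Suc ?k)"
    by (simp add: sigma_Suc err_Suc algebra_simps)
  finally show ?case .
qed

lemma conv_err_eq: "conv_err a \<epsilon> \<alpha> k = err (Suc k)"
  unfolding conv_err_def convergent_error
  using abs_sigma[of "Suc k"] err_pos[of "Suc k"] by (simp add: abs_mult)

text \<open>The identity q_k D_{k-1} + \<epsilon>_{k+1} q_{k-1} D_k = 1 in normalised form.
  Positivity of \<open>\<Delta>\<close> is read off from it rather than from estimates of
  \<open>\<beta>\<close>, which may exceed 1 at early levels.\<close>

lemma q_err_Delta: "q k * err k * \<Delta> k = 1"
proof (induction k)
  case 0
  then show ?case by (simp add: \<Delta>_def)
next
  case (Suc k)
  have "q (Suc k) * err (Suc k) * \<Delta> (Suc k) = (q (Suc k) * \<beta> (Suc k)) * err k * (\<theta> k * S k)"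
    by (simp add: Delta_eq_beta err_Suc)
  then show ?case using Suc by (simp add: q_beta Delta_eq_tail)
qed

lemma Delta_pos: "\<Delta> k > 0"
proof -
  have "q k * err k > 0" using q_pos err_pos by simp
  then show ?thesis using q_err_Delta[of k] by (metis zero_less_mult_pos zero_less_one)
qed

text \<open>With digits \<open>t\<^sub>i\<close> in place of the \<open>c\<^sub>i\<close>, the inhomogeneous forms \<open>2n - 1\<close> and
  \<open>2(n\<alpha> - m - \<gamma>)\<close> become, up to scaling by \<open>q\<^sub>k\<close> and \<open>D\<^sub>k\<^sub>-\<^sub>1\<close>, the functions
  \<open>denom_form\<close> and \<open>error_form\<close> of a pair of odd integers, where \<open>d\<^sub>k\<^sup>-\<close> collects the digits up
  to \<open>k\<close> and \<open>y\<^sub>k\<close> those after \<open>k\<close>.\<close>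

primrec dminus :: "(nat \<Rightarrow> int) \<Rightarrow> nat \<Rightarrow> real" where
  "dminus t 0 = 0"
| "dminus t (Suc k) = \<beta> (Suc k) * (t (Suc k) - re (Suc k) * dminus t k)"

text \<open>Only the recursion is required, because two different objects meet it: the recentred
  remainders of the alpha-expansion of \<gamma>, and a series for \<gamma>_*.\<close>

definition digit_tail :: "(nat \<Rightarrow> int) \<Rightarrow> (nat \<Rightarrow> real) \<Rightarrow> bool" where
  "digit_tail t y \<longleftrightarrow> (\<forall>k. y k = \<theta> k * (t (Suc k) + y (Suc k)))"

definition denom_form :: "(nat \<Rightarrow> int) \<Rightarrow> nat \<Rightarrow> int \<Rightarrow> int \<Rightarrow> real" where
  "denom_form t k X Y = X - \<beta> k * Y + dminus t k"

definition error_form :: "(nat \<Rightarrow> real) \<Rightarrow> nat \<Rightarrow> int \<Rightarrow> int \<Rightarrow> real" where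
  "error_form y k X Y = Y + re (Suc k) * \<theta> k * X + y k"

text \<open>The sum of (a_i - 1 + \<epsilon>_i) D_{i-1} telescopes to 1 + \<epsilon>_1 \<theta>_0;
  adding y_0 and halving gives the inhomogeneity with digits t.\<close>

definition base_point :: "(nat \<Rightarrow> real) \<Rightarrow> real" where
  "base_point y = (1 + re 1 * \<theta> 0 + y 0) / 2"

text \<open>Replacing 2n by 2n - 1 changes the first form by a bounded amount, which is negligible
  where n \<alpha> - m - \<gamma> is small.\<close>

definition represents ::
  "(nat \<Rightarrow> int) \<Rightarrow> (nat \<Rightarrow> real) \<Rightarrow> nat \<Rightarrow> int \<Rightarrow> int \<Rightarrow> int \<Rightarrow> int \<Rightarrow> bool" where
  "represents t y k X Y n m \<longleftrightarrow>
     2 * n - 1 = \<sigma> k * q k * denom_form t k X Y \<and>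
     2 * (n * \<alpha> - m - base_point y) = - err k * error_form y k X Y"

section \<open>Lattice points as pairs of odd integers at every level\<close>

lemma denom_form_Suc:
  "\<sigma> (Suc k) * q (Suc k) * denom_form t (Suc k) Y (a (Suc k) * Y + \<epsilon> (Suc k) * X + t (Suc k))
   = \<sigma> k * q k * denom_form t k X Y"
proof -
  let ?e = "re (Suc k)" and ?A = "ra (Suc k)"
  have "q (Suc k) * denom_form t (Suc k) Y (a (Suc k) * Y + \<epsilon> (Suc k) * X + t (Suc k))
      = q (Suc k) * Y - (q (Suc k) * \<beta> (Suc k)) * (?A * Y + ?e * X + ?e * dminus t k)"
    by (simp add: denom_form_def algebra_simps)
  also have "\<dots> = q k * (?A + ?e * \<beta> k) * Y - q k * (?A * Y + ?e * X + ?e * dminus t k)"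
    unfolding q_beta using q_Suc[of k] by simp
  also have "\<dots> = - ?e * (q k * denom_form t k X Y)"
    by (simp add: denom_form_def algebra_simps)
  finally have *: "q (Suc k) * denom_form t (Suc k) Y (a (Suc k) * Y + \<epsilon> (Suc k) * X + t (Suc k))
     = - ?e * (q k * denom_form t k X Y)" .
  have "\<sigma> (Suc k) * q (Suc k) * denom_form t (Suc k) Y (a (Suc k) * Y + \<epsilon> (Suc k) * X + t (Suc k))
      = (?e * ?e) * (\<sigma> k * q k * denom_form t k X Y)"
    unfolding mult.assoc * sigma_Suc by (simp add: algebra_simps)
  then show ?thesis by (simp add: re_square)
qed

lemma error_form_Suc:
  assumes "digit_tail t y"
  shows "\<theta> k * error_form y (Suc k) Y (a (Suc k) * Y + \<epsilon> (Suc k) * X + t (Suc k))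
    = error_form y k X Y"
proof -
  have "y k = \<theta> k * (t (Suc k) + y (Suc k))" using assms unfolding digit_tail_def by blast
  moreover have "\<theta> k * error_form y (Suc k) Y (a (Suc k) * Y + \<epsilon> (Suc k) * X + t (Suc k))
     = (\<theta> k * (ra (Suc k) + re (Suc (Suc k)) * \<theta> (Suc k))) * Y + re (Suc k) * \<theta> k * X
       + \<theta> k * (t (Suc k) + y (Suc k))"
    by (simp add: error_form_def algebra_simps)
  ultimately show ?thesis unfolding tail_mult by (simp add: error_form_def)
qed

text \<open>The step from (X, Y) to (Y, a Y + \<epsilon> X + t) is an affine map of determinant
  -\<epsilon>. It changes the basis but neither of the two represented quantities, so the same
  lattice point is seen at every level.\<close>

lemma represents_Suc:
  assumes "digit_tail t y"
  shows "represents t y (Suc k) Y (a (Suc k) * Y + \<epsilon> (Suc k) * X + t (Suc k)) n m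
    \<longleftrightarrow> represents t y k X Y n m"
proof -
  have "- err (Suc k) * error_form y (Suc k) Y (a (Suc k) * Y + \<epsilon> (Suc k) * X + t (Suc k))
      = - err k * error_form y k X Y"
    unfolding error_form_Suc[OF assms, of k Y X, symmetric] by (simp add: err_Suc)
  then show ?thesis unfolding represents_def denom_form_Suc by simp
qed

lemma represents_0: "represents t y 0 (1 - 2 * n) (1 + 2 * m - 2 * n * a 0) n m"
proof -
  have "2 * (n * \<alpha> - m - base_point y)
      = 2 * (n * (ra 0 + re 1 * \<theta> 0) - m - base_point y)"
    using alpha_eq by simp
  then show ?thesis
    by (simp add: represents_def denom_form_def error_form_def base_point_def algebra_simps)
qed

lemma odd_step:
  assumes "even (a (Suc k) + t (Suc k))" "odd X" "odd Y"
  shows "odd (a (Suc k) * Y + \<epsilon> (Suc k) * X + t (Suc k))"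
    and "odd (\<epsilon> (Suc k) * (Y - a (Suc k) * X - t (Suc k)))"
  using assms eps_cases[of k] by auto

text \<open>The step is invertible on odd pairs, so any odd pair can be carried down to level 0,
  where it comes from some n and m. This makes each vertex an actual value of the approximation
  problem.\<close>

lemma represents_exists:
  assumes "digit_tail t y" "\<And>k. even (a (Suc k) + t (Suc k))" "odd X" "odd Y"
  shows "\<exists>n m. represents t y k X Y n m"
  using assms(3,4)
proof (induction k arbitrary: X Y)
  case 0
  then obtain i j where "X = 2 * i + 1" and "Y = 2 * j + 1" by (meson oddE)
  then obtain n where n: "X = 1 - 2 * n" and j: "Y = 1 + 2 * j" by (metis add.commute diff_minus_eq_add mult_minus_right)
  have "represents t y 0 (1 - 2 * n) (1 + 2 * (j + n * a 0) - 2 * n * a 0) n (j + n * a 0)"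
    by (rule represents_0)
  then have "represents t y 0 X Y n (j + n * a 0)"
    unfolding n j by (simp add: algebra_simps)
  then show ?case by blast
next
  case (Suc k)
  define X' where "X' = \<epsilon> (Suc k) * (Y - a (Suc k) * X - t (Suc k))"
  have "odd X'" unfolding X'_def by (rule odd_step(2)) (use assms Suc.prems in auto)
  then obtain n m where "represents t y k X' X n m" using Suc by blast
  moreover have "a (Suc k) * X + \<epsilon> (Suc k) * X' + t (Suc k) = Y"
    using eps_cases[of k] by (auto simp: X'_def)
  ultimately show ?case using represents_Suc[OF assms(1), of k X X' n m] by auto
qed

text \<open>The pairs of one lattice point overlap from level to level, hence are consecutive terms
  of a single integer sequence.\<close>

lemma represents_sequence:
  assumes "digit_tail t y" "\<And>k. even (a (Suc k) + t (Suc k))"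
  obtains Z :: "nat \<Rightarrow> int" where
    "\<And>k. odd (Z k)"
    "\<And>k. Z (Suc (Suc k)) = a (Suc k) * Z (Suc k) + \<epsilon> (Suc k) * Z k + t (Suc k)"
    "\<And>k. represents t y k (Z k) (Z (Suc k)) n m"
proof -
  define W where "W = rec_nat (1 - 2 * n, 1 + 2 * m - 2 * n * a 0)
    (\<lambda>k (X, Y). (Y, a (Suc k) * Y + \<epsilon> (Suc k) * X + t (Suc k)))"
  define Z where "Z k = fst (W k)" for k
  have snd: "snd (W k) = Z (Suc k)" for k
    by (simp add: Z_def W_def split: prod.splits)
  have rec: "Z (Suc (Suc k)) = a (Suc k) * Z (Suc k) + \<epsilon> (Suc k) * Z k + t (Suc k)" for k
    unfolding snd[symmetric] by (simp add: Z_def W_def split: prod.splits)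
  have Z0: "Z 0 = 1 - 2 * n" "Z (Suc 0) = 1 + 2 * m - 2 * n * a 0"
    by (simp_all add: Z_def W_def)
  have odd: "odd (Z k) \<and> odd (Z (Suc k))" for k
  proof (induction k)
    case (Suc k)
    then show ?case unfolding rec using odd_step(1)[of k t, OF assms(2)] by blast
  qed (simp add: Z0)
  have rep: "represents t y k (Z k) (Z (Suc k)) n m" for k
  proof (induction k)
    case 0
    then show ?case unfolding Z0 by (rule represents_0)
  next
    case (Suc k)
    then show ?case unfolding rec represents_Suc[OF assms(1)] .
  qed
  show ?thesis using that[of Z] odd rec rep by blast
qed

text \<open>The scalings of the two forms multiply to q_k D_{k-1} = 1 / \<Delta>_k. This is where
  the factor \<open>\<Delta> k\<close> in the vertex conditions comes from.\<close>

lemma represents_product: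
  assumes "represents t y k X Y n m"
  shows "\<bar>2 * real_of_int n - 1\<bar> * (2 * \<bar>n * \<alpha> - m - base_point y\<bar>) * \<Delta> k
    = \<bar>denom_form t k X Y\<bar> * \<bar>error_form y k X Y\<bar>"
proof -
  have "\<bar>2 * real_of_int n - 1\<bar> = q k * \<bar>denom_form t k X Y\<bar>"
    using assms abs_sigma[of k] q_pos[of k] unfolding represents_def by (simp add: abs_mult)
  moreover have "2 * \<bar>n * \<alpha> - m - base_point y\<bar> = \<bar>2 * (n * \<alpha> - m - base_point y)\<bar>"
    by (simp only: abs_mult abs_numeral)
  then have "2 * \<bar>n * \<alpha> - m - base_point y\<bar> = err k * \<bar>error_form y k X Y\<bar>"
    using assms err_pos[of k] unfolding represents_def by (simp add: abs_mult)
  ultimately have "\<bar>2 * real_of_int n - 1\<bar> * (2 * \<bar>n * \<alpha> - m - base_point y\<bar>) * \<Delta> k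
    = (q k * err k * \<Delta> k) * (\<bar>denom_form t k X Y\<bar> * \<bar>error_form y k X Y\<bar>)"
    by (simp add: mult_ac)
  then show ?thesis by (simp add: q_err_Delta)
qed

end

section \<open>Lattice points and vertices\<close>

lemma nint_dist_le: "nint_dist x \<le> \<bar>x - of_int m\<bar>"
  unfolding nint_dist_def by (rule round_diff_minimal)

lemma nint_dist_pos:
  assumes "\<gamma> \<notin> homogeneous_values \<alpha>"
  shows "nint_dist (of_int n * \<alpha> - \<gamma>) > 0"
proof (rule ccontr)
  assume "\<not> ?thesis"
  then have "of_int n * \<alpha> - \<gamma> = of_int (round (of_int n * \<alpha> - \<gamma>))"
    by (simp add: nint_dist_def)
  then have "\<gamma> = of_int (- round (of_int n * \<alpha> - \<gamma>)) + of_int n * \<alpha>" by simp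
  then show False using assms unfolding homogeneous_values_def by blast
qed

lemma eventually_SucI:
  "(\<forall>\<^sub>F k in sequentially. P (Suc k)) \<Longrightarrow> \<forall>\<^sub>F k in sequentially. P k"
  by (simp add: eventually_sequentially_Suc)

lemma eventually_SucD:
  "(\<forall>\<^sub>F k in sequentially. P k) \<Longrightarrow> \<forall>\<^sub>F k in sequentially. P (Suc k)"
  by (simp add: eventually_sequentially_Suc)

text \<open>The difference to the value at \<open>s1\<close> factors as (s - s1)(u + v - s - s1),
  and similarly at \<open>s2\<close>; the sign of the second factor tells which endpoint to compare
  with.\<close>

lemma concave_quadratic_ge:
  fixes s :: real
  assumes "s1 \<le> s" "s \<le> s2"
    and "(s1 - u) * (v - s1) \<ge> K" "(s2 - u) * (v - s2) \<ge> K"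
  shows "(s - u) * (v - s) \<ge> K"
proof (cases "u + v \<ge> s + s1")
  case True
  then have "0 \<le> (s - s1) * (u + v - s - s1)" using assms by (intro mult_nonneg_nonneg) auto
  then show ?thesis using assms by (simp add: algebra_simps)
next
  case False
  then have "0 \<le> (s2 - s) * (s + s2 - u - v)" using assms by (intro mult_nonneg_nonneg) auto
  then show ?thesis using assms by (simp add: algebra_simps)
qed

text \<open>The zeros lie within distance 1 of 0 and of -c. On the two outer ranges both factors
  grow away from the zeros, on the middle range the product is concave, and the end points of the
  three ranges are the listed values of r.\<close>

lemma product_ge_at_vertices:
  fixes s :: real
  assumes s: "s \<ge> 1 \<or> s \<le> -1" "s + c \<ge> 1 \<or> s + c \<le> -1"
    and uw: "\<bar>u\<bar> < 1" "\<bar>w\<bar> < 1" and c: "c \<ge> 3"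
    and v: "\<And>r. r \<in> {1, -1, 1 - c, -1 - c} \<Longrightarrow> \<bar>r - u\<bar> * \<bar>r + c - w\<bar> \<ge> K"
  shows "\<bar>s - u\<bar> * \<bar>s + c - w\<bar> \<ge> K"
proof -
  consider "s \<ge> 1" | "s \<le> -1 - c" | "1 - c \<le> s" "s \<le> -1" using s by linarith
  then show ?thesis
  proof cases
    case 1
    then have "\<bar>1 - u\<bar> * \<bar>1 + c - w\<bar> \<le> \<bar>s - u\<bar> * \<bar>s + c - w\<bar>"
      using uw c by (intro mult_mono) auto
    then show ?thesis using v[of 1] by simp
  next
    case 2
    then have "\<bar>(-1 - c) - u\<bar> * \<bar>(-1 - c) + c - w\<bar> \<le> \<bar>s - u\<bar> * \<bar>s + c - w\<bar>"
      using uw c by (intro mult_mono) auto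
    moreover have "\<bar>(-1 - c) - u\<bar> * \<bar>(-1 - c) + c - w\<bar> \<ge> K" by (rule v) simp
    ultimately show ?thesis by linarith
  next
    case 3
    have sgn: "\<bar>r - u\<bar> * \<bar>r + c - w\<bar> = (r - (w - c)) * (u - r)" if "1 - c \<le> r" "r \<le> -1" for r
    proof -
      have "\<bar>r - u\<bar> = u - r" "\<bar>r + c - w\<bar> = r - (w - c)" using that uw by auto
      then show ?thesis by simp
    qed
    have "(s - (w - c)) * (u - s) \<ge> K"
    proof (rule concave_quadratic_ge[OF 3])
      have "\<bar>(1 - c) - u\<bar> * \<bar>(1 - c) + c - w\<bar> \<ge> K" by (rule v) simp
      then show "K \<le> (1 - c - (w - c)) * (u - (1 - c))"
        using sgn[of "1 - c"] c by simp
      show "K \<le> (- 1 - (w - c)) * (u - - 1)" using sgn[of "-1"] c v[of "-1"] by simp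
    qed
    then show ?thesis using sgn[OF 3] by simp
  qed
qed

context semi_regular
begin

text \<open>\<open>L\<close> refers to the product of the doubled forms, so it corresponds to L / 4
  for M.\<close>

definition vertices_ge :: "(nat \<Rightarrow> int) \<Rightarrow> (nat \<Rightarrow> real) \<Rightarrow> real \<Rightarrow> nat \<Rightarrow> bool" where
  "vertices_ge t y L k \<longleftrightarrow> (\<forall>X\<in>{1,-1}. \<forall>Y\<in>{1,-1}.
     \<bar>denom_form t k X Y\<bar> * \<bar>error_form y k X Y\<bar> \<ge> L * \<Delta> k)"

definition vertices_gt :: "(nat \<Rightarrow> int) \<Rightarrow> (nat \<Rightarrow> real) \<Rightarrow> real \<Rightarrow> nat \<Rightarrow> bool" where
  "vertices_gt t y T k \<longleftrightarrow> (\<forall>X\<in>{1,-1}. \<forall>Y\<in>{1,-1}.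
     \<bar>denom_form t k X Y\<bar> * \<bar>error_form y k X Y\<bar> > T * \<Delta> k)"

definition moderate :: "(nat \<Rightarrow> int) \<Rightarrow> (nat \<Rightarrow> real) \<Rightarrow> nat \<Rightarrow> bool" where
  "moderate t y k \<longleftrightarrow> a (Suc k) \<ge> 4 \<and> \<theta> k \<le> 3/11 \<and> \<beta> k \<le> 3/11 \<and>
     \<bar>dminus t k\<bar> \<le> 1/2 \<and> \<bar>y k\<bar> \<le> 1/2 \<and> \<bar>t (Suc k)\<bar> \<le> 1"

lemma denom_error_Suc:
  assumes "digit_tail t y"
  shows "\<bar>denom_form t k X Y\<bar> * \<bar>error_form y k X Y\<bar> * \<beta> (Suc k)
    = \<theta> k * (\<bar>denom_form t (Suc k) Y (a (Suc k) * Y + \<epsilon> (Suc k) * X + t (Suc k))\<bar>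
      * \<bar>error_form y (Suc k) Y (a (Suc k) * Y + \<epsilon> (Suc k) * X + t (Suc k))\<bar>)"
    (is "?L = \<theta> k * (\<bar>?d\<bar> * \<bar>?e\<bar>)")
proof -
  have "\<bar>\<sigma> (Suc k) * q (Suc k) * ?d\<bar> = \<bar>\<sigma> k * q k * denom_form t k X Y\<bar>"
    by (simp only: denom_form_Suc)
  then have "q (Suc k) * \<bar>?d\<bar> = q (Suc k) * (\<beta> (Suc k) * \<bar>denom_form t k X Y\<bar>)"
    using q_pos[of k] q_pos[of "Suc k"] q_beta[of k] by (simp add: abs_mult abs_sigma)
  then have d: "\<bar>?d\<bar> = \<beta> (Suc k) * \<bar>denom_form t k X Y\<bar>" using q_pos[of "Suc k"] by simp
  have "\<theta> k * \<bar>?e\<bar> = \<bar>\<theta> k * ?e\<bar>" using tail_pos[of k] by (simp add: abs_mult)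
  then have e: "\<theta> k * \<bar>?e\<bar> = \<bar>error_form y k X Y\<bar>"
    by (simp only: error_form_Suc[OF assms])
  show ?thesis unfolding d e[symmetric] by (simp add: mult_ac)
qed

text \<open>Both neighbours dominate \<open>z\<close>, so the first form u at level k and the second
  form at level k + 1 are at least 3/2 in size; the latter gives |v| \<ge> 3/2 \<theta>. Eliminating
  X from u and v leaves z \<open>\<Delta> k\<close> up to small terms, whence |v| + \<theta> |u|
  \<ge> 2. So |v| \<ge> 1 or \<theta> |u| > 1, and either way |u| |v| \<ge> 3/2 \<ge>
  \<open>\<Delta> k\<close>.\<close>

lemma point_ge_if_middle_large:
  assumes tail: "digit_tail t y" and mod: "moderate t y k" "moderate t y (Suc k)"
    and W: "W = a (Suc k) * z + \<epsilon> (Suc k) * X + t (Suc k)"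
    and z: "\<bar>z\<bar> \<ge> 3" "\<bar>z\<bar> \<le> \<bar>X\<bar>" "\<bar>z\<bar> \<le> \<bar>W\<bar>"
  shows "\<bar>denom_form t k X z\<bar> * \<bar>error_form y k X z\<bar> \<ge> \<Delta> k"
proof -
  let ?u = "denom_form t k X z" and ?v = "error_form y k X z"
  have zr: "real_of_int \<bar>z\<bar> \<ge> 3" "real_of_int \<bar>z\<bar> \<le> real_of_int \<bar>X\<bar>"
    "real_of_int \<bar>z\<bar> \<le> real_of_int \<bar>W\<bar>" using z by linarith+
  note m = mod[unfolded moderate_def]
  have part: "\<bar>x + r * real_of_int z + d\<bar> \<ge> 3/2"
    if "\<bar>z\<bar> \<le> \<bar>x\<bar>" "\<bar>r\<bar> \<le> 3/11" "\<bar>d\<bar> \<le> 1/2" for x r d :: real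
  proof -
    have "\<bar>r * real_of_int z\<bar> \<le> 3/11 * \<bar>real_of_int z\<bar>"
      unfolding abs_mult using that by (intro mult_right_mono) auto
    then show ?thesis using that zr(1) by linarith
  qed
  have u: "\<bar>?u\<bar> \<ge> 3/2"
    using part[of "real_of_int X" "- \<beta> k" "dminus t k"] m zr(2) beta_nonneg[of k]
    by (simp add: denom_form_def)
  have "\<bar>re (Suc (Suc k)) * \<theta> (Suc k)\<bar> \<le> 3/11"
    using re_cases[of "Suc k"] m tail_pos[of "Suc k"] by auto
  then have "\<bar>error_form y (Suc k) z W\<bar> \<ge> 3/2"
    using part[of "real_of_int W" "re (Suc (Suc k)) * \<theta> (Suc k)" "y (Suc k)"] m zr(3)
    by (simp add: error_form_def)
  then have "\<theta> k * \<bar>error_form y (Suc k) z W\<bar> \<ge> \<theta> k * (3/2)"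
    using tail_pos[of k] by (intro mult_left_mono) auto
  moreover have "\<bar>?v\<bar> = \<theta> k * \<bar>error_form y (Suc k) z W\<bar>"
    unfolding W error_form_Suc[OF tail, of k z X, symmetric] using tail_pos[of k]
    by (simp add: abs_mult)
  ultimately have v: "\<bar>?v\<bar> \<ge> 3/2 * \<theta> k" by linarith
  have rt: "\<bar>re (Suc k) * \<theta> k\<bar> = \<theta> k"
    using re_cases[of k] tail_pos[of k] by auto
  have prod: "\<bar>re (Suc k) * \<theta> k * \<beta> k\<bar> \<le> 3/11 * (3/11)"
    unfolding abs_mult[of _ "\<beta> k"] rt using m beta_nonneg[of k] tail_pos[of k]
    by (intro mult_mono) auto
  have sum_aux: "\<bar>w\<bar> + r \<ge> 2" if "\<bar>b\<bar> \<le> 3/11 * (1/2)" "\<bar>x\<bar> \<ge> 3 * (1 - 3/11 * (3/11))"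
    "w - c = x + d - b" "\<bar>c\<bar> = r" "\<bar>d\<bar> \<le> 1/2" for w r b x c d :: real
    using that by (auto simp: abs_if split: if_splits)
  have "\<bar>re (Suc k) * \<theta> k * dminus t k\<bar> \<le> 3/11 * (1/2)"
    unfolding abs_mult[of _ "dminus t k"] rt using m tail_pos[of k] by (intro mult_mono) auto
  moreover have "\<bar>z * (1 + re (Suc k) * \<theta> k * \<beta> k)\<bar> \<ge> 3 * (1 - 3/11 * (3/11))"
    unfolding abs_mult using zr(1) prod by (intro mult_mono) auto
  moreover have "?v - re (Suc k) * \<theta> k * ?u
     = z * (1 + re (Suc k) * \<theta> k * \<beta> k) + y k - re (Suc k) * \<theta> k * dminus t k"
    by (simp add: denom_form_def error_form_def algebra_simps)
  moreover have "\<bar>re (Suc k) * \<theta> k * ?u\<bar> = \<theta> k * \<bar>?u\<bar>" by (simp only: abs_mult[of _ ?u] rt)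
  moreover have "\<bar>y k\<bar> \<le> 1/2" using m by simp
  ultimately have sum: "\<bar>?v\<bar> + \<theta> k * \<bar>?u\<bar> \<ge> 2" by (rule sum_aux)
  have "\<bar>?u\<bar> * \<bar>?v\<bar> \<ge> 3/2"
  proof (cases "\<bar>?v\<bar> \<ge> 1")
    case True
    then show ?thesis using u mult_mono[of "3/2" "\<bar>?u\<bar>" 1 "\<bar>?v\<bar>"] by simp
  next
    case False
    have "3/2 * 1 \<le> 3/2 * (\<theta> k * \<bar>?u\<bar>)" using False sum by simp
    also have "\<dots> = \<bar>?u\<bar> * (3/2 * \<theta> k)" by simp
    also have "\<dots> \<le> \<bar>?u\<bar> * \<bar>?v\<bar>" using v by (intro mult_left_mono) auto
    finally show ?thesis by simp
  qed
  moreover have "\<Delta> k \<le> 3/2" using prod unfolding \<Delta>_def by linarith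
  ultimately show ?thesis by linarith
qed

text \<open>With the middle entry z fixed, the product depends on s = \<epsilon> z X alone. The
  vertices of level k with this entry are s = 1 and s = -1; those of level k + 1 are s + c = 1 and s
  + c = -1 with c = a + z t. These are the four points of
  \<open>product_ge_at_vertices\<close>.\<close>

lemma point_ge_if_middle_one:
  assumes tail: "digit_tail t y" and mod: "moderate t y k" "moderate t y (Suc k)"
    and vert: "vertices_ge t y L k" "vertices_ge t y L (Suc k)"
    and W: "W = a (Suc k) * z + \<epsilon> (Suc k) * X + t (Suc k)"
    and z: "\<bar>z\<bar> = 1" "X \<noteq> 0" "W \<noteq> 0"
  shows "\<bar>denom_form t k X z\<bar> * \<bar>error_form y k X z\<bar> \<ge> L * \<Delta> k"
proof -
  define e where "e = \<epsilon> (Suc k)"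
  have e: "e = 1 \<or> e = -1" using eps_cases[of k] by (simp add: e_def)
  have zz: "z = 1 \<or> z = -1" using z(1) by linarith
  define c where "c = a (Suc k) + z * t (Suc k)"
  define u where "u = real_of_int e * (\<beta> k - z * dminus t k)"
  define w where "w = - (re (Suc (Suc k)) * \<theta> (Suc k) + z * y (Suc k))"
  note m = mod[unfolded moderate_def]
  have f: "\<bar>denom_form t k V z\<bar> * \<bar>error_form y k V z\<bar>
      = \<theta> k * (\<bar>real_of_int (e * z * V) - u\<bar> * \<bar>real_of_int (e * z * V) + c - w\<bar>)" for V
  proof -
    have "\<bar>denom_form t k V z\<bar> = \<bar>real_of_int (e * z * V) - u\<bar>"
      using e zz by (auto simp: denom_form_def u_def)
    moreover have "\<bar>error_form y (Suc k) z (a (Suc k) * z + e * V + t (Suc k))\<bar>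
        = \<bar>real_of_int (e * z * V) + c - w\<bar>"
      using e zz by (auto simp: error_form_def c_def w_def)
    moreover have "\<bar>error_form y k V z\<bar>
        = \<theta> k * \<bar>error_form y (Suc k) z (a (Suc k) * z + e * V + t (Suc k))\<bar>"
      using error_form_Suc[OF tail, of k z V] tail_pos[of k] unfolding e_def
      by (metis abs_mult abs_of_pos)
    ultimately show ?thesis by (simp add: mult_ac)
  qed
  have vk: "\<bar>denom_form t k V z\<bar> * \<bar>error_form y k V z\<bar> \<ge> L * \<Delta> k" if "V \<in> {1, -1}" for V
    using vert(1) that zz unfolding vertices_ge_def by auto
  have vSk: "\<bar>denom_form t k V z\<bar> * \<bar>error_form y k V z\<bar> \<ge> L * \<Delta> k"
    if "a (Suc k) * z + \<epsilon> (Suc k) * V + t (Suc k) \<in> {1, -1}" for V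
  proof -
    have "L * \<Delta> (Suc k) \<le> \<bar>denom_form t (Suc k) z (a (Suc k) * z + \<epsilon> (Suc k) * V + t (Suc k))\<bar>
      * \<bar>error_form y (Suc k) z (a (Suc k) * z + \<epsilon> (Suc k) * V + t (Suc k))\<bar>"
      using vert(2) that zz unfolding vertices_ge_def by auto
    then have "\<theta> k * (L * \<Delta> (Suc k))
       \<le> \<bar>denom_form t k V z\<bar> * \<bar>error_form y k V z\<bar> * \<beta> (Suc k)"
      unfolding denom_error_Suc[OF tail] using tail_pos[of k] by simp
    moreover have "\<theta> k * (L * \<Delta> (Suc k)) = L * \<Delta> k * \<beta> (Suc k)"
      unfolding Delta_eq_beta unfolding Delta_eq_tail by (simp add: mult_ac)
    ultimately show ?thesis using beta_Suc_pos[of k] by simp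
  qed
  have c3: "c \<ge> 3" using m zz unfolding c_def by auto
  have "\<bar>real_of_int (e * z * X) - u\<bar> * \<bar>real_of_int (e * z * X) + c - w\<bar> \<ge> L * \<Delta> k / \<theta> k"
  proof (rule product_ge_at_vertices)
    show "real_of_int (e * z * X) \<ge> 1 \<or> real_of_int (e * z * X) \<le> -1"
      using e zz z(2) by auto
    have "e * z * X + c = z * W" using e zz unfolding W c_def e_def by auto
    then have "e * z * X + c \<noteq> 0" using z by auto
    then show "real_of_int (e * z * X) + c \<ge> 1 \<or> real_of_int (e * z * X) + c \<le> -1"
      by linarith
    show "\<bar>u\<bar> < 1" unfolding u_def using e zz m beta_nonneg[of k] by auto
    have "\<bar>re (Suc (Suc k)) * \<theta> (Suc k)\<bar> \<le> 3/11"
      using re_cases[of "Suc k"] m tail_pos[of "Suc k"] by auto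
    moreover have "\<bar>z * y (Suc k)\<bar> \<le> 1/2" using m zz by auto
    ultimately show "\<bar>w\<bar> < 1" unfolding w_def by linarith
    show "real_of_int c \<ge> 3" using c3 by simp
    fix r :: real
    assume "r \<in> {1, -1, 1 - real_of_int c, -1 - real_of_int c}"
    then obtain i :: int where i: "r = i" "i \<in> {1, -1, 1 - c, -1 - c}"
      by (metis (no_types, lifting) insert_iff of_int_1 of_int_diff of_int_minus singletonD)
    define V where "V = e * z * i"
    have r: "r = real_of_int (e * z * V)" using e zz i by (auto simp: V_def)
    have "V \<in> {1, -1} \<or> a (Suc k) * z + \<epsilon> (Suc k) * V + t (Suc k) \<in> {1, -1}"
      using e zz i(2) unfolding V_def c_def e_def[symmetric] by auto
    then have "\<bar>denom_form t k V z\<bar> * \<bar>error_form y k V z\<bar> \<ge> L * \<Delta> k"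
      using vk vSk by blast
    then show "L * \<Delta> k / \<theta> k \<le> \<bar>r - u\<bar> * \<bar>r + real_of_int c - w\<bar>"
      unfolding f r using tail_pos[of k] by (simp add: pos_divide_le_eq mult_ac)
  qed
  then show ?thesis unfolding f using tail_pos[of k] by (simp add: pos_divide_le_eq mult_ac)
qed

text \<open>For the lattice point represented by \<open>(Z k, Z (k + 1))\<close> at level \<open>k\<close>, the sequence
  \<open>\<bar>Z k\<bar>\<close> decreases to a minimum and then increases; at the minimum the point is compared
  with the vertices of two consecutive levels.\<close>

lemma inhom_const_base_point_ge:
  assumes tail: "digit_tail t y" and par: "\<And>k. even (a (Suc k) + t (Suc k))"
    and mod: "\<forall>\<^sub>F k in sequentially. moderate t y k"
    and vert: "\<forall>\<^sub>F k in sequentially. vertices_ge t y L k"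
    and L: "0 \<le> L" "L \<le> 1"
  shows "inhom_const \<alpha> (base_point y) \<ge> ereal (L / 4)"
proof -
  obtain k0 where k0: "\<And>k. k \<ge> k0 \<Longrightarrow> moderate t y k" "\<And>k. k \<ge> k0 \<Longrightarrow> vertices_ge t y L k"
    using eventually_conj[OF mod vert] unfolding eventually_sequentially by blast
  \<comment> \<open>For |2n - 1| > N the first entry must be the larger one at level
    \<open>k0\<close>. Otherwise |Y| (1 - 3/11) is at most 1 / \<open>err k0\<close> + 1/2, and |X|
    \<le> |Y| then bounds the first form and with it |2n - 1|.\<close>
  define C where "C = 1 / err k0 + 1/2"
  define N where "N = q k0 * (11/4 * C + 1) + 1"
  have C: "C > 0" using err_pos[of k0] unfolding C_def by (simp add: add_pos_pos)
  have key: "\<bar>2 * real_of_int n - 1\<bar> * (2 * nint_dist (n * \<alpha> - base_point y)) \<ge> L"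
    if n: "\<bar>2 * real_of_int n - 1\<bar> > N" for n
  proof -
    define m where "m = round (n * \<alpha> - base_point y)"
    have nd: "nint_dist (n * \<alpha> - base_point y) = \<bar>n * \<alpha> - m - base_point y\<bar>"
      unfolding nint_dist_def m_def by (simp add: algebra_simps)
    obtain Z :: "nat \<Rightarrow> int" where Z: "\<And>k. odd (Z k)"
      "\<And>k. Z (Suc (Suc k)) = a (Suc k) * Z (Suc k) + \<epsilon> (Suc k) * Z k + t (Suc k)"
      "\<And>k. represents t y k (Z k) (Z (Suc k)) n m"
      using represents_sequence[OF tail par] by metis
    have start: "\<bar>Z (Suc k0)\<bar> < \<bar>Z k0\<bar>"
    proof (rule ccontr)
      assume neg: "\<not> ?thesis"
      let ?X = "real_of_int (Z k0)" and ?Y = "real_of_int (Z (Suc k0))"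
      have XY: "\<bar>?X\<bar> \<le> \<bar>?Y\<bar>" using neg by linarith
      note md = k0(1)[of k0, simplified, unfolded moderate_def]
      have "\<bar>n * \<alpha> - m - base_point y\<bar> \<le> 1/2"
        unfolding nd[symmetric] nint_dist_def using of_int_round_abs_le[of "n * \<alpha> - base_point y"]
        by (simp add: abs_minus_commute)
      moreover have "\<bar>2 * x\<bar> \<le> 1" if "\<bar>x\<bar> \<le> 1/2" for x :: real using that by linarith
      ultimately have "\<bar>2 * (n * \<alpha> - m - base_point y)\<bar> \<le> 1" by blast
      then have "err k0 * \<bar>error_form y k0 (Z k0) (Z (Suc k0))\<bar> \<le> 1"
        using Z(3)[of k0] err_pos[of k0] unfolding represents_def by (simp add: abs_mult)
      then have "\<bar>error_form y k0 (Z k0) (Z (Suc k0))\<bar> \<le> 1 / err k0"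
        using err_pos[of k0] by (simp add: pos_le_divide_eq mult.commute)
      moreover have "\<bar>re (Suc k0) * \<theta> k0 * ?X\<bar> \<le> 3/11 * \<bar>?Y\<bar>"
      proof -
        have "\<bar>re (Suc k0) * \<theta> k0 * ?X\<bar> = \<theta> k0 * \<bar>?X\<bar>"
          using re_cases[of k0] tail_pos[of k0] by (auto simp: abs_mult)
        also have "\<dots> \<le> 3/11 * \<bar>?Y\<bar>" using md XY tail_pos[of k0] by (intro mult_mono) auto
        finally show ?thesis .
      qed
      moreover have "\<bar>y k0\<bar> \<le> 1/2" using md by simp
      moreover have "\<bar>x\<bar> \<le> 11/8 * (r + 1/2)" if "\<bar>x + b + d\<bar> \<le> r" "\<bar>b\<bar> \<le> 3/11 * \<bar>x\<bar>"
        "\<bar>d\<bar> \<le> 1/2" for x b d r :: real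
        using that by (auto simp: abs_if split: if_splits)
      ultimately have Y: "\<bar>?Y\<bar> \<le> 11/8 * C"
        unfolding C_def error_form_def by blast
      have "\<bar>\<beta> k0 * ?Y\<bar> \<le> 1 * \<bar>?Y\<bar>"
        unfolding abs_mult using md beta_nonneg[of k0] by (intro mult_right_mono) auto
      then have "\<bar>denom_form t k0 (Z k0) (Z (Suc k0))\<bar> \<le> 11/4 * C + 1"
        using Y XY md unfolding denom_form_def by linarith
      moreover have "\<bar>2 * real_of_int n - 1\<bar> = q k0 * \<bar>denom_form t k0 (Z k0) (Z (Suc k0))\<bar>"
        using Z(3)[of k0] abs_sigma[of k0] q_pos[of k0] unfolding represents_def
        by (simp add: abs_mult)
      ultimately have "\<bar>2 * real_of_int n - 1\<bar> \<le> q k0 * (11/4 * C + 1)"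
        using q_pos[of k0] by (simp add: mult_left_mono)
      then show False using n unfolding N_def by linarith
    qed
    have "\<exists>j. \<bar>Z (Suc (Suc (k0 + j)))\<bar> \<ge> \<bar>Z (Suc (k0 + j))\<bar>"
    proof (rule ccontr)
      assume "\<not> ?thesis"
      then have dec: "\<bar>Z (Suc (Suc (k0 + j)))\<bar> < \<bar>Z (Suc (k0 + j))\<bar>" for j by (simp add: not_le)
      have "int j + \<bar>Z (Suc (k0 + j))\<bar> \<le> \<bar>Z (Suc k0)\<bar>" for j
      proof (induction j)
        case (Suc j)
        then show ?case using dec[of j] by simp
      qed simp
      from this[of "nat (\<bar>Z (Suc k0)\<bar>) + 1"] show False by linarith
    qed
    then obtain j where j: "\<bar>Z (Suc (Suc (k0 + j)))\<bar> \<ge> \<bar>Z (Suc (k0 + j))\<bar>"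
      and least: "\<And>i. i < j \<Longrightarrow> \<not> \<bar>Z (Suc (Suc (k0 + i)))\<bar> \<ge> \<bar>Z (Suc (k0 + i))\<bar>"
      using exists_least_iff[of "\<lambda>j. \<bar>Z (Suc (Suc (k0 + j)))\<bar> \<ge> \<bar>Z (Suc (k0 + j))\<bar>"] by blast
    define k where "k = k0 + j"
    have up: "\<bar>Z (Suc k)\<bar> \<le> \<bar>Z (Suc (Suc k))\<bar>" using j by (simp add: k_def)
    have down: "\<bar>Z (Suc k)\<bar> \<le> \<bar>Z k\<bar>"
    proof (cases j)
      case 0
      then show ?thesis using start by (simp add: k_def)
    next
      case (Suc i)
      then show ?thesis using least[of i] by (simp add: k_def)
    qed
    have kk: "moderate t y k" "moderate t y (Suc k)" "vertices_ge t y L k" "vertices_ge t y L (Suc k)"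
      using k0 by (auto simp: k_def)
    have nz: "Z i \<noteq> 0" for i using Z(1)[of i] by auto
    have "\<bar>denom_form t k (Z k) (Z (Suc k))\<bar> * \<bar>error_form y k (Z k) (Z (Suc k))\<bar> \<ge> L * \<Delta> k"
    proof (cases "\<bar>Z (Suc k)\<bar> = 1")
      case True
      then show ?thesis
        using point_ge_if_middle_one[OF tail kk Z(2) True] nz by blast
    next
      case False
      have "\<bar>Z (Suc k)\<bar> \<noteq> 2" using Z(1)[of "Suc k"] by presburger
      then have "\<bar>Z (Suc k)\<bar> \<ge> 3" using False nz[of "Suc k"] by linarith
      from point_ge_if_middle_large[OF tail kk(1,2) Z(2) this down up]
      have "\<Delta> k \<le> \<bar>denom_form t k (Z k) (Z (Suc k))\<bar> * \<bar>error_form y k (Z k) (Z (Suc k))\<bar>" .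
      moreover have "L * \<Delta> k \<le> 1 * \<Delta> k"
        using L Delta_pos[of k] by (intro mult_right_mono) auto
      ultimately show ?thesis by linarith
    qed
    then have "L * \<Delta> k \<le> \<bar>2 * real_of_int n - 1\<bar> * (2 * \<bar>n * \<alpha> - m - base_point y\<bar>) * \<Delta> k"
      unfolding represents_product[OF Z(3)[of k]] .
    then show ?thesis unfolding nd using Delta_pos[of k] by simp
  qed
  show ?thesis unfolding inhom_const_def le_Liminf_iff
  proof (intro allI impI)
    fix M :: ereal
    assume M: "M < ereal (L / 4)"
    then obtain M' :: real where M': "M < ereal M'" "M' < L / 4"
      using ereal_dense2 by (metis less_ereal.simps(1))
    have dpos: "L / 4 - M' > 0" using M' by simp
    \<comment> \<open>Since |n| \<ge> (P - 1) / 2, passing from P = |2n - 1| to |n| costs L / (4 P)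
      in the lower bound; the last term of the maximum keeps this below L / 4 - M'.\<close>
    define N' where "N' = max (max N 1) (L / (L / 4 - M')) + 1"
    show "\<forall>\<^sub>F n in filtercomap (\<lambda>n::int. \<bar>n\<bar>) at_top.
        M < ereal (of_int \<bar>n\<bar> * nint_dist (of_int n * \<alpha> - base_point y))"
      unfolding eventually_filtercomap_at_top_linorder
    proof (intro exI allI impI)
      fix n :: int
      assume "\<bar>n\<bar> \<ge> \<lceil>N'\<rceil>"
      then have n: "\<bar>real_of_int n\<bar> \<ge> N'" by linarith
      define P where "P = \<bar>2 * real_of_int n - 1\<bar>"
      define d where "d = nint_dist (of_int n * \<alpha> - base_point y)"
      have P1: "P > N" "P > 1" "P > L / (L / 4 - M')"
        using n unfolding P_def N'_def by (auto simp: abs_if split: if_splits)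
      have Pd: "P * (2 * d) \<ge> L" using key P1(1) unfolding P_def d_def by simp
      have "d \<ge> 0" by (simp add: d_def nint_dist_def)
      have chain: "M' < e" if "x < c - M'" "b \<le> e" "f \<le> b" "f = c - x / 4" "0 \<le> x" for x b c e f
        using that by linarith
      have "L / P < L / 4 - M'" using P1 dpos by (simp add: field_simps)
      moreover have "\<bar>real_of_int n\<bar> * d \<ge> (P - 1) / 2 * d"
        using \<open>d \<ge> 0\<close> unfolding P_def by (intro mult_right_mono) auto
      moreover have "(P - 1) / 2 * d \<ge> (P - 1) / 2 * (L / (2 * P))"
        using Pd P1 by (intro mult_left_mono) (auto simp: field_simps)
      moreover have "(P - 1) / 2 * (L / (2 * P)) = L / 4 - L / P / 4"
        using P1 by (simp add: field_simps)
      moreover have "L / P \<ge> 0" using L P1 by simp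
      ultimately have "M' < \<bar>real_of_int n\<bar> * d" by (rule chain)
      then show "M < ereal (of_int \<bar>n\<bar> * nint_dist (of_int n * \<alpha> - base_point y))"
        using less_trans[OF M'(1), of "ereal (\<bar>real_of_int n\<bar> * d)"] by (simp add: d_def)
    qed
  qed
qed

text \<open>A vertex of level k is a lattice point with error at most 2 \<open>err k\<close>.
  Because \<gamma> is not homogeneous, the finitely many small n keep a positive distance, so at
  high levels the point has large |n| and the lower bound from M applies to it.\<close>

lemma vertices_gt_of_inhom_const:
  assumes tail: "digit_tail t y" and par: "\<And>k. even (a (Suc k) + t (Suc k))"
    and bdd: "\<And>k. \<bar>y k\<bar> \<le> 2" and lim: "err \<longlonglongrightarrow> 0"
    and \<gamma>: "\<gamma> = base_point y + of_int j" "\<gamma> \<notin> homogeneous_values \<alpha>"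
    and T: "ereal (T / 4) < inhom_const \<alpha> \<gamma>"
  shows "\<forall>\<^sub>F k in sequentially. vertices_gt t y T k"
proof -
  obtain M where M: "T / 4 < M" "ereal M < inhom_const \<alpha> \<gamma>"
    using ereal_dense2[OF T] by auto
  obtain N where N: "\<And>n. \<bar>n\<bar> \<ge> N \<Longrightarrow> M < of_int \<bar>n\<bar> * nint_dist (of_int n * \<alpha> - \<gamma>)"
    using less_LiminfD[OF M(2)[unfolded inhom_const_def]]
    unfolding eventually_filtercomap_at_top_linorder by auto
  define F where "F = (\<lambda>n::int. nint_dist (of_int n * \<alpha> - \<gamma>)) ` {- N..N}"
  define \<delta> where "\<delta> = Min (insert 1 F)"
  have fin: "finite (insert 1 F)" by (simp add: F_def)
  have "\<delta> > 0"
    unfolding \<delta>_def using fin nint_dist_pos[OF \<gamma>(2)] by (auto simp: F_def)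
  have small: "\<bar>n\<bar> \<ge> N" if "nint_dist (of_int n * \<alpha> - \<gamma>) < \<delta>" for n
  proof (rule ccontr)
    assume "\<not> ?thesis"
    then have "n \<in> {- N..N}" by auto
    then have "nint_dist (of_int n * \<alpha> - \<gamma>) \<in> insert 1 F" unfolding F_def by blast
    then show False using that Min_le[OF fin] unfolding \<delta>_def by fastforce
  qed
  \<comment> \<open>The first bound forces |n| \<ge> N; the second pays for replacing |2n| by |2n -
    1|, which costs 2 d \<le> 4 \<open>err k\<close> < 4 M - T.\<close>
  have "\<forall>\<^sub>F k in sequentially. err k < min (\<delta> / 2) ((4 * M - T) / 4)"
    by (rule order_tendstoD(2)[OF lim]) (use M(1) \<open>\<delta> > 0\<close> in auto)
  then show ?thesis
  proof eventually_elim
    case (elim k)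
    show ?case unfolding vertices_gt_def
    proof (intro ballI)
      fix X Y :: int assume XY: "X \<in> {1, -1}" "Y \<in> {1, -1}"
      obtain n m where rep: "represents t y k X Y n m"
        using represents_exists[OF tail par] XY by (metis dvd_minus_iff insertE odd_one singletonD)
      define d where "d = \<bar>n * \<alpha> - m - base_point y\<bar>"
      have "\<bar>re (Suc k) * \<theta> k * X\<bar> \<le> 1"
        using re_cases[of k] XY tail_pos[of k] tail_less_one[of k] by auto
      moreover have "\<bar>real_of_int Y\<bar> \<le> 1" using XY by auto
      ultimately have "\<bar>error_form y k X Y\<bar> \<le> 4" using bdd[of k] unfolding error_form_def by linarith
      moreover have "2 * d = err k * \<bar>error_form y k X Y\<bar>"
      proof -
        have "2 * d = \<bar>2 * (n * \<alpha> - m - base_point y)\<bar>" by (simp only: abs_mult abs_numeral d_def)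
        then show ?thesis using rep err_pos[of k] unfolding represents_def by (simp add: abs_mult)
      qed
      ultimately have d: "2 * d \<le> err k * 4" using err_pos[of k] by simp
      have nd: "nint_dist (of_int n * \<alpha> - \<gamma>) \<le> d"
        using nint_dist_le[of "of_int n * \<alpha> - \<gamma>" "m - j"] unfolding \<gamma>(1) d_def
        by (simp add: algebra_simps)
      then have "\<bar>n\<bar> \<ge> N" using small d elim by fastforce
      then have "M < of_int \<bar>n\<bar> * nint_dist (of_int n * \<alpha> - \<gamma>)" by (rule N)
      also have "\<dots> \<le> of_int \<bar>n\<bar> * d" using nd by (intro mult_left_mono) auto
      finally have "4 * M < \<bar>2 * real_of_int n\<bar> * (2 * d)" by (simp add: abs_mult)
      also have "\<dots> \<le> (\<bar>2 * real_of_int n - 1\<bar> + 1) * (2 * d)"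
        by (intro mult_right_mono) (auto simp: d_def)
      finally have "T < \<bar>2 * real_of_int n - 1\<bar> * (2 * d)"
        using d elim by (simp add: algebra_simps)
      then show "\<bar>denom_form t k X Y\<bar> * \<bar>error_form y k X Y\<bar> > T * \<Delta> k"
        unfolding represents_product[OF rep, symmetric] d_def using Delta_pos[of k] by simp
    qed
  qed
qed

end

section \<open>Bounding the digits of \<open>\<gamma>\<close>\<close>

lemma eventually_le_of_contraction:
  fixes u :: "nat \<Rightarrow> real"
  assumes step: "\<forall>\<^sub>F k in sequentially. u (Suc k) \<le> r * u k + s"
    and r: "0 \<le> r" "r < 1" and C: "s < (1 - r) * C"
  shows "\<forall>\<^sub>F k in sequentially. u k \<le> C"
proof -
  obtain k0 where k0: "\<And>k. k \<ge> k0 \<Longrightarrow> u (Suc k) \<le> r * u k + s"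
    using step unfolding eventually_sequentially by blast
  define l where "l = s / (1 - r)"
  have l: "r * l + s = l" "l < C" using r C by (auto simp: l_def field_simps)
  have bound: "u (k0 + j) - l \<le> r ^ j * \<bar>u k0 - l\<bar>" for j
  proof (induction j)
    case (Suc j)
    have "u (k0 + Suc j) - l \<le> r * u (k0 + j) + s - l" using k0[of "k0 + j"] by simp
    also have "\<dots> = r * (u (k0 + j) - l)" using l(1) by (simp add: algebra_simps)
    also have "\<dots> \<le> r * (r ^ j * \<bar>u k0 - l\<bar>)" using Suc r by (intro mult_left_mono) auto
    finally show ?case by simp
  qed simp
  have "(\<lambda>j. r ^ j * \<bar>u k0 - l\<bar>) \<longlonglongrightarrow> 0 * \<bar>u k0 - l\<bar>"
    using r by (intro tendsto_intros LIMSEQ_power_zero) auto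
  then have "\<forall>\<^sub>F j in sequentially. r ^ j * \<bar>u k0 - l\<bar> < C - l"
    using l(2) order_tendstoD(2) by fastforce
  then have "\<forall>\<^sub>F j in sequentially. u (j + k0) \<le> C"
  proof eventually_elim
    case (elim j)
    then show ?case using bound[of j] by (simp add: add.commute)
  qed
  then show ?thesis by (rule eventually_sequentially_seg[of "\<lambda>k. u k \<le> C" k0, THEN iffD1])
qed

text \<open>For e in [0, 1] multiply the two inequalities: e (1 - e) g (1 - g) is at most 1/16, less
  than 1/9. Outside, one of |e| and |1 - e| is at most 2/5, which pushes g to within 1/6 of an end
  of [0, 1] and makes the other product at most 7/30.\<close>

lemma no_small_pair:
  fixes e g :: real
  assumes e: "-2/5 \<le> e" "e \<le> 7/5" and g: "0 \<le> g" "g \<le> 1"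
    and eg: "\<bar>e\<bar> * g \<ge> 1/3" "\<bar>1 - e\<bar> * (1 - g) \<ge> 1/3"
  shows False
proof -
  consider "e < 0" | "0 \<le> e" "e \<le> 1" | "e > 1" by linarith
  then show False
  proof cases
    case 1
    have "\<bar>e\<bar> * g \<le> 2/5 * g" using 1 e g by (intro mult_right_mono) auto
    from order_trans[OF eg(1) this] have "1 - g \<le> 1/6" by (simp add: field_simps)
    then have "\<bar>1 - e\<bar> * (1 - g) \<le> 7/5 * (1/6)" using 1 e g by (intro mult_mono) auto
    from order_trans[OF eg(2) this] show False by simp
  next
    case 3
    have "\<bar>1 - e\<bar> * (1 - g) \<le> 2/5 * (1 - g)" using 3 e g by (intro mult_right_mono) auto
    from order_trans[OF eg(2) this] have "g \<le> 1/6" by (simp add: field_simps)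
    then have "\<bar>e\<bar> * g \<le> 7/5 * (1/6)" using 3 e g by (intro mult_mono) auto
    from order_trans[OF eg(1) this] show False by simp
  next
    case 2
    have quarter: "x * (1 - x) \<le> 1/4" for x :: real
      using zero_le_power2[of "x - 1/2"] by (simp add: power2_eq_square algebra_simps)
    have "1/3 * (1/3) \<le> (\<bar>e\<bar> * g) * (\<bar>1 - e\<bar> * (1 - g))"
      using eg by (intro mult_mono) auto
    also have "\<dots> = (e * (1 - e)) * (g * (1 - g))" using 2 by simp
    also have "\<dots> \<le> 1/4 * (1/4)" using 2 g quarter by (intro mult_mono) auto
    finally show False by simp
  qed
qed

locale large_digits = semi_regular +
  fixes R :: int
  assumes R_ge: "R \<ge> 4"
    and digits_ge: "\<forall>\<^sub>F k in sequentially. a k \<ge> R"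
begin

section \<open>Asymptotic bounds for tails and denominator quotients\<close>

lemma digits_Suc_ge: "\<forall>\<^sub>F k in sequentially. R \<le> a (Suc k) \<and> 4 \<le> a (Suc k)"
  using eventually_SucD[OF digits_ge] by eventually_elim (use R_ge in auto)

lemma tail_le_step:
  assumes "\<forall>\<^sub>F k in sequentially. \<theta> k \<le> c" "c < 4"
  shows "\<forall>\<^sub>F k in sequentially. \<theta> k \<le> 1 / (ra (Suc k) - c)"
  using eventually_SucD[OF assms(1)] digits_Suc_ge
proof eventually_elim
  case (elim k)
  have "ra (Suc k) \<ge> 4" using elim by simp
  moreover have "ra (Suc k) - c \<le> 1 / \<theta> k"
    using elim re_cases[of "Suc k"] tail_pos[of "Suc k"] unfolding tail_rec by auto
  ultimately show ?case using assms(2) tail_pos[of k] by (simp add: field_simps)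
qed

text \<open>Only a minus sign lets \<open>\<beta> k\<close> reduce the denominator in the recursion,
  so a bound is required just there; that is also where \<beta> < 1 is available as a start.\<close>

lemma beta_le_step:
  assumes "\<forall>\<^sub>F k in sequentially. \<epsilon> (Suc k) = -1 \<longrightarrow> \<beta> k \<le> c" "0 \<le> c" "c < 4"
  shows "\<forall>\<^sub>F k in sequentially. \<beta> (Suc k) \<le> 1 / (ra (Suc k) - c)"
  using assms(1) digits_Suc_ge
proof eventually_elim
  case (elim k)
  have "ra (Suc k) \<ge> 4" using elim by simp
  moreover have "ra (Suc k) - c \<le> 1 / \<beta> (Suc k)"
    using elim eps_cases[of k] beta_nonneg[of k] assms(2) unfolding beta_rec by auto
  ultimately show ?case using assms(3) beta_Suc_pos[of k] by (simp add: field_simps)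
qed

lemma inverse_digit_le:
  assumes "\<forall>\<^sub>F k in sequentially. u k \<le> 1 / (ra (Suc k) - c)" "c < 4"
  shows "\<forall>\<^sub>F k in sequentially. u k \<le> 1 / (4 - c)"
  using assms(1) digits_Suc_ge
proof eventually_elim
  case (elim k)
  have "1 / (ra (Suc k) - c) \<le> 1 / (4 - c)"
    using elim assms(2) by (intro divide_left_mono mult_pos_pos) auto
  then show ?case using elim by linarith
qed

text \<open>The map c to 1 / (4 - c), iterated from 1, gives 1/3, 3/11, 11/41 and decreases to 2 -
  sqrt 3; a few steps yield rational constants close enough to the limit.\<close>

lemma tail_le: "\<forall>\<^sub>F k in sequentially. \<theta> k \<le> 1 / (ra (Suc k) - 3/11)"
proof -
  have "\<forall>\<^sub>F k in sequentially. \<theta> k \<le> 1" using tail_less_one by (simp add: less_imp_le)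
  from inverse_digit_le[OF tail_le_step[OF this]]
  have "\<forall>\<^sub>F k in sequentially. \<theta> k \<le> 1/3" by simp
  from inverse_digit_le[OF tail_le_step[OF this]]
  have "\<forall>\<^sub>F k in sequentially. \<theta> k \<le> 3/11" by simp
  from tail_le_step[OF this] show ?thesis by simp
qed

text \<open>One iteration more than for the tails: with 11/41 in place of 3/11 the fixed point in
  \<open>abs_X_le\<close> is 1 / (R - 52/41), strictly below \<open>\<xi>\<close> instead of equal
  to it.\<close>

lemma beta_le_sharp: "\<forall>\<^sub>F k in sequentially. \<beta> (Suc k) \<le> 1 / (ra (Suc k) - 11/41)"
proof -
  have next_step: "\<forall>\<^sub>F k in sequentially. \<beta> (Suc k) \<le> 1 / (ra (Suc k) - 1 / (4 - c))"
    if "\<forall>\<^sub>F k in sequentially. \<beta> (Suc k) \<le> 1 / (ra (Suc k) - c)" "c \<le> 1" for c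
  proof -
    have "\<forall>\<^sub>F k in sequentially. \<beta> (Suc k) \<le> 1 / (4 - c)"
      using inverse_digit_le[OF that(1)] that(2) by simp
    then have "\<forall>\<^sub>F k in sequentially. \<beta> k \<le> 1 / (4 - c)" by (rule eventually_SucI)
    then have *: "\<forall>\<^sub>F k in sequentially. \<epsilon> (Suc k) = -1 \<longrightarrow> \<beta> k \<le> 1 / (4 - c)"
      by eventually_elim simp
    have "1 / (4 - c) < 4" "0 \<le> 1 / (4 - c)" using that(2) by (auto simp: field_simps)
    then show ?thesis using beta_le_step[OF *] by simp
  qed
  have "\<forall>\<^sub>F k in sequentially. \<epsilon> (Suc k) = -1 \<longrightarrow> \<beta> k \<le> 1"
    using beta_less_one by (simp add: less_imp_le)
  then have "\<forall>\<^sub>F k in sequentially. \<beta> (Suc k) \<le> 1 / (ra (Suc k) - 1)"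
    using beta_le_step by simp
  from next_step[OF this] have "\<forall>\<^sub>F k in sequentially. \<beta> (Suc k) \<le> 1 / (ra (Suc k) - 1/3)" by simp
  from next_step[OF this] have "\<forall>\<^sub>F k in sequentially. \<beta> (Suc k) \<le> 1 / (ra (Suc k) - 3/11)" by simp
  from next_step[OF this] show ?thesis by simp
qed

lemma beta_le: "\<forall>\<^sub>F k in sequentially. \<beta> (Suc k) \<le> 1 / (ra (Suc k) - 3/11)"
  using beta_le_sharp digits_Suc_ge
proof eventually_elim
  case (elim k)
  have "1 / (ra (Suc k) - 11/41) \<le> 1 / (ra (Suc k) - 3/11)"
    using elim by (intro divide_left_mono mult_pos_pos) auto
  then show ?case using elim by linarith
qed

lemma tail_le_const: "\<forall>\<^sub>F k in sequentially. \<theta> k \<le> 11/41"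
  using inverse_digit_le[OF tail_le] by simp

lemma beta_le_const: "\<forall>\<^sub>F k in sequentially. \<beta> k \<le> 11/41"
  by (rule eventually_SucI) (use inverse_digit_le[OF beta_le] in simp)

lemma summable_err: "summable err"
proof -
  obtain N where "\<And>k. k \<ge> N \<Longrightarrow> \<theta> k \<le> 11/41"
    using tail_le_const unfolding eventually_sequentially by blast
  then have "norm (err (Suc k)) \<le> 11/41 * norm (err k)" if "k \<ge> N" for k
    using that err_pos[of k] tail_pos[of k] by (simp add: err_Suc abs_mult)
  then show ?thesis by (intro summable_ratio_test[of "11/41" N]) auto
qed

lemma err_lim: "err \<longlonglongrightarrow> 0"
  by (rule summable_LIMSEQ_zero[OF summable_err])

context
  fixes \<gamma> :: real
begin

section \<open>The alpha-expansion of \<gamma> in centred digits\<close>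

definition t\<^sub>\<gamma> :: "nat \<Rightarrow> int" where "t\<^sub>\<gamma> = t_digit a \<epsilon> \<gamma>"
definition c\<^sub>\<gamma> :: "nat \<Rightarrow> int" where "c\<^sub>\<gamma> = c_digit a \<epsilon> \<gamma>"
definition g :: "nat \<Rightarrow> real" where "g = gamma_rem a \<epsilon> \<gamma>"
definition y\<^sub>\<gamma> :: "nat \<Rightarrow> real" where "y\<^sub>\<gamma> k = 2 * g k - 1 - re (Suc k) * \<theta> k"
text \<open>The analogue of the remainder \<open>g\<close> for the digits up to k: E_{k+1} =
  \<beta>_{k+1} (c_{k+1} - \<epsilon>_{k+1} E_k). At the vertices the first form takes the values
  2E, 2(E + \<beta>), 2(E + \<beta> - 1) and 2(E - 1).\<close>

definition E :: "nat \<Rightarrow> real" where "E k = (1 - \<beta> k + dminus t\<^sub>\<gamma> k) / 2"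

lemma g_bounds: "0 \<le> g k" "g k < 1"
  by (cases k; simp add: g_def frac_lt_1)+

lemma g_eq: "g k = \<theta> k * (c\<^sub>\<gamma> (Suc k) + g (Suc k))"
proof -
  have "c\<^sub>\<gamma> (Suc k) + g (Suc k) = g k / \<theta> k"
    by (simp add: c\<^sub>\<gamma>_def g_def c_digit_def frac_def)
  then show ?thesis using tail_pos[of k] by simp
qed

lemma t_eq: "t\<^sub>\<gamma> (Suc k) = 2 * c\<^sub>\<gamma> (Suc k) - (a (Suc k) - 1 + \<epsilon> (Suc k))"
  by (simp add: t\<^sub>\<gamma>_def c\<^sub>\<gamma>_def t_digit_def)

lemma even_t: "even (a (Suc k) + t\<^sub>\<gamma> (Suc k))"
  unfolding t_eq using eps_cases[of k] by auto

lemma digit_tail_y: "digit_tail t\<^sub>\<gamma> y\<^sub>\<gamma>"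
  unfolding digit_tail_def
proof
  fix k
  have "\<theta> k * (t\<^sub>\<gamma> (Suc k) + y\<^sub>\<gamma> (Suc k)) = 2 * (\<theta> k * (c\<^sub>\<gamma> (Suc k) + g (Suc k)))
      - \<theta> k * (ra (Suc k) + re (Suc (Suc k)) * \<theta> (Suc k)) - re (Suc k) * \<theta> k"
    by (simp add: t_eq y\<^sub>\<gamma>_def algebra_simps)
  also have "\<dots> = y\<^sub>\<gamma> k" unfolding g_eq[symmetric] tail_mult by (simp add: y\<^sub>\<gamma>_def)
  finally show "y\<^sub>\<gamma> k = \<theta> k * (t\<^sub>\<gamma> (Suc k) + y\<^sub>\<gamma> (Suc k))" by simp
qed

lemma base_point_y: "\<gamma> = base_point y\<^sub>\<gamma> + of_int \<lfloor>\<gamma>\<rfloor>"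
  by (simp add: base_point_def y\<^sub>\<gamma>_def g_def frac_def field_simps)

lemma abs_y_le: "\<bar>y\<^sub>\<gamma> k\<bar> \<le> 2"
  using g_bounds[of k] tail_pos[of k] tail_less_one[of k] re_cases[of k] unfolding y\<^sub>\<gamma>_def by auto

lemma dminus_eq: "dminus t\<^sub>\<gamma> k = 2 * E k - 1 + \<beta> k"
  by (simp add: E_def field_simps)

lemma E_Suc: "E (Suc k) = \<beta> (Suc k) * (c\<^sub>\<gamma> (Suc k) - re (Suc k) * E k)"
proof -
  have "2 * E (Suc k) = 1 - \<beta> (Suc k) + \<beta> (Suc k) * (t\<^sub>\<gamma> (Suc k) - re (Suc k) * dminus t\<^sub>\<gamma> k)"
    by (simp add: E_def)
  also have "\<dots> = 1 - \<beta> (Suc k) + \<beta> (Suc k) * (2 * c\<^sub>\<gamma> (Suc k) + 1 - 2 * (re (Suc k) * E k))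
      - \<beta> (Suc k) * (ra (Suc k) + re (Suc k) * \<beta> k)"
    unfolding dminus_eq t_eq by (simp add: algebra_simps)
  finally show ?thesis unfolding beta_mult by (simp add: algebra_simps)
qed

lemma c_nonneg: "c\<^sub>\<gamma> (Suc k) \<ge> 0"
  using g_bounds(1)[of k] tail_pos[of k] by (simp add: c\<^sub>\<gamma>_def c_digit_def g_def)

lemma c_less: "c\<^sub>\<gamma> (Suc k) + g (Suc k) < ra (Suc k) + re (Suc (Suc k)) * \<theta> (Suc k)"
proof -
  have "\<theta> k * (c\<^sub>\<gamma> (Suc k) + g (Suc k)) < \<theta> k * (ra (Suc k) + re (Suc (Suc k)) * \<theta> (Suc k))"
    using g_bounds(2)[of k] unfolding g_eq[symmetric] tail_mult .
  then show ?thesis using tail_pos[of k] by simp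
qed

lemma c_le: "c\<^sub>\<gamma> (Suc k) \<le> a (Suc k)" "\<epsilon> (Suc (Suc k)) = -1 \<Longrightarrow> c\<^sub>\<gamma> (Suc k) \<le> a (Suc k) - 1"
proof -
  have *: "real_of_int (c\<^sub>\<gamma> (Suc k)) < ra (Suc k) + re (Suc (Suc k)) * \<theta> (Suc k)"
    using c_less[of k] g_bounds(1)[of "Suc k"] by linarith
  have "real_of_int (c\<^sub>\<gamma> (Suc k)) < ra (Suc k) + 1"
    using * re_cases[of "Suc k"] tail_pos[of "Suc k"] tail_less_one[of "Suc k"] by auto
  then show "c\<^sub>\<gamma> (Suc k) \<le> a (Suc k)" by linarith
  assume "\<epsilon> (Suc (Suc k)) = -1"
  then have "real_of_int (c\<^sub>\<gamma> (Suc k)) < ra (Suc k)" using * tail_pos[of "Suc k"] by simp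
  then show "c\<^sub>\<gamma> (Suc k) \<le> a (Suc k) - 1" by linarith
qed

section \<open>A priori range of \<open>E\<close>\<close>

lemma beta_mult_le:
  assumes "\<beta> (Suc k) \<le> 1 / (ra (Suc k) - 3/11)" "a (Suc k) \<ge> 4" "u \<ge> - 3/11" "x \<le> ra (Suc k) + u"
  shows "\<beta> (Suc k) * x \<le> 1 + 11/41 * (u + 3/11)"
proof -
  have 4: "ra (Suc k) \<ge> 4" using assms(2) by simp
  have "\<beta> (Suc k) * x \<le> \<beta> (Suc k) * (ra (Suc k) + u)"
    using assms(4) beta_Suc_pos[of k] by simp
  also have "\<dots> \<le> 1 / (ra (Suc k) - 3/11) * (ra (Suc k) + u)"
    using assms(1,3) 4 by (intro mult_right_mono) auto
  also have "\<dots> = 1 + 1 / (ra (Suc k) - 3/11) * (u + 3/11)" using 4 by (simp add: field_simps)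
  also have "1 / (ra (Suc k) - 3/11) * (u + 3/11) \<le> 1 / (4 - 3/11) * (u + 3/11)"
    using 4 assms(3) by (intro mult_right_mono divide_left_mono) auto
  finally show ?thesis by simp
qed

lemma abs_E_le: "\<forall>\<^sub>F k in sequentially. \<bar>E k\<bar> \<le> 3/2"
proof (rule eventually_le_of_contraction)
  \<comment> \<open>Here 44/41 = 1 + 11/41 * 3/11; the fixed point of this recursion is 22/15, below
    3/2.\<close>
  show "\<forall>\<^sub>F k in sequentially. \<bar>E (Suc k)\<bar> \<le> 11/41 * \<bar>E k\<bar> + 44/41"
    using beta_le digits_Suc_ge
  proof eventually_elim
    case (elim k)
    have "\<bar>c\<^sub>\<gamma> (Suc k) - re (Suc k) * E k\<bar> \<le> ra (Suc k) + \<bar>E k\<bar>"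
      using c_nonneg[of k] c_le(1)[of k] re_cases[of k] by auto
    then have "\<beta> (Suc k) * \<bar>c\<^sub>\<gamma> (Suc k) - re (Suc k) * E k\<bar> \<le> 1 + 11/41 * (\<bar>E k\<bar> + 3/11)"
      using elim by (intro beta_mult_le) auto
    then show ?case unfolding E_Suc abs_mult using beta_Suc_pos[of k] by (simp add: field_simps)
  qed
qed auto

text \<open>If \<epsilon>_{k+1} = 1, then \<beta>_{k+1} \<le> 1/4 and E_{k+1} is at least -1/4 * 3/2
  = -3/8. If \<epsilon>_{k+1} = -1, a negative E_k is only passed on with a factor of at most
  11/41.\<close>

lemma E_ge: "\<forall>\<^sub>F k in sequentially. E k \<ge> -2/5"
proof -
  have step: "\<forall>\<^sub>F k in sequentially. E (Suc k) \<ge> - C'"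
    if "\<forall>\<^sub>F k in sequentially. E k \<ge> - C" "C \<ge> 0" "C' \<ge> 3/8" "C' \<ge> 11/41 * C" for C C'
    using that(1) abs_E_le beta_le_const[THEN eventually_SucD] digits_Suc_ge
  proof eventually_elim
    case (elim k)
    show ?case
    proof (cases "\<epsilon> (Suc k) = 1")
      case True
      have "4 * \<beta> (Suc k) \<le> (ra (Suc k) + re (Suc k) * \<beta> k) * \<beta> (Suc k)"
        using elim True beta_nonneg[of k] beta_Suc_pos[of k] by (intro mult_right_mono) auto
      then have "\<beta> (Suc k) \<le> 1/4" using beta_mult[of k] by (simp add: mult.commute)
      then have "\<beta> (Suc k) * E k \<le> 1/4 * (3/2)"
        using elim beta_Suc_pos[of k] by (intro order_trans[OF mult_left_mono mult_right_mono]) auto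
      moreover have "\<beta> (Suc k) * c\<^sub>\<gamma> (Suc k) \<ge> 0" using c_nonneg[of k] beta_Suc_pos[of k] by simp
      ultimately show ?thesis unfolding E_Suc using True that(3) by (simp add: algebra_simps)
    next
      case False
      then have "\<epsilon> (Suc k) = -1" using eps_cases by blast
      then have "E (Suc k) = \<beta> (Suc k) * c\<^sub>\<gamma> (Suc k) + \<beta> (Suc k) * E k"
        unfolding E_Suc by (simp add: algebra_simps)
      moreover have "\<beta> (Suc k) * c\<^sub>\<gamma> (Suc k) \<ge> 0" using c_nonneg[of k] beta_Suc_pos[of k] by simp
      moreover have "\<beta> (Suc k) * E k \<ge> \<beta> (Suc k) * (- C)"
        using elim beta_Suc_pos[of k] by (intro mult_left_mono) auto
      moreover have "\<beta> (Suc k) * C \<le> 11/41 * C"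
        using elim that(2) by (intro mult_right_mono) auto
      ultimately show ?thesis using that(4) by simp
    qed
  qed
  have "\<forall>\<^sub>F k in sequentially. E k \<ge> - (3/2)"
    using abs_E_le by eventually_elim auto
  \<comment> \<open>Two rounds are made because 11/41 * 3/2 is slightly above 2/5.\<close>
  from step[OF this, of "1/2"] have "\<forall>\<^sub>F k in sequentially. E (Suc k) \<ge> - (1/2)" by simp
  from step[OF eventually_SucI[OF this], of "2/5"]
  have "\<forall>\<^sub>F k in sequentially. E (Suc k) \<ge> - 2/5" by simp
  then show ?thesis by (rule eventually_SucI)
qed

text \<open>Before a minus sign c \<le> a - 1, which saves 1 in the recursion. The auxiliary
  \<open>v\<close> ignores E at plus signs, where E enters negatively and E \<ge> -2/5 suffices; its
  floor 8/11 = 1 - 3/11 is the least value for which \<open>beta_mult_le\<close> applies. The fixed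
  point is 11/10.\<close>

lemma E_le_if_minus: "\<forall>\<^sub>F k in sequentially. \<epsilon> (Suc k) = -1 \<longrightarrow> E k \<le> 111/100"
proof -
  define v where "v k = (if \<epsilon> (Suc k) = -1 then max (E k) (8/11) else 8/11)" for k
  have "\<forall>\<^sub>F k in sequentially. v k \<le> 111/100"
  proof (rule eventually_le_of_contraction)
    show "\<forall>\<^sub>F k in sequentially. v (Suc k) \<le> 11/41 * v k + 33/41"
      using beta_le digits_Suc_ge E_ge
    proof eventually_elim
      case (elim k)
      have v: "v k \<ge> 8/11" using max.cobounded2[of "8/11" "E k"] by (auto simp: v_def)
      have "E (Suc k) \<le> 11/41 * v k + 33/41" if minus: "\<epsilon> (Suc (Suc k)) = -1"
      proof -
        have c: "real_of_int (c\<^sub>\<gamma> (Suc k)) \<le> ra (Suc k) - 1"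
          using c_le(2)[OF minus] by (metis of_int_1 of_int_diff of_int_le_iff)
        have "c\<^sub>\<gamma> (Suc k) - re (Suc k) * E k \<le> ra (Suc k) + (v k - 1)"
          using c v elim eps_cases[of k] by (auto simp: v_def)
        then have "E (Suc k) \<le> 1 + 11/41 * ((v k - 1) + 3/11)"
          unfolding E_Suc using elim v by (intro beta_mult_le) auto
        then show ?thesis by (simp add: field_simps)
      qed
      then show ?case using v by (auto simp: v_def[of "Suc k"])
    qed
  qed auto
  then show ?thesis by (rule eventually_mono) (auto simp: v_def split: if_splits)
qed

lemma E_le: "\<forall>\<^sub>F k in sequentially. E k \<le> 7/5"
proof (rule eventually_SucI)
  show "\<forall>\<^sub>F k in sequentially. E (Suc k) \<le> 7/5"
    using beta_le digits_Suc_ge E_ge E_le_if_minus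
  proof eventually_elim
    case (elim k)
    have "c\<^sub>\<gamma> (Suc k) - re (Suc k) * E k \<le> ra (Suc k) + 111/100"
      using elim eps_cases[of k] c_le(1)[of k] by auto
    then have "E (Suc k) \<le> 1 + 11/41 * (111/100 + 3/11)"
      unfolding E_Suc using elim by (intro beta_mult_le) auto
    then show ?case by simp
  qed
qed

section \<open>Signs of the factors in the vertex values\<close>

lemma vertex_values:
  assumes "vertices_gt t\<^sub>\<gamma> y\<^sub>\<gamma> T k"
  shows "\<bar>E k\<bar> * g k > T * \<Delta> k / 4"
    and "\<bar>E k + \<beta> k\<bar> * (1 - g k) > T * \<Delta> k / 4"
    and "\<bar>1 - \<beta> k - E k\<bar> * \<bar>1 + re (Suc k) * \<theta> k - g k\<bar> > T * \<Delta> k / 4"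
    and "\<bar>1 - E k\<bar> * \<bar>g k - re (Suc k) * \<theta> k\<bar> > T * \<Delta> k / 4"
proof -
  have *: "\<bar>denom_form t\<^sub>\<gamma> k X Y\<bar> * \<bar>error_form y\<^sub>\<gamma> k X Y\<bar> > T * \<Delta> k"
    if "X \<in> {1, -1}" "Y \<in> {1, -1}" for X Y
    using assms that unfolding vertices_gt_def by blast
  have d: "denom_form t\<^sub>\<gamma> k X Y = X - \<beta> k * Y + (2 * E k - 1 + \<beta> k)" for X Y
    by (simp add: denom_form_def dminus_eq)
  have e: "error_form y\<^sub>\<gamma> k X Y = Y + re (Suc k) * \<theta> k * X + (2 * g k - 1 - re (Suc k) * \<theta> k)" for X Y
    by (simp add: error_form_def y\<^sub>\<gamma>_def)
  have dbl: "\<bar>u\<bar> * \<bar>v\<bar> > T * \<Delta> k / 4" if "\<bar>2 * u\<bar> * \<bar>2 * v\<bar> > T * \<Delta> k" for u v :: real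
    using that unfolding abs_mult by simp
  have "\<bar>2 * E k\<bar> * \<bar>2 * g k\<bar> > T * \<Delta> k"
    using *[of 1 1] unfolding d e by simp
  from dbl[OF this] show "\<bar>E k\<bar> * g k > T * \<Delta> k / 4" using g_bounds[of k] by simp
  have "\<bar>2 * (E k + \<beta> k)\<bar> * \<bar>2 * (g k - 1)\<bar> > T * \<Delta> k"
    using *[of 1 "-1"] unfolding d e by (simp add: algebra_simps)
  from dbl[OF this] show "\<bar>E k + \<beta> k\<bar> * (1 - g k) > T * \<Delta> k / 4" using g_bounds[of k] by simp
  have "\<bar>2 * (E k + \<beta> k - 1)\<bar> * \<bar>2 * (g k - 1 - re (Suc k) * \<theta> k)\<bar> > T * \<Delta> k"
    using *[of "-1" "-1"] unfolding d e by (simp add: algebra_simps)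
  from dbl[OF this] show "\<bar>1 - \<beta> k - E k\<bar> * \<bar>1 + re (Suc k) * \<theta> k - g k\<bar> > T * \<Delta> k / 4"
    by (smt (verit))
  have "\<bar>2 * (E k - 1)\<bar> * \<bar>2 * (g k - re (Suc k) * \<theta> k)\<bar> > T * \<Delta> k"
    using *[of "-1" 1] unfolding d e by (simp add: algebra_simps)
  from dbl[OF this] show "\<bar>1 - E k\<bar> * \<bar>g k - re (Suc k) * \<theta> k\<bar> > T * \<Delta> k / 4"
    by (simp add: abs_minus_commute)
qed

text \<open>With \<open>T * S k\<close> at least 4/3, the quarter vertex values exceed 1/3 after
  division by \<theta>_k at level k, or by \<beta>_{k+1} at level k + 1. The bounds on E are the
  range of \<open>no_small_pair\<close>, with room for adding \<beta> at minus signs.\<close>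

definition admissible :: "real \<Rightarrow> nat \<Rightarrow> bool" where
  "admissible T k \<longleftrightarrow> vertices_gt t\<^sub>\<gamma> y\<^sub>\<gamma> T k \<and> 4/3 \<le> T * S k \<and> \<beta> k \<le> 3/11 \<and>
     -2/5 \<le> E k \<and> E k \<le> 7/5 \<and> (\<epsilon> (Suc k) = -1 \<longrightarrow> E k \<le> 111/100)"

lemma cancel_scale: "(s :: real) > 0 \<Longrightarrow> s * x > T * (s * z) / 4 \<Longrightarrow> x > T * z / 4"
proof -
  assume s: "s > 0" "s * x > T * (s * z) / 4"
  then have "s * (T * z / 4) < s * x" by (simp add: mult_ac)
  then show "x > T * z / 4" using s(1) by simp
qed

lemma no_small_pair_scaled:
  fixes s T z e h :: real
  assumes "s > 0" "4/3 \<le> T * z" "-2/5 \<le> e" "e \<le> 7/5" "0 \<le> h" "h \<le> 1"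
    and "s * (\<bar>e\<bar> * h) > T * (s * z) / 4" "s * (\<bar>1 - e\<bar> * (1 - h)) > T * (s * z) / 4"
  shows False
proof (rule no_small_pair[OF assms(3-6)])
  show "1/3 \<le> \<bar>e\<bar> * h" using cancel_scale[OF assms(1,7)] assms(2) by simp
  show "1/3 \<le> \<bar>1 - e\<bar> * (1 - h)" using cancel_scale[OF assms(1,8)] assms(2) by simp
qed

text \<open>Half of the second form at X = -1, Y = 1, as \<open>g\<close> is half of it at X = Y =
  1.\<close>

definition h :: "nat \<Rightarrow> real" where "h k = g k - re (Suc k) * \<theta> k"

text \<open>Two cases are in doubt. If \<epsilon> = 1 and g = \<theta> r with r \<le> 1, the
  vertices with Y = 1 put |E| r and |1 - E| (1 - r) above 1/3. If \<epsilon> = -1 and 1 - g =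
  \<theta> r with r \<le> 1, those with Y = -1 do the same for E + \<beta>, which the bound 111/100
  keeps below 7/5.\<close>

lemma h_bounds:
  assumes "admissible T k"
  shows "0 < h k" "h k < 1"
proof -
  note ad = assms[unfolded admissible_def]
  note v = vertex_values[OF conjunct1[OF ad], unfolded Delta_eq_tail]
  have pos: "\<theta> k > 0" by (rule tail_pos)
  have "\<not> (\<epsilon> (Suc k) = 1 \<and> g k \<le> \<theta> k)"
  proof
    assume *: "\<epsilon> (Suc k) = 1 \<and> g k \<le> \<theta> k"
    define r where "r = g k / \<theta> k"
    have r: "g k = \<theta> k * r" "0 \<le> r" "r \<le> 1"
      using * pos g_bounds[of k] by (auto simp: r_def)
    have "\<bar>g k - \<theta> k\<bar> = \<theta> k * (1 - r)" using * r(1) pos by (simp add: algebra_simps)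
    then have "\<theta> k * (\<bar>1 - E k\<bar> * (1 - r)) > T * (\<theta> k * S k) / 4"
      using v(4) * by (simp add: mult_ac)
    moreover have "\<theta> k * (\<bar>E k\<bar> * r) > T * (\<theta> k * S k) / 4"
      using v(1) r(1) by (simp add: mult_ac)
    ultimately show False
      using no_small_pair_scaled[of "\<theta> k" T "S k" "E k" r] pos ad r by blast
  qed
  moreover have "\<not> (\<epsilon> (Suc k) = -1 \<and> 1 - g k \<le> \<theta> k)"
  proof
    assume *: "\<epsilon> (Suc k) = -1 \<and> 1 - g k \<le> \<theta> k"
    define r where "r = (1 - g k) / \<theta> k"
    have r: "1 - g k = \<theta> k * r" "0 \<le> r" "r \<le> 1"
      using * pos g_bounds[of k] by (auto simp: r_def)
    have "1 + re (Suc k) * \<theta> k - g k = - (\<theta> k * (1 - r))"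
      using * r(1) by (simp add: algebra_simps)
    then have "\<bar>1 + re (Suc k) * \<theta> k - g k\<bar> = \<theta> k * (1 - r)"
      using pos r(3) by (simp add: abs_mult)
    then have "\<theta> k * (\<bar>1 - (E k + \<beta> k)\<bar> * (1 - r)) > T * (\<theta> k * S k) / 4"
      using v(3) by (simp add: mult_ac diff_diff_eq add.commute)
    moreover have "\<theta> k * (\<bar>E k + \<beta> k\<bar> * r) > T * (\<theta> k * S k) / 4"
      using v(2) r(1) by (simp add: mult_ac)
    moreover have "-2/5 \<le> E k + \<beta> k" "E k + \<beta> k \<le> 7/5"
      using ad * beta_nonneg[of k] by auto
    ultimately show False
      using no_small_pair_scaled[of "\<theta> k" T "S k" "E k + \<beta> k" r] pos ad r by blast
  qed
  ultimately show "0 < h k" "h k < 1"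
    using eps_cases[of k] pos g_bounds[of k] by (auto simp: h_def)
qed

text \<open>A nonpositive E_{k+1} equals -\<beta>_{k+1} e with 0 \<le> e \<le> 7/5, and the vertices
  with X = 1 turn into the forbidden pair e, g_{k+1}.\<close>

lemma E_pos:
  assumes "admissible T k" "admissible T (Suc k)"
  shows "0 < E (Suc k)"
proof (rule ccontr)
  assume neg: "\<not> 0 < E (Suc k)"
  note ad = assms(1)[unfolded admissible_def]
  note v = vertex_values[OF conjunct1[OF assms(2)[unfolded admissible_def]], unfolded Delta_eq_beta]
  have pos: "\<beta> (Suc k) > 0" by (rule beta_Suc_pos)
  define e where "e = re (Suc k) * E k - c\<^sub>\<gamma> (Suc k)"
  have E: "E (Suc k) = - (\<beta> (Suc k) * e)" unfolding E_Suc e_def by (simp add: algebra_simps)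
  have "\<beta> (Suc k) * e \<ge> 0" using neg E by simp
  then have "e \<ge> 0" using pos by (simp add: zero_le_mult_iff)
  moreover have "e \<le> 7/5" using ad eps_cases[of k] c_nonneg[of k] by (auto simp: e_def)
  moreover have "\<bar>E (Suc k)\<bar> = \<beta> (Suc k) * \<bar>e\<bar>" unfolding E using pos by (simp add: abs_mult)
  then have "\<beta> (Suc k) * (\<bar>e\<bar> * g (Suc k)) > T * (\<beta> (Suc k) * S k) / 4"
    using v(1) by (simp add: mult_ac)
  moreover have "E (Suc k) + \<beta> (Suc k) = \<beta> (Suc k) * (1 - e)" unfolding E by (simp add: algebra_simps)
  then have "\<bar>E (Suc k) + \<beta> (Suc k)\<bar> = \<beta> (Suc k) * \<bar>1 - e\<bar>" using pos by (simp add: abs_mult)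
  then have "\<beta> (Suc k) * (\<bar>1 - e\<bar> * (1 - g (Suc k))) > T * (\<beta> (Suc k) * S k) / 4"
    using v(2) by (simp add: mult_ac)
  ultimately show False
    using no_small_pair_scaled[of "\<beta> (Suc k)" T "S k" e "g (Suc k)"] pos ad g_bounds[of "Suc k"] by auto
qed

lemma one_minus_g: "1 - g k = \<theta> k * (ra (Suc k) - c\<^sub>\<gamma> (Suc k) - h (Suc k))"
proof -
  have "\<theta> k * (ra (Suc k) - c\<^sub>\<gamma> (Suc k) - h (Suc k))
      = \<theta> k * (ra (Suc k) + re (Suc (Suc k)) * \<theta> (Suc k)) - \<theta> k * (c\<^sub>\<gamma> (Suc k) + g (Suc k))"
    by (simp add: h_def algebra_simps)
  then show ?thesis unfolding tail_mult g_eq[symmetric] by simp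
qed

lemma one_minus_h: "1 - h k = \<theta> k * (ra (Suc k) - c\<^sub>\<gamma> (Suc k) - h (Suc k) + re (Suc k))"
  using one_minus_g[of k] by (simp add: h_def algebra_simps)

lemma one_minus_E:
  "1 - E (Suc k) = \<beta> (Suc k) * (ra (Suc k) - c\<^sub>\<gamma> (Suc k) + re (Suc k) * (E k + \<beta> k))"
proof -
  have "\<beta> (Suc k) * (ra (Suc k) - c\<^sub>\<gamma> (Suc k) + re (Suc k) * (E k + \<beta> k))
      = \<beta> (Suc k) * (ra (Suc k) + re (Suc k) * \<beta> k) - E (Suc k)"
    unfolding E_Suc by (simp add: algebra_simps)
  then show ?thesis unfolding beta_mult by simp
qed

text \<open>The mirror image of \<open>E_pos\<close>: otherwise 1 - E_{k+1} = \<beta>_{k+1} e with e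
  \<le> 1, and the vertices with X = -1 give the forbidden pair e, h_{k+1}.\<close>

lemma E_less:
  assumes "admissible T k" "admissible T (Suc k)"
  shows "E (Suc k) < 1 - \<beta> (Suc k)"
proof (rule ccontr)
  assume neg: "\<not> ?thesis"
  note ad = assms(1)[unfolded admissible_def]
  note v = vertex_values[OF conjunct1[OF assms(2)[unfolded admissible_def]], unfolded Delta_eq_beta]
  have pos: "\<beta> (Suc k) > 0" by (rule beta_Suc_pos)
  define e where "e = ra (Suc k) - c\<^sub>\<gamma> (Suc k) + re (Suc k) * (E k + \<beta> k)"
  have E: "1 - E (Suc k) = \<beta> (Suc k) * e" unfolding one_minus_E e_def ..
  have "\<beta> (Suc k) * e \<le> \<beta> (Suc k) * 1" using neg E by simp
  then have "e \<le> 7/5" using pos by simp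
  moreover have "-2/5 \<le> e"
  proof (cases "\<epsilon> (Suc k) = 1")
    case True
    then show ?thesis using ad c_le(1)[of k] beta_nonneg[of k] by (simp add: e_def)
  next
    case False
    then have minus: "\<epsilon> (Suc k) = -1" using eps_cases by blast
    \<comment> \<open>The general bound c \<le> a is too weak to give e \<ge> -2/5 here; h_k < 1 and
      h_{k+1} > 0 improve it to c \<le> a - 2.\<close>
    have "\<theta> k * (ra (Suc k) - c\<^sub>\<gamma> (Suc k) - h (Suc k) + re (Suc k)) > \<theta> k * 0"
      using h_bounds(2)[OF assms(1)] unfolding one_minus_h[symmetric] by simp
    then have "ra (Suc k) - c\<^sub>\<gamma> (Suc k) - h (Suc k) + re (Suc k) > 0"
      using tail_pos[of k] by (simp only: mult_less_cancel_left_pos)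
    then have "real_of_int (c\<^sub>\<gamma> (Suc k)) < ra (Suc k) - 1"
      using h_bounds(1)[OF assms(2)] minus by simp
    then have "c\<^sub>\<gamma> (Suc k) \<le> a (Suc k) - 2" by linarith
    then have "real_of_int (c\<^sub>\<gamma> (Suc k)) \<le> ra (Suc k) - 2" by linarith
    then show ?thesis using ad minus unfolding e_def by simp
  qed
  moreover have "\<bar>1 - E (Suc k)\<bar> = \<beta> (Suc k) * \<bar>e\<bar>" unfolding E using pos by (simp add: abs_mult)
  then have "\<beta> (Suc k) * (\<bar>e\<bar> * h (Suc k)) > T * (\<beta> (Suc k) * S k) / 4"
    using v(4) h_bounds[OF assms(2)] by (simp add: mult_ac h_def)
  moreover have "1 - \<beta> (Suc k) - E (Suc k) = \<beta> (Suc k) * (e - 1)"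
    using E by (simp add: algebra_simps)
  then have "\<bar>1 - \<beta> (Suc k) - E (Suc k)\<bar> = \<beta> (Suc k) * \<bar>1 - e\<bar>"
    using pos by (simp add: abs_mult abs_minus_commute)
  then have "\<beta> (Suc k) * (\<bar>1 - e\<bar> * (1 - h (Suc k))) > T * (\<beta> (Suc k) * S k) / 4"
    using v(3) h_bounds[OF assms(2)] by (simp add: mult_ac h_def algebra_simps)
  ultimately show False
    using no_small_pair_scaled[of "\<beta> (Suc k)" T "S k" e "h (Suc k)"] pos ad h_bounds[OF assms(2)]
    by auto
qed

text \<open>The four vertex values at levels \<open>k\<close> and \<open>k + 1\<close> that shrink when \<open>t\<^sub>k\<^sub>+\<^sub>1\<close> grows add up to
  exactly \<open>a\<^sub>k\<^sub>+\<^sub>1 - t\<^sub>k\<^sub>+\<^sub>1\<close> (in units of \<open>S k\<close>), and the other four to \<open>a\<^sub>k\<^sub>+\<^sub>1 + t\<^sub>k\<^sub>+\<^sub>1\<close>.\<close>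

lemma digit_bound_step:
  assumes "admissible T k" "admissible T (Suc k)" "0 < E k" "E k < 1 - \<beta> k"
  shows "T * S k < ra (Suc k) - \<bar>t\<^sub>\<gamma> (Suc k)\<bar>"
proof -
  note v = vertex_values[OF conjunct1[OF assms(1)[unfolded admissible_def]], unfolded Delta_eq_tail]
  note v' = vertex_values[OF conjunct1[OF assms(2)[unfolded admissible_def]], unfolded Delta_eq_beta]
  note pos = tail_pos[of k] beta_Suc_pos[of k]
  note hb = h_bounds[OF assms(1)] h_bounds[OF assms(2)]
  note Eb = E_pos[OF assms(1,2)] E_less[OF assms(1,2)]
  let ?A = "ra (Suc k)" and ?c = "real_of_int (c\<^sub>\<gamma> (Suc k))" and ?e = "re (Suc k)"
  let ?B = "\<beta> (Suc k)" and ?h = "h (Suc k)" and ?g = "g (Suc k)"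
  \<comment> \<open>These are (1 - E_{k+1}) / \<beta>_{k+1} and E_{k+1} / \<beta>_{k+1}, so
    \<beta>_{k+1} cancels at level k + 1 as \<theta>_k does at level k.\<close>
  define P where "P = ?A - ?c + ?e * (E k + \<beta> k)"
  define Q where "Q = ?c - ?e * E k"
  have "1 - ?B - E (Suc k) = ?B * (P - 1)" using one_minus_E[of k] by (simp add: P_def algebra_simps)
  moreover have "\<bar>1 - ?B - E (Suc k)\<bar> * (1 - ?h) > T * (?B * S k) / 4"
    using v'(3) hb by (simp add: h_def algebra_simps)
  ultimately have "?B * ((P - 1) * (1 - ?h)) > T * (?B * S k) / 4" using Eb by (simp add: mult_ac)
  then have a1: "(P - 1) * (1 - ?h) > T * S k / 4" using cancel_scale pos by blast
  have "\<bar>1 - E (Suc k)\<bar> * ?h > T * (?B * S k) / 4" using v'(4) hb by (simp add: h_def)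
  moreover have "\<bar>1 - E (Suc k)\<bar> = ?B * P"
    using Eb pos one_minus_E[of k] unfolding P_def by simp
  ultimately have "?B * (P * ?h) > T * (?B * S k) / 4" by (simp add: mult_ac)
  then have a2: "P * ?h > T * S k / 4" using cancel_scale pos by blast
  have "\<theta> k * ((E k + \<beta> k) * (?A - ?c - ?h)) > T * (\<theta> k * S k) / 4"
    using v(2) assms(3) beta_nonneg[of k] unfolding one_minus_g by (simp add: mult_ac)
  then have a3: "(E k + \<beta> k) * (?A - ?c - ?h) > T * S k / 4" using cancel_scale pos by blast
  have "\<bar>1 - \<beta> k - E k\<bar> * (1 - h k) > T * (\<theta> k * S k) / 4"
    using v(3) hb by (simp add: h_def algebra_simps)
  then have "\<theta> k * ((1 - \<beta> k - E k) * (?A - ?c - ?h + ?e)) > T * (\<theta> k * S k) / 4"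
    using assms(4) unfolding one_minus_h by (simp add: mult_ac)
  then have a4: "(1 - \<beta> k - E k) * (?A - ?c - ?h + ?e) > T * S k / 4" using cancel_scale pos by blast
  \<comment> \<open>The weights 1 - h_{k+1} and h_{k+1} sum to 1, as do E_k + \<beta>_k and 1 -
    \<beta>_k - E_k; hence E, \<beta> and h cancel and 2 (a - c) - 1 + \<epsilon> = a - t
    remains.\<close>
  have "(P - 1) * (1 - ?h) + P * ?h + (E k + \<beta> k) * (?A - ?c - ?h)
      + (1 - \<beta> k - E k) * (?A - ?c - ?h + ?e) = ?A - t\<^sub>\<gamma> (Suc k)"
    unfolding t_eq P_def by (simp add: algebra_simps)
  then have upper: "T * S k < ?A - t\<^sub>\<gamma> (Suc k)" using a1 a2 a3 a4 by linarith
  have E': "E (Suc k) = ?B * Q" unfolding E_Suc Q_def ..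
  have "?B * (Q * ?g) > T * (?B * S k) / 4" using v'(1) Eb unfolding E' by (simp add: mult_ac)
  then have b1: "Q * ?g > T * S k / 4" using cancel_scale pos by blast
  have "E (Suc k) + ?B = ?B * (Q + 1)" unfolding E' by (simp add: algebra_simps)
  moreover have "\<bar>E (Suc k) + ?B\<bar> = E (Suc k) + ?B" using Eb pos by simp
  ultimately have "?B * ((Q + 1) * (1 - ?g)) > T * (?B * S k) / 4"
    using v'(2) by (simp add: mult_ac)
  then have b2: "(Q + 1) * (1 - ?g) > T * S k / 4" using cancel_scale pos by blast
  have "g k = \<theta> k * (?c + ?g)" by (rule g_eq)
  then have "\<theta> k * (E k * (?c + ?g)) > T * (\<theta> k * S k) / 4"
    using v(1) assms(3) by (simp add: mult_ac)
  then have b3: "E k * (?c + ?g) > T * S k / 4" using cancel_scale pos by blast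
  have "h k = \<theta> k * (?c + ?g - ?e)" using g_eq[of k] by (simp add: h_def algebra_simps)
  moreover have "(1 - E k) * h k > T * (\<theta> k * S k) / 4"
    using v(4) assms(4) beta_nonneg[of k] hb by (simp add: h_def)
  ultimately have "\<theta> k * ((1 - E k) * (?c + ?g - ?e)) > T * (\<theta> k * S k) / 4" by (simp add: mult_ac)
  then have b4: "(1 - E k) * (?c + ?g - ?e) > T * S k / 4" using cancel_scale pos by blast
  have "Q * ?g + (Q + 1) * (1 - ?g) + E k * (?c + ?g) + (1 - E k) * (?c + ?g - ?e)
      = ?A + t\<^sub>\<gamma> (Suc k)"
    unfolding t_eq Q_def by (simp add: algebra_simps)
  then have "T * S k < ?A + t\<^sub>\<gamma> (Suc k)" using b1 b2 b3 b4 by linarith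
  with upper show ?thesis by linarith
qed

lemma digit_bound:
  assumes "\<gamma> \<notin> homogeneous_values \<alpha>" "ereal (T / 4) < inhom_const \<alpha> \<gamma>"
    and TS: "\<forall>\<^sub>F k in sequentially. 4/3 \<le> T * S k"
  shows "\<forall>\<^sub>F k in sequentially. T * S k < ra (Suc k) - \<bar>t_digit a \<epsilon> \<gamma> (Suc k)\<bar>"
proof -
  have "\<forall>\<^sub>F k in sequentially. vertices_gt t\<^sub>\<gamma> y\<^sub>\<gamma> T k"
    by (rule vertices_gt_of_inhom_const[OF digit_tail_y even_t abs_y_le err_lim base_point_y assms(1,2)])
  then have ad: "\<forall>\<^sub>F k in sequentially. admissible T k"
    using TS beta_le_const E_ge E_le E_le_if_minus
    by eventually_elim (auto simp: admissible_def)
  have "\<forall>\<^sub>F k in sequentially. 0 < E (Suc k) \<and> E (Suc k) < 1 - \<beta> (Suc k)"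
    using ad eventually_SucD[OF ad] by eventually_elim (use E_pos E_less in blast)
  then have "\<forall>\<^sub>F k in sequentially. 0 < E k \<and> E k < 1 - \<beta> k" by (rule eventually_SucI)
  with ad eventually_SucD[OF ad] show ?thesis
    by eventually_elim (use digit_bound_step t\<^sub>\<gamma>_def in auto)
qed

end

end

section \<open>The digits of \<open>\<gamma>\<^sub>*\<close>\<close>

context large_digits
begin

abbreviation \<mu> :: "nat \<Rightarrow> int" where "\<mu> \<equiv> odd_sign a"

text \<open>The sign of the next nonzero \<open>\<lambda>\<^sub>i\<close> with \<open>i > k\<close>, if there is one.\<close>

definition next_sign :: "nat \<Rightarrow> int" where
  "next_sign k = (-1) ^ Suc (card {j \<in> {1..k}. odd (a j)})"

definition y_star :: "nat \<Rightarrow> real" where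
  "y_star k = (\<Sum>i. \<mu> (Suc (i + k)) * err (Suc (i + k))) / err k"

text \<open>Multiplying by the sign of the next nonzero \<lambda>_i removes the alternation: Y
  becomes eventually nonnegative, and the latest nonzero \<lambda>_i always enters X with a minus
  sign.\<close>

definition Y :: "nat \<Rightarrow> real" where "Y k = next_sign k * y_star k"
definition X :: "nat \<Rightarrow> real" where "X k = next_sign k * dminus \<mu> k"

lemma next_sign_cases: "next_sign k = 1 \<or> next_sign k = -1"
  unfolding next_sign_def by (metis neg_one_even_power neg_one_odd_power)

lemma card_odd_Suc:
  "card {j \<in> {1..Suc k}. odd (a j)}
    = (if odd (a (Suc k)) then Suc (card {j \<in> {1..k}. odd (a j)}) else card {j \<in> {1..k}. odd (a j)})"
proof -
  have "{j \<in> {1..Suc k}. odd (a j)} = (if odd (a (Suc k)) then insert (Suc k) {j \<in> {1..k}. odd (a j)}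
      else {j \<in> {1..k}. odd (a j)})"
    by (auto simp: le_Suc_eq)
  then show ?thesis by simp
qed

lemma odd_digit:
  assumes "odd (a (Suc k))"
  shows "\<mu> (Suc k) = - next_sign (Suc k)" "next_sign k = - next_sign (Suc k)"
  using assms unfolding odd_sign_def next_sign_def card_odd_Suc by simp_all

lemma even_digit:
  assumes "even (a (Suc k))"
  shows "\<mu> (Suc k) = 0" "next_sign k = next_sign (Suc k)"
  using assms unfolding odd_sign_def next_sign_def card_odd_Suc by simp_all

lemma abs_sign_le: "\<bar>\<mu> k\<bar> \<le> 1"
  by (simp add: odd_sign_def)

lemma even_sign: "even (a (Suc k) + \<mu> (Suc k))"
  by (simp add: odd_sign_def)

lemma summable_sign_err: "summable (\<lambda>i. \<mu> (Suc (i + k)) * err (Suc (i + k)))"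
proof (rule summable_comparison_test')
  show "summable (\<lambda>i. err (i + Suc k))"
    using summable_err by (subst summable_iff_shift)
  have "\<bar>real_of_int (\<mu> j)\<bar> * err j \<le> 1 * err j" for j
    using abs_sign_le[of j] err_pos[of j] by (intro mult_right_mono) auto
  then show "norm (\<mu> (Suc (i + k)) * err (Suc (i + k))) \<le> err (i + Suc k)" if "i \<ge> 0" for i
    using err_pos[of "Suc (i + k)"] by (simp add: abs_mult)
qed

lemma digit_tail_star: "digit_tail \<mu> y_star"
  unfolding digit_tail_def
proof
  fix k
  have "(\<Sum>i. \<mu> (Suc (i + k)) * err (Suc (i + k)))
      = (\<Sum>i. \<mu> (Suc (Suc i + k)) * err (Suc (Suc i + k))) + \<mu> (Suc k) * err (Suc k)"
    using suminf_split_head[OF summable_sign_err[of k]] by simp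
  then have "y_star k * err k = y_star (Suc k) * err (Suc k) + \<mu> (Suc k) * err (Suc k)"
    using err_pos[of k] err_pos[of "Suc k"] by (simp add: y_star_def)
  then have "err k * y_star k = err k * (\<theta> k * (\<mu> (Suc k) + y_star (Suc k)))"
    by (simp add: err_Suc algebra_simps)
  then show "y_star k = \<theta> k * (\<mu> (Suc k) + y_star (Suc k))" using err_pos[of k] by simp
qed

text \<open>From a_{i+1} D_i = D_{i-1} - \<epsilon>_{i+2} D_{i+1}, twice the part of a term without
  \<lambda> is F_i - F_{i+1} with F_i = D_{i-1} + \<epsilon>_{i+1} D_i; what is left is the series
  in \<open>y_star\<close>.\<close>

lemma gamma_star_eq: "gamma_star a \<epsilon> \<alpha> = base_point y_star"
proof -
  define F where "F i = err i + re (Suc i) * err (Suc i)" for i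
  have "F \<longlonglongrightarrow> 0"
  proof (rule Lim_null_comparison)
    show "\<forall>\<^sub>F i in sequentially. norm (F i) \<le> err i + err (Suc i)"
    proof (rule always_eventually, rule allI)
      fix i show "norm (F i) \<le> err i + err (Suc i)"
        using re_cases[of i] err_pos[of i] err_pos[of "Suc i"] by (auto simp: F_def)
    qed
    show "(\<lambda>i. err i + err (Suc i)) \<longlonglongrightarrow> 0"
      using tendsto_add[OF err_lim LIMSEQ_Suc[OF err_lim]] by simp
  qed
  then have "(\<lambda>i. F i - F (Suc i)) sums F 0" using telescope_sums'[of F 0] by simp
  then have "(\<lambda>i. 1/2 * (F i - F (Suc i)) + 1/2 * (\<mu> (Suc (i + 0)) * err (Suc (i + 0))))
      sums (1/2 * F 0 + 1/2 * (\<Sum>i. \<mu> (Suc (i + 0)) * err (Suc (i + 0))))"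
    by (intro sums_add sums_mult summable_sums summable_sign_err)
  moreover have "(\<lambda>i. 1/2 * (F i - F (Suc i)) + 1/2 * (\<mu> (Suc (i + 0)) * err (Suc (i + 0))))
      = (\<lambda>i. 1/2 * of_int (a (i + 1) - 1 + \<epsilon> (i + 1) + \<mu> (i + 1)) * conv_err a \<epsilon> \<alpha> i)"
  proof
    fix i
    have "ra (Suc i) * err (Suc i) = err i * (\<theta> i * (ra (Suc i) + re (Suc (Suc i)) * \<theta> (Suc i)))
        - re (Suc (Suc i)) * err (Suc (Suc i))"
      by (simp add: err_Suc algebra_simps)
    then have "ra (Suc i) * err (Suc i) = err i - re (Suc (Suc i)) * err (Suc (Suc i))"
      by (simp add: tail_mult)
    then show "1/2 * (F i - F (Suc i)) + 1/2 * (\<mu> (Suc (i + 0)) * err (Suc (i + 0)))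
      = 1/2 * of_int (a (i + 1) - 1 + \<epsilon> (i + 1) + \<mu> (i + 1)) * conv_err a \<epsilon> \<alpha> i"
      by (simp add: F_def conv_err_eq algebra_simps)
  qed
  ultimately have "(\<lambda>i. 1/2 * of_int (a (i + 1) - 1 + \<epsilon> (i + 1) + \<mu> (i + 1)) * conv_err a \<epsilon> \<alpha> i)
      sums (1/2 * F 0 + 1/2 * (\<Sum>i. \<mu> (Suc (i + 0)) * err (Suc (i + 0))))"
    by (simp only:)
  from sums_unique[OF this] have "gamma_star a \<epsilon> \<alpha>
      = 1/2 * F 0 + 1/2 * (\<Sum>i. \<mu> (Suc (i + 0)) * err (Suc (i + 0)))"
    unfolding gamma_star_def by (rule sym)
  then show ?thesis by (simp add: base_point_def y_star_def F_def err_Suc field_simps)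
qed

lemma abs_y_star_le: "\<forall>\<^sub>F k in sequentially. \<bar>y_star k\<bar> \<le> 1/2"
proof -
  obtain N where N: "\<And>k. k \<ge> N \<Longrightarrow> \<theta> k \<le> 11/41"
    using tail_le_const unfolding eventually_sequentially by blast
  have "\<bar>y_star k\<bar> \<le> 1/2" if "k \<ge> N" for k
  proof -
    \<comment> \<open>Relaxing 11/41 to 1/3 makes the geometric series 1/3 + 1/9 + ... equal to the
      claimed 1/2.\<close>
    have bound: "err (i + k) \<le> err k * (1/3) ^ i" for i
    proof (induction i)
      case (Suc i)
      have "err (i + k) * \<theta> (i + k) \<le> (err k * (1/3) ^ i) * (1/3)"
        using Suc N[of "i + k"] that err_pos[of "i + k"] err_pos[of k] tail_pos[of "i + k"]
        by (intro mult_mono) auto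
      then show ?case by (simp add: err_Suc)
    qed simp
    have geo: "(\<lambda>i. err k * (1/3) * (1/3) ^ i) sums (err k * (1/3) * (1 / (1 - 1/3)))"
      by (intro sums_mult geometric_sums) auto
    have "norm (\<mu> (Suc (i + k)) * err (Suc (i + k))) \<le> err k * (1/3) * (1/3) ^ i" for i
    proof -
      have "\<bar>real_of_int (\<mu> (Suc (i + k)))\<bar> * err (Suc (i + k)) \<le> 1 * err (Suc i + k)"
        using abs_sign_le[of "Suc (i + k)"] err_pos[of "Suc (i + k)"]
        by (intro mult_mono) auto
      also have "1 * err (Suc i + k) \<le> err k * (1/3) * (1/3) ^ i" using bound[of "Suc i"] by simp
      finally show ?thesis using err_pos[of "Suc (i + k)"] by (simp add: abs_mult)
    qed
    then have "norm (\<Sum>i. \<mu> (Suc (i + k)) * err (Suc (i + k))) \<le> (\<Sum>i. err k * (1/3) * (1/3) ^ i)"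
      using geo by (intro norm_suminf_le) (auto simp: sums_iff)
    also have "\<dots> = err k / 2" using geo by (simp add: sums_iff)
    finally show ?thesis using err_pos[of k] by (simp add: y_star_def field_simps)
  qed
  then show ?thesis unfolding eventually_sequentially by blast
qed

section \<open>Sign-normalised digit sums of \<gamma>_*\<close>

lemma Y_rec:
  shows "odd (a (Suc k)) \<Longrightarrow> Y k = \<theta> k * (1 - Y (Suc k))"
    and "even (a (Suc k)) \<Longrightarrow> Y k = \<theta> k * Y (Suc k)"
proof -
  have y: "y_star k = \<theta> k * (\<mu> (Suc k) + y_star (Suc k))"
    using digit_tail_star unfolding digit_tail_def by blast
  show "Y k = \<theta> k * (1 - Y (Suc k))" if "odd (a (Suc k))"
    unfolding Y_def y odd_digit[OF that] using next_sign_cases[of "Suc k"]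
    by (auto simp: algebra_simps)
  show "Y k = \<theta> k * Y (Suc k)" if "even (a (Suc k))"
    unfolding Y_def y even_digit[OF that] by simp
qed

lemma X_rec:
  shows "odd (a (Suc k)) \<Longrightarrow> X (Suc k) = \<beta> (Suc k) * (re (Suc k) * X k - 1)"
    and "even (a (Suc k)) \<Longrightarrow> X (Suc k) = - \<beta> (Suc k) * (re (Suc k) * X k)"
proof -
  show "X (Suc k) = \<beta> (Suc k) * (re (Suc k) * X k - 1)" if "odd (a (Suc k))"
    unfolding X_def dminus.simps odd_digit[OF that] using next_sign_cases[of "Suc k"]
    by (auto simp: algebra_simps)
  show "X (Suc k) = - \<beta> (Suc k) * (re (Suc k) * X k)" if "even (a (Suc k))"
    unfolding X_def dminus.simps even_digit[OF that] by simp
qed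

lemma abs_X: "\<bar>X k\<bar> = \<bar>dminus \<mu> k\<bar>" and abs_Y: "\<bar>Y k\<bar> = \<bar>y_star k\<bar>"
  using next_sign_cases[of k] by (auto simp: X_def Y_def)

text \<open>An odd next digit gives Y \<ge> 0 at once from |Y_{k+1}| \<le> 1/2. Even digits only
  pass the question on, possibly forever, but each at least halves a negative lower bound; hence
  -(1/2)^j for every j, and the limit.\<close>

lemma Y_nonneg: "\<forall>\<^sub>F k in sequentially. 0 \<le> Y k"
proof -
  obtain N where N: "\<And>k. k \<ge> N \<Longrightarrow> \<theta> k \<le> 11/41 \<and> \<bar>y_star k\<bar> \<le> 1/2"
    using eventually_conj[OF tail_le_const abs_y_star_le] unfolding eventually_sequentially by blast
  have low: "Y k \<ge> - ((1/2) ^ j)" if "k \<ge> N" for j k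
    using that
  proof (induction j arbitrary: k)
    case 0
    then show ?case using N[of k] abs_Y[of k] by auto
  next
    case (Suc j)
    show ?case
    proof (cases "odd (a (Suc k))")
      case True
      have "0 \<le> \<theta> k * (1 - Y (Suc k))"
        using N[of "Suc k"] abs_Y[of "Suc k"] Suc.prems tail_pos[of k] by (intro mult_nonneg_nonneg) auto
      moreover have "- ((1/2) ^ Suc j) \<le> (0::real)" by simp
      ultimately show ?thesis unfolding Y_rec(1)[OF True] by linarith
    next
      case False
      have "\<theta> k * (- ((1/2) ^ j)) \<le> \<theta> k * Y (Suc k)"
        using Suc tail_pos[of k] by (intro mult_left_mono) auto
      moreover have "\<theta> k * (1/2) ^ j \<le> 1/2 * (1/2) ^ j"
        using N[of k] Suc.prems by (intro mult_right_mono) auto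
      ultimately have "- (1/2 * (1/2) ^ j) \<le> \<theta> k * Y (Suc k)" by linarith
      moreover have "Y k = \<theta> k * Y (Suc k)" using Y_rec(2) False by blast
      ultimately show ?thesis by simp
    qed
  qed
  have "0 \<le> Y k" if "k \<ge> N" for k
  proof (rule LIMSEQ_le_const2)
    have "(\<lambda>j. - ((1/2) ^ j)) \<longlonglongrightarrow> (- 0 :: real)"
      by (intro tendsto_intros LIMSEQ_power_zero) auto
    then show "(\<lambda>j. - ((1/2) ^ j)) \<longlonglongrightarrow> (0 :: real)" by simp
  qed (use low[OF that] in auto)
  then show ?thesis unfolding eventually_sequentially by blast
qed

lemma Y_bounds:
  "\<forall>\<^sub>F k in sequentially. 0 \<le> Y k \<and> Y k \<le> \<theta> k \<and>
     (odd (a (Suc k)) \<longrightarrow> Y k \<ge> \<theta> k * (1 - \<theta> (Suc k))) \<and>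
     (even (a (Suc k)) \<longrightarrow> Y k \<le> \<theta> k * \<theta> (Suc k))"
proof -
  have le: "\<forall>\<^sub>F k in sequentially. Y k \<le> \<theta> k"
    using Y_nonneg eventually_SucD[OF Y_nonneg] eventually_SucD[OF abs_y_star_le]
  proof eventually_elim
    case (elim k)
    have "\<theta> k * z \<le> \<theta> k * 1" if "z \<le> 1" for z
      using that tail_pos[of k] by (intro mult_left_mono) auto
    moreover have "\<bar>Y (Suc k)\<bar> \<le> 1/2" using elim abs_Y[of "Suc k"] by simp
    ultimately have "\<theta> k * (1 - Y (Suc k)) \<le> \<theta> k * 1" "\<theta> k * Y (Suc k) \<le> \<theta> k * 1"
      using elim by (auto simp del: mult_1_right)
    then show ?case using Y_rec[of k] by (cases "odd (a (Suc k))") (simp_all only: simp_thms mult_1_right)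
  qed
  show ?thesis
    using Y_nonneg le eventually_SucD[OF le]
  proof eventually_elim
    case (elim k)
    have "\<theta> k * (1 - \<theta> (Suc k)) \<le> \<theta> k * (1 - Y (Suc k))" "\<theta> k * Y (Suc k) \<le> \<theta> k * \<theta> (Suc k)"
      using elim tail_pos[of k] by (auto intro!: mult_left_mono)
    then show ?case using elim Y_rec[of k] by (simp only: simp_thms) metis
  qed
qed

text \<open>Tails and quotients are eventually at most \<open>1 / (4 - 1/3) = 3/11\<close>, hence at most
  \<open>1 / (a - 3/11)\<close> for a partial quotient \<open>a\<close>; iterating \<open>\<bar>X\<bar> \<mapsto> (1 + \<bar>X\<bar>) / (R - 3/11)\<close> gives \<open>\<xi>\<close>.\<close>

definition \<xi> :: real where "\<xi> = 1 / (R - 14/11)"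

lemma xi_bounds: "0 < \<xi>" "\<xi> \<le> 11/30"
proof -
  have "real_of_int R \<ge> 4" using R_ge by simp
  then show "0 < \<xi>" "\<xi> \<le> 11/30" by (auto simp: \<xi>_def field_simps)
qed

lemma abs_X_le: "\<forall>\<^sub>F k in sequentially. \<bar>X k\<bar> \<le> \<xi>"
proof (rule eventually_le_of_contraction)
  define r where "r = 1 / (real_of_int R - 11/41)"
  have R: "real_of_int R \<ge> 4" using R_ge by simp
  show "\<forall>\<^sub>F k in sequentially. \<bar>X (Suc k)\<bar> \<le> r * \<bar>X k\<bar> + r"
    using beta_le_sharp digits_Suc_ge
  proof eventually_elim
    case (elim k)
    have "1 / (ra (Suc k) - 11/41) \<le> r"
      unfolding r_def using elim R by (intro divide_left_mono mult_pos_pos) auto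
    then have "\<beta> (Suc k) \<le> r" using elim by linarith
    moreover have "\<bar>X (Suc k)\<bar> \<le> \<beta> (Suc k) * (\<bar>X k\<bar> + 1)"
    proof (cases "odd (a (Suc k))")
      case True
      have "\<bar>re (Suc k) * X k - 1\<bar> \<le> \<bar>X k\<bar> + 1" using re_cases[of k] by auto
      then show ?thesis unfolding X_rec(1)[OF True] abs_mult using beta_Suc_pos[of k] by simp
    next
      case False
      have "\<bar>re (Suc k) * X k\<bar> \<le> \<bar>X k\<bar> + 1" using re_cases[of k] by auto
      then show ?thesis using X_rec(2)[of k] False beta_Suc_pos[of k] by (simp add: abs_mult)
    qed
    ultimately have "\<bar>X (Suc k)\<bar> \<le> r * (\<bar>X k\<bar> + 1)"
      by (meson abs_ge_zero add_nonneg_nonneg mult_right_mono order_trans zero_le_one)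
    then show ?case by (simp add: algebra_simps)
  qed
  show "0 \<le> r" "r < 1" using R by (auto simp: r_def field_simps)
  have "r * 1 < r * ((R - 52/41) * \<xi>)"
    using R by (intro mult_strict_left_mono) (auto simp: r_def \<xi>_def field_simps)
  moreover have "1 - r = r * (R - 52/41)" using R by (simp add: r_def field_simps)
  ultimately show "r < (1 - r) * \<xi>" by (simp add: mult.assoc)
qed

lemma X_bounds:
  "\<forall>\<^sub>F k in sequentially. - (\<beta> k * (1 + \<xi>)) \<le> X k \<and> X k \<le> \<beta> k * \<xi> \<and>
     (even (a k) \<longrightarrow> - (\<beta> k * \<xi>) \<le> X k)"
proof (rule eventually_SucI)
  show "\<forall>\<^sub>F k in sequentially. - (\<beta> (Suc k) * (1 + \<xi>)) \<le> X (Suc k) \<and> X (Suc k) \<le> \<beta> (Suc k) * \<xi> \<and>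
     (even (a (Suc k)) \<longrightarrow> - (\<beta> (Suc k) * \<xi>) \<le> X (Suc k))"
    using abs_X_le
  proof eventually_elim
    case (elim k)
    have x: "\<bar>re (Suc k) * X k\<bar> \<le> \<xi>" using elim re_cases[of k] by auto
    have mono: "\<beta> (Suc k) * z \<le> \<beta> (Suc k) * z'" if "z \<le> z'" for z z'
      using that beta_Suc_pos[of k] by simp
    show ?case
    proof (cases "odd (a (Suc k))")
      case True
      then show ?thesis unfolding X_rec(1)[OF True]
        using mono[of "- (1 + \<xi>)" "re (Suc k) * X k - 1"] mono[of "re (Suc k) * X k - 1" \<xi>] x xi_bounds
        by (auto simp: algebra_simps)
    next
      case False
      then have "X (Suc k) = \<beta> (Suc k) * (- (re (Suc k) * X k))" using X_rec(2)[of k] by simp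
      moreover have "\<beta> (Suc k) * \<xi> \<le> \<beta> (Suc k) * (1 + \<xi>)" by (rule mono) simp
      moreover have "\<beta> (Suc k) * (- \<xi>) \<le> \<beta> (Suc k) * (- (re (Suc k) * X k))"
        "\<beta> (Suc k) * (- (re (Suc k) * X k)) \<le> \<beta> (Suc k) * \<xi>"
        using x by (intro mono; simp)+
      ultimately show ?thesis by (intro conjI impI; linarith)
    qed
  qed
qed

lemma moderate_star: "\<forall>\<^sub>F k in sequentially. moderate \<mu> y_star k"
  using digits_Suc_ge tail_le_const beta_le_const abs_y_star_le abs_X_le
proof eventually_elim
  case (elim k)
  then show ?case unfolding moderate_def using abs_X[of k] xi_bounds abs_sign_le[of "Suc k"] by auto
qed

text \<open>Taking out \<beta>_{k+1} reduces the vertex condition at level k + 1 to a comparison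
  with L S_k, in which a_{k+1} appears explicitly.\<close>

lemma vertex_star_eq:
  "\<bar>denom_form \<mu> (Suc k) V W\<bar> * \<bar>error_form y_star (Suc k) V W\<bar>
   = \<beta> (Suc k) * (\<bar>V * (ra (Suc k) + re (Suc k) * \<beta> k) - W + \<mu> (Suc k) - re (Suc k) * dminus \<mu> k\<bar>
     * \<bar>W + re (Suc (Suc k)) * \<theta> (Suc k) * V + y_star (Suc k)\<bar>)"
proof -
  have "denom_form \<mu> (Suc k) V W = (\<beta> (Suc k) * (ra (Suc k) + re (Suc k) * \<beta> k)) * V - \<beta> (Suc k) * W
      + \<beta> (Suc k) * (\<mu> (Suc k) - re (Suc k) * dminus \<mu> k)"
    unfolding beta_mult by (simp add: denom_form_def)
  also have "\<dots> = \<beta> (Suc k) * (V * (ra (Suc k) + re (Suc k) * \<beta> k) - W + \<mu> (Suc k)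
      - re (Suc k) * dminus \<mu> k)"
    by (simp add: algebra_simps)
  finally show ?thesis
    using beta_Suc_pos[of k] by (simp add: abs_mult error_form_def)
qed

section \<open>Vertex conditions for odd and even partial quotients\<close>

lemma le_abs_mult:
  fixes D F :: real
  assumes "K \<le> D' * F'" "D = D' \<or> D = - D'" "F = F' \<or> F = - F'"
  shows "K \<le> \<bar>D\<bar> * \<bar>F\<bar>"
  using assms abs_ge_self[of "D' * F'"] by (auto simp: abs_mult)

text \<open>Multiplying both coordinates by the sign s leaves four cases that no longer depend on s.
  At the vertex with both coordinates equal to s the first factor loses 2.\<close>

lemma vertices_ge_odd:
  fixes L :: real and k :: nat
  defines "A \<equiv> ra (Suc k)" and "b \<equiv> re (Suc k) * \<beta> k" and "x \<equiv> re (Suc k) * X k"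
    and "f \<equiv> re (Suc (Suc k)) * \<theta> (Suc k)" and "u \<equiv> Y (Suc k)"
  assumes odd: "odd (a (Suc k))"
    and "L * (A + f + b) \<le> (A - 2 + b + x) * (1 + f + u)"
    and "L * (A + f + b) \<le> (A + b + x) * (1 - f - u)"
    and "L * (A + f + b) \<le> (A + 2 + b - x) * (1 - f + u)"
    and "L * (A + f + b) \<le> (A + b - x) * (1 + f - u)"
  shows "vertices_ge \<mu> y_star L (Suc k)"
proof -
  define s where "s = real_of_int (next_sign (Suc k))"
  have s: "s = 1 \<or> s = -1" using next_sign_cases[of "Suc k"] by (auto simp: s_def)
  have t: "real_of_int (\<mu> (Suc k)) = - s" using odd_digit[OF odd] by (simp add: s_def)
  have d: "re (Suc k) * dminus \<mu> k = - s * x"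
    using odd_digit(2)[OF odd] next_sign_cases[of "Suc k"] by (auto simp: s_def x_def X_def)
  have y: "y_star (Suc k) = s * u"
    using next_sign_cases[of "Suc k"] by (auto simp: s_def u_def Y_def)
  have "L * (A + f + b) \<le> \<bar>V * (A + b) - W + - s - - s * x\<bar> * \<bar>W + f * V + s * u\<bar>"
    if VW: "V \<in> {1, -1}" "W \<in> {1, -1}" for V W :: int
  proof -
    consider "s * V = 1 \<and> s * W = 1" | "s * V = 1 \<and> s * W = -1" | "s * V = -1 \<and> s * W = 1"
      | "s * V = -1 \<and> s * W = -1" using VW s by auto
    then show ?thesis
    proof cases
      case 1 show ?thesis by (rule le_abs_mult[OF assms(7)]) (use 1 s that in auto)
    next
      case 2 show ?thesis by (rule le_abs_mult[OF assms(8)]) (use 2 s that in auto)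
    next
      case 3 show ?thesis by (rule le_abs_mult[OF assms(9)]) (use 3 s that in auto)
    next
      case 4 show ?thesis by (rule le_abs_mult[OF assms(10)]) (use 4 s that in auto)
    qed
  qed
  then show ?thesis
    unfolding vertices_ge_def vertex_star_eq Delta_eq_beta t d y S_def
    using beta_Suc_pos[of k] by (auto simp: A_def b_def f_def mult.left_commute[of L])
qed

lemma vertices_ge_even:
  fixes L :: real and k :: nat
  defines "A \<equiv> ra (Suc k)" and "b \<equiv> re (Suc k) * \<beta> k" and "x \<equiv> re (Suc k) * X k"
    and "f \<equiv> re (Suc (Suc k)) * \<theta> (Suc k)" and "u \<equiv> Y (Suc k)"
  assumes even: "even (a (Suc k))"
    and "L * (A + f + b) \<le> (A - 1 + b - x) * (1 + f + u)"
    and "L * (A + f + b) \<le> (A + 1 + b - x) * (1 - f - u)"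
    and "L * (A + f + b) \<le> (A + 1 + b + x) * (1 - f + u)"
    and "L * (A + f + b) \<le> (A - 1 + b + x) * (1 + f - u)"
  shows "vertices_ge \<mu> y_star L (Suc k)"
proof -
  define s where "s = real_of_int (next_sign (Suc k))"
  have s: "s = 1 \<or> s = -1" using next_sign_cases[of "Suc k"] by (auto simp: s_def)
  have t: "real_of_int (\<mu> (Suc k)) = 0" using even_digit[OF even] by simp
  have d: "re (Suc k) * dminus \<mu> k = s * x"
    using even_digit(2)[OF even] next_sign_cases[of "Suc k"] by (auto simp: s_def x_def X_def)
  have y: "y_star (Suc k) = s * u"
    using next_sign_cases[of "Suc k"] by (auto simp: s_def u_def Y_def)
  have "L * (A + f + b) \<le> \<bar>V * (A + b) - W + 0 - s * x\<bar> * \<bar>W + f * V + s * u\<bar>"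
    if VW: "V \<in> {1, -1}" "W \<in> {1, -1}" for V W :: int
  proof -
    consider "s * V = 1 \<and> s * W = 1" | "s * V = 1 \<and> s * W = -1" | "s * V = -1 \<and> s * W = 1"
      | "s * V = -1 \<and> s * W = -1" using VW s by auto
    then show ?thesis
    proof cases
      case 1 show ?thesis by (rule le_abs_mult[OF assms(7)]) (use 1 s that in auto)
    next
      case 2 show ?thesis by (rule le_abs_mult[OF assms(8)]) (use 2 s that in auto)
    next
      case 3 show ?thesis by (rule le_abs_mult[OF assms(9)]) (use 3 s that in auto)
    next
      case 4 show ?thesis by (rule le_abs_mult[OF assms(10)]) (use 4 s that in auto)
    qed
  qed
  then show ?thesis
    unfolding vertices_ge_def vertex_star_eq Delta_eq_beta t d y S_def
    using beta_Suc_pos[of k] by (auto simp: A_def b_def f_def mult.left_commute[of L])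
qed

end

section \<open>Estimates for the vertex values\<close>

lemma mult_ge_of_bounds:
  fixes U V :: real
  assumes "0 \<le> U0 * V0 - K" "0 \<le> U0" "0 \<le> V0" "U0 \<le> U" "V0 \<le> V"
  shows "K \<le> U * V"
  using assms(1) mult_mono[OF assms(4,5)] assms(2-5) by linarith

text \<open>The difference of the two sides is affine in z with slope of known sign, so the largest
  z is the worst case; likewise the smallest A in \<open>mult_ge_of_left_end\<close>.\<close>

lemma mult_ge_of_right_end:
  fixes U V :: real
  assumes "L * (w - z1) \<le> U * (1 - c * z1)" "z \<le> z1" "L \<le> U * c"
  shows "L * (w - z) \<le> U * (1 - c * z)"
proof -
  have "0 \<le> (z1 - z) * (U * c - L)" using assms by (intro mult_nonneg_nonneg) auto
  then show ?thesis using assms(1) by (simp add: algebra_simps)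
qed

lemma mult_ge_of_left_end:
  fixes A :: real
  assumes "L * (r + w) \<le> (r - c) * V" "r \<le> A" "L \<le> V"
  shows "L * (A + w) \<le> (A - c) * V"
proof -
  have "0 \<le> (A - r) * (V - L)" using assms by (intro mult_nonneg_nonneg) auto
  then show ?thesis using assms(1) by (simp add: algebra_simps)
qed

text \<open>Here \<open>r\<close> and \<open>m\<close> are the least odd and the least even integer that are at least \<open>R\<close>;
  \<open>\<tau>\<close>, \<open>\<tau>r\<close> and \<open>\<tau>m\<close> bound the tails \<open>\<alpha>\<^sub>i\<close> and the quotients \<open>q\<^sub>i\<^sub>-\<^sub>1 / q\<^sub>i\<close> belonging to
  arbitrary, odd and even partial quotients.\<close>

locale semi_constants =
  fixes r m \<tau> \<xi> \<tau>r \<tau>m L :: real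
  assumes pos: "0 < \<tau>" "\<tau> \<le> 1/3" "0 < \<xi>" "\<xi> \<le> 1/2" "0 < \<tau>r" "\<tau>r \<le> 1/4" "0 < \<tau>m"
    and rm: "5 \<le> r" "4 \<le> m" "r \<le> m + 1"
    and xi: "\<tau> * (1 + \<xi>) = \<xi>"
    and L: "0 \<le> L" "L \<le> 1 - 2 * \<tau>r"
    and tau: "\<tau> + \<tau> * \<tau> \<le> 2 * \<tau>r" "\<tau>m \<le> 2 * \<tau>r"
    and odd_far: "L * (r + 2 * \<tau>) \<le> (r - (\<tau> + \<xi>)) * (1 - 2 * \<tau>r)"
    and odd_near_odd: "L * (r + \<tau>) \<le> (r - (2 + \<xi>)) * (1 - \<tau> * \<tau>)"
    and odd_near_minus: "L * (r - \<tau> - \<tau>m) \<le> (r - (2 + \<xi>)) * (1 - \<tau>m)"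
    and odd_near_plus: "L * (r + \<tau> - \<tau>m) \<le> (r - (2 + \<tau> * \<xi>)) * (1 - \<tau>m)"
    and even_plus: "L * (m + 2 * \<tau>) \<le> m - (1 + \<tau> + \<xi>)"
    and even_minus: "L * m \<le> (m - (1 + \<tau> + \<xi>)) * (1 - \<tau>)"
    and even_next_even: "L * m \<le> (m - (1 + \<xi>)) * (1 - \<tau> - \<tau> * \<tau>)"
    and even_next_odd_minus: "L * (m - \<tau>r - \<tau>) \<le> (m - (1 + \<xi>)) * (1 - 2 * \<tau>r)"
    and even_next_odd_prev_even: "L * (m + \<tau> - \<tau>r) \<le> (m - 1) * (1 - 2 * \<tau>r)"
    and even_next_odd_prev_odd: "L * m \<le> (m - (1 + \<tau>r * \<xi>)) * (1 - 2 * \<tau>r)"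
begin

lemma L_le_one: "L \<le> 1" and L_le_tau: "L \<le> 1 - \<tau>"
  using L pos tau(1) zero_le_square[of \<tau>] by linarith+

text \<open>The variables e, f, \<beta>, X, \<theta>, Y stand for \<epsilon>_{k+1},
  \<epsilon>_{k+2}, \<beta>_k, X_k, \<theta>_{k+1}, Y_{k+1}, and A below for a_{k+1}.\<close>

context
  fixes e f \<beta> X \<theta> Y :: real
  assumes signs: "e = 1 \<or> e = -1" "f = 1 \<or> f = -1"
    and beta: "0 \<le> \<beta>" "\<beta> \<le> \<tau>" and X: "- (\<beta> * (1 + \<xi>)) \<le> X" "X \<le> \<beta> * \<xi>"
    and theta: "0 \<le> \<theta>" "\<theta> \<le> \<tau>" and Y: "0 \<le> Y" "Y \<le> \<theta>" "\<theta> + Y \<le> 2 * \<tau>r"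
begin

lemma beta_xi: "0 \<le> \<beta> * \<xi>" "\<beta> * \<xi> \<le> \<tau> * \<xi>" "\<beta> * (1 + \<xi>) \<le> \<xi>" "\<beta> * \<xi> \<le> \<xi>" "\<beta> * \<xi> \<le> \<beta>"
proof -
  show "0 \<le> \<beta> * \<xi>" "\<beta> * \<xi> \<le> \<tau> * \<xi>" using beta pos by (auto intro: mult_right_mono)
  have "\<beta> * (1 + \<xi>) \<le> \<tau> * (1 + \<xi>)" using beta pos by (intro mult_right_mono) auto
  then show "\<beta> * (1 + \<xi>) \<le> \<xi>" using xi by simp
  then show "\<beta> * \<xi> \<le> \<xi>" using beta by (simp add: algebra_simps)
  show "\<beta> * \<xi> \<le> \<beta>" using beta pos by (intro mult_left_le) auto
qed

lemma sum_ge: "e * \<beta> + e * X \<ge> - \<xi>" "e = 1 \<Longrightarrow> e * \<beta> + e * X \<ge> - (\<beta> * \<xi>)"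
  "e = -1 \<Longrightarrow> e * \<beta> + e * X \<ge> - (\<beta> * (1 + \<xi>))"
  using signs X beta beta_xi pos by (auto simp: algebra_simps)

lemma diff_ge: "e * \<beta> - e * X \<ge> - (\<tau> + \<xi>)"
  using signs X beta beta_xi pos by (auto simp: algebra_simps)

lemma size_le: "f * \<theta> + e * \<beta> \<le> 2 * \<tau>" "e * \<beta> \<le> \<tau>"
  using signs beta theta by auto

text \<open>Serves three of the four vertices at an odd digit and, with A + 1 in place of A, two of
  those at an even digit: their first factor loses at most \<tau> + \<xi>.\<close>

lemma far_product_ge:
  assumes "A \<ge> r" "A - (\<tau> + \<xi>) \<le> U" "1 - 2 * \<tau>r \<le> V"
  shows "L * (A + f * \<theta> + e * \<beta>) \<le> U * V"
proof (rule mult_ge_of_bounds[OF _ _ _ assms(2,3)])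
  have "L * (A + f * \<theta> + e * \<beta>) \<le> L * (A + 2 * \<tau>)"
    using size_le(1) L by (intro mult_left_mono) auto
  also have "\<dots> \<le> (A - (\<tau> + \<xi>)) * (1 - 2 * \<tau>r)"
    by (rule mult_ge_of_left_end[OF odd_far assms(1) L(2)])
  finally show "0 \<le> (A - (\<tau> + \<xi>)) * (1 - 2 * \<tau>r) - L * (A + f * \<theta> + e * \<beta>)" by simp
qed (use assms pos rm in auto)

lemma error_factor_ge: "1 - f * \<theta> - Y \<ge> 1 - 2 * \<tau>r" "1 - f * \<theta> + Y \<ge> 1 - 2 * \<tau>r"
  "1 + f * \<theta> - Y \<ge> 1 - 2 * \<tau>r"
  using signs theta Y by auto

text \<open>The first vertex is delicate when f = -1. An odd next digit lets Y nearly cancel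
  \<theta>, leaving 1 - \<tau>^2; for an even one \<theta> = \<tau>m is the worst case, and the sign
  e decides how \<beta> and X combine.\<close>

lemma odd_vertices:
  assumes A: "A \<ge> r" and next_digit: "Y \<ge> \<theta> * (1 - \<tau>) \<or> \<theta> \<le> \<tau>m"
  shows "L * (A + f * \<theta> + e * \<beta>) \<le> (A - 2 + e * \<beta> + e * X) * (1 + f * \<theta> + Y)"
    and "L * (A + f * \<theta> + e * \<beta>) \<le> (A + e * \<beta> + e * X) * (1 - f * \<theta> - Y)"
    and "L * (A + f * \<theta> + e * \<beta>) \<le> (A + 2 + e * \<beta> - e * X) * (1 - f * \<theta> + Y)"
    and "L * (A + f * \<theta> + e * \<beta>) \<le> (A + e * \<beta> - e * X) * (1 + f * \<theta> - Y)"
proof -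
  let ?U = "A - 2 + e * \<beta> + e * X"
  have U: "?U \<ge> A - (2 + \<xi>)" using sum_ge(1) by simp
  have U1: "?U \<ge> 1" using U A rm pos by linarith
  have tau2: "\<tau> * \<tau> \<le> 2 * \<tau>r" using tau pos by linarith
  have crude: "L * (A + \<tau>) \<le> (A - (2 + \<xi>)) * (1 - \<tau> * \<tau>)"
    by (rule mult_ge_of_left_end[OF odd_near_odd A]) (use L tau2 in linarith)
  have sq1: "\<tau> * \<tau> \<le> 1" using tau2 pos by linarith
  have Sle: "L * (A + e * \<beta>) \<le> L * (A + \<tau>)"
    using size_le(2) L by (intro mult_left_mono) auto
  show "L * (A + f * \<theta> + e * \<beta>) \<le> ?U * (1 + f * \<theta> + Y)"
  proof (cases "f = 1")
    case True
    have "(A - (2 + \<xi>)) * (1 - \<tau> * \<tau>) \<le> ?U * 1"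
      using U U1 A rm pos sq1 by (intro mult_mono) auto
    from order_trans[OF Sle order_trans[OF crude this]] have "L * (A + e * \<beta>) \<le> ?U" by simp
    moreover have "L * \<theta> \<le> ?U * \<theta>" using U1 L_le_one theta by (intro mult_right_mono) auto
    ultimately have "L * (A + \<theta> + e * \<beta>) \<le> ?U * (1 + \<theta>)" by (simp add: algebra_simps)
    also have "\<dots> \<le> ?U * (1 + f * \<theta> + Y)" using U1 Y True by (intro mult_left_mono) auto
    finally show ?thesis using True by simp
  next
    case False
    then have f: "f = -1" using signs by blast
    consider "Y \<ge> \<theta> * (1 - \<tau>)" | "\<theta> \<le> \<tau>m" using next_digit by blast
    then show ?thesis
    proof cases
      case 1
      have "\<theta> * \<tau> \<le> \<tau> * \<tau>" using theta pos by (intro mult_right_mono) auto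
      then have "1 - \<tau> * \<tau> \<le> 1 + f * \<theta> + Y" using 1 f by (simp add: algebra_simps)
      moreover have "L * (A + f * \<theta> + e * \<beta>) \<le> L * (A + e * \<beta>)"
        using f theta L by (intro mult_left_mono) auto
      ultimately show ?thesis
        using crude Sle U A rm pos sq1 by (intro mult_ge_of_bounds[of "A - (2 + \<xi>)" "1 - \<tau> * \<tau>"]) auto
    next
      case 2
      have le: "L \<le> 1 - \<tau>m" using L tau by linarith
      have "L * (A + e * \<beta> - \<theta>) \<le> ?U * (1 - 1 * \<theta>)"
      proof (rule mult_ge_of_right_end[OF _ 2])
        show "L \<le> ?U * 1" using U1 L_le_one by simp
        show "L * (A + e * \<beta> - \<tau>m) \<le> ?U * (1 - 1 * \<tau>m)"
        proof (cases "e = 1")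
          case True
          have "L * (A + (\<tau> - \<tau>m)) \<le> (A - (2 + \<tau> * \<xi>)) * (1 - \<tau>m)"
            by (rule mult_ge_of_left_end[OF _ A le]) (use odd_near_plus in \<open>simp add: algebra_simps\<close>)
          moreover have "L * (A + e * \<beta> - \<tau>m) \<le> L * (A + (\<tau> - \<tau>m))"
            using size_le L by (intro mult_left_mono) auto
          moreover have "(A - (2 + \<tau> * \<xi>)) * (1 - \<tau>m) \<le> ?U * (1 - \<tau>m)"
            using sum_ge(2)[OF True] beta_xi(2) le L by (intro mult_right_mono) auto
          ultimately show ?thesis by simp
        next
          case False
          then have e: "e = -1" using signs by blast
          have "L * (A + (- \<tau> - \<tau>m)) \<le> (A - (2 + \<xi>)) * (1 - \<tau>m)"
            by (rule mult_ge_of_left_end[OF _ A le]) (use odd_near_minus in \<open>simp add: algebra_simps\<close>)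
          \<comment> \<open>Both sides are affine in \<beta>; the worst case is \<beta> = \<tau>,
            where \<beta> (1 + \<xi>) = \<xi> gives back the preceding estimate.\<close>
          moreover have "0 \<le> (\<tau> - \<beta>) * ((1 + \<xi>) * (1 - \<tau>m) - L)"
          proof (intro mult_nonneg_nonneg)
            have "1 * (1 - \<tau>m) \<le> (1 + \<xi>) * (1 - \<tau>m)" using pos le L by (intro mult_right_mono) auto
            from order_trans[OF le this[unfolded mult_1]]
            show "0 \<le> (1 + \<xi>) * (1 - \<tau>m) - L" by simp
          qed (use beta in simp)
          then have "L * (\<tau> - \<beta>) \<le> (\<tau> * (1 + \<xi>) - \<beta> * (1 + \<xi>)) * (1 - \<tau>m)"
            by (simp add: algebra_simps)
          then have "L * (\<tau> - \<beta>) \<le> (\<xi> - \<beta> * (1 + \<xi>)) * (1 - \<tau>m)" unfolding xi .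
          ultimately have "L * (A - \<beta> - \<tau>m) \<le> (A - 2 - \<beta> * (1 + \<xi>)) * (1 - \<tau>m)"
            by (simp add: algebra_simps)
          also have "\<dots> \<le> ?U * (1 - \<tau>m)"
            using sum_ge(3)[OF e] le L by (intro mult_right_mono) auto
          finally show ?thesis using e by simp
        qed
      qed
      also have "\<dots> \<le> ?U * (1 + f * \<theta> + Y)" using U1 Y f by (intro mult_left_mono) auto
      finally show ?thesis using f by (simp add: algebra_simps)
    qed
  qed
  show "L * (A + f * \<theta> + e * \<beta>) \<le> (A + e * \<beta> + e * X) * (1 - f * \<theta> - Y)"
    by (rule far_product_ge[OF A _ error_factor_ge(1)]) (use sum_ge pos in linarith)
  show "L * (A + f * \<theta> + e * \<beta>) \<le> (A + 2 + e * \<beta> - e * X) * (1 - f * \<theta> + Y)"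
    by (rule far_product_ge[OF A _ error_factor_ge(2)]) (use diff_ge in linarith)
  show "L * (A + f * \<theta> + e * \<beta>) \<le> (A + e * \<beta> - e * X) * (1 + f * \<theta> - Y)"
    by (rule far_product_ge[OF A _ error_factor_ge(3)]) (use diff_ge in linarith)
qed

text \<open>The fourth vertex is delicate when f = -1, since its second factor loses \<theta> and Y
  together. An even next digit makes Y of second order, an odd one gives \<theta> \<le> \<tau>r. In
  the latter case with e = 1, the previous digit limits the loss through \<beta> if odd and through
  X if even.\<close>

lemma even_vertices:
  assumes A: "A \<ge> m" and next_digit: "\<theta> \<le> \<tau>r \<or> Y \<le> \<theta> * \<tau>"
    and prev_digit: "\<beta> \<le> \<tau>r \<or> X \<ge> - (\<beta> * \<xi>)"
  shows "L * (A + f * \<theta> + e * \<beta>) \<le> (A - 1 + e * \<beta> - e * X) * (1 + f * \<theta> + Y)"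
    and "L * (A + f * \<theta> + e * \<beta>) \<le> (A + 1 + e * \<beta> - e * X) * (1 - f * \<theta> - Y)"
    and "L * (A + f * \<theta> + e * \<beta>) \<le> (A + 1 + e * \<beta> + e * X) * (1 - f * \<theta> + Y)"
    and "L * (A + f * \<theta> + e * \<beta>) \<le> (A - 1 + e * \<beta> + e * X) * (1 + f * \<theta> - Y)"
proof -
  have far: "L * (A + f * \<theta> + e * \<beta>) \<le> U * V"
    if "A + 1 - (\<tau> + \<xi>) \<le> U" "1 - 2 * \<tau>r \<le> V" for U V
  proof -
    have "L * (A + f * \<theta> + e * \<beta>) \<le> L * ((A + 1) + f * \<theta> + e * \<beta>)"
      using L by (intro mult_left_mono) auto
    also have "\<dots> \<le> U * V" by (rule far_product_ge) (use that A rm in auto)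
    finally show ?thesis .
  qed
  show "L * (A + f * \<theta> + e * \<beta>) \<le> (A + 1 + e * \<beta> - e * X) * (1 - f * \<theta> - Y)"
    by (rule far[OF _ error_factor_ge(1)]) (use diff_ge in linarith)
  show "L * (A + f * \<theta> + e * \<beta>) \<le> (A + 1 + e * \<beta> + e * X) * (1 - f * \<theta> + Y)"
    by (rule far[OF _ error_factor_ge(2)]) (use sum_ge pos in linarith)
  have plus: "L * (A + 2 * \<tau>) \<le> A - (1 + \<tau> + \<xi>)"
    using mult_ge_of_left_end[of L m "2 * \<tau>" "1 + \<tau> + \<xi>" 1 A] even_plus A L_le_one by simp
  show "L * (A + f * \<theta> + e * \<beta>) \<le> (A - 1 + e * \<beta> - e * X) * (1 + f * \<theta> + Y)"
  proof -
    let ?U = "A - (1 + \<tau> + \<xi>)"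
    have U: "?U \<le> A - 1 + e * \<beta> - e * X" using diff_ge by linarith
    have U1: "?U \<ge> 1" using A rm pos by linarith
    show ?thesis
    proof (cases "f = 1")
      case True
      have "L * (A + f * \<theta> + e * \<beta>) \<le> L * (A + 2 * \<tau>)"
        using size_le(1) L by (intro mult_left_mono) auto
      then show ?thesis using plus U U1 True theta Y by (intro mult_ge_of_bounds[of ?U 1]) auto
    next
      case False
      then have f: "f = -1" using signs by blast
      have "L * (A + 0) \<le> ?U * (1 - \<tau>)"
        by (rule mult_ge_of_left_end[OF _ A]) (use even_minus L_le_tau in auto)
      then have "L * (A + \<tau> - \<tau>) \<le> ?U * (1 - 1 * \<tau>)" by simp
      from mult_ge_of_right_end[OF this theta(2)]
      have "L * (A + \<tau> - \<theta>) \<le> ?U * (1 - 1 * \<theta>)" using U1 L_le_one by simp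
      moreover have "L * (A + f * \<theta> + e * \<beta>) \<le> L * (A + \<tau> - \<theta>)"
        using f size_le(2) L by (intro mult_left_mono) auto
      ultimately show ?thesis
        using U U1 f Y theta pos by (intro mult_ge_of_bounds[of ?U "1 - \<theta>"]) auto
    qed
  qed
  show "L * (A + f * \<theta> + e * \<beta>) \<le> (A - 1 + e * \<beta> + e * X) * (1 + f * \<theta> - Y)"
  proof (cases "f = 1")
    case True
    have "L * (A + f * \<theta> + e * \<beta>) \<le> L * (A + 2 * \<tau>)"
      using size_le(1) L by (intro mult_left_mono) auto
    then show ?thesis using plus sum_ge(1) True theta Y pos A rm
      by (intro mult_ge_of_bounds[of "A - (1 + \<tau> + \<xi>)" 1]) auto
  next
    case False
    then have f: "f = -1" using signs by blast
    let ?U = "A - 1 + e * \<beta> + e * X"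
    have U: "?U \<ge> A - (1 + \<xi>)" using sum_ge(1) by simp
    have U1: "?U \<ge> 1" using U A rm pos by linarith
    consider "\<theta> \<le> \<tau>r" | "Y \<le> \<theta> * \<tau>" using next_digit by blast
    then show ?thesis
    proof cases
      case 2
      let ?V = "A - (1 + \<xi>)"
      have V1: "?V \<ge> 1" using A rm pos by linarith
      have "L * (A + 0) \<le> ?V * (1 - \<tau> - \<tau> * \<tau>)"
        by (rule mult_ge_of_left_end[OF _ A]) (use even_next_even L tau in auto)
      then have *: "L * (A + \<tau> - \<tau>) \<le> ?V * (1 - (1 + \<tau>) * \<tau>)" by (simp add: algebra_simps)
      have "1 * 1 \<le> ?V * (1 + \<tau>)" using V1 pos by (intro mult_mono) auto
      then have "L \<le> ?V * (1 + \<tau>)" using L_le_one by linarith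
      from mult_ge_of_right_end[OF * theta(2) this]
      have "L * (A + \<tau> - \<theta>) \<le> ?V * (1 - (1 + \<tau>) * \<theta>)" .
      moreover have "L * (A + f * \<theta> + e * \<beta>) \<le> L * (A + \<tau> - \<theta>)"
        using f size_le(2) L by (intro mult_left_mono) auto
      moreover have "1 - (1 + \<tau>) * \<theta> \<le> 1 + f * \<theta> - Y" using 2 f by (simp add: algebra_simps)
      moreover have "0 \<le> 1 - (1 + \<tau>) * \<theta>"
      proof -
        have "(1 + \<tau>) * \<theta> \<le> (1 + \<tau>) * \<tau>" using theta pos by (intro mult_left_mono) auto
        then show ?thesis using tau pos by (simp add: algebra_simps)
      qed
      ultimately show ?thesis
        using U V1 by (intro mult_ge_of_bounds[of ?V "1 - (1 + \<tau>) * \<theta>"]) auto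
    next
      case 1
      have "L * (A + e * \<beta> - \<theta>) \<le> ?U * (1 - 2 * \<theta>)"
      proof (rule mult_ge_of_right_end[OF _ 1])
        show "L \<le> ?U * 2" using U1 L_le_one by (simp add: algebra_simps)
        have Vpos: "0 \<le> 1 - 2 * \<tau>r" using L by linarith
        show "L * (A + e * \<beta> - \<tau>r) \<le> ?U * (1 - 2 * \<tau>r)"
        proof (cases "e = 1")
          case True
          show ?thesis
          proof (cases "\<beta> \<le> \<tau>r")
            case small: True
            have "L * (A + 0) \<le> (A - (1 + \<tau>r * \<xi>)) * (1 - 2 * \<tau>r)"
              by (rule mult_ge_of_left_end[OF _ A L(2)]) (use even_next_odd_prev_odd in simp)
            moreover have "L * (A + e * \<beta> - \<tau>r) \<le> L * (A + 0)"
              using small True L by (intro mult_left_mono) auto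
            moreover have "\<beta> * \<xi> \<le> \<tau>r * \<xi>" using small pos by (intro mult_right_mono) auto
            then have "(A - (1 + \<tau>r * \<xi>)) * (1 - 2 * \<tau>r) \<le> ?U * (1 - 2 * \<tau>r)"
              using sum_ge(2)[OF True] Vpos by (intro mult_right_mono) auto
            ultimately show ?thesis by linarith
          next
            case False
            then have "X \<ge> - (\<beta> * \<xi>)" using prev_digit by blast
            then have "\<beta> + X \<ge> 0" using beta_xi(5) by linarith
            then have "(A - 1) * (1 - 2 * \<tau>r) \<le> ?U * (1 - 2 * \<tau>r)"
              using True Vpos by (intro mult_right_mono) auto
            moreover have "L * (A + (\<tau> - \<tau>r)) \<le> (A - 1) * (1 - 2 * \<tau>r)"
              by (rule mult_ge_of_left_end[OF _ A L(2)])
                (use even_next_odd_prev_even in \<open>simp add: algebra_simps\<close>)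
            moreover have "L * (A + e * \<beta> - \<tau>r) \<le> L * (A + (\<tau> - \<tau>r))"
              using size_le(2) L by (intro mult_left_mono) auto
            ultimately show ?thesis by linarith
          qed
        next
          case False
          then have e: "e = -1" using signs by blast
          have "L * (A + (- \<tau>r - \<tau>)) \<le> (A - (1 + \<xi>)) * (1 - 2 * \<tau>r)"
            by (rule mult_ge_of_left_end[OF _ A L(2)])
              (use even_next_odd_minus in \<open>simp add: algebra_simps\<close>)
          moreover have "0 \<le> (\<tau> - \<beta>) * ((1 + \<xi>) * (1 - 2 * \<tau>r) - L)"
          proof (intro mult_nonneg_nonneg)
            have "1 * (1 - 2 * \<tau>r) \<le> (1 + \<xi>) * (1 - 2 * \<tau>r)"
              using pos Vpos by (intro mult_right_mono) auto
            from order_trans[OF L(2) this[unfolded mult_1]]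
            show "0 \<le> (1 + \<xi>) * (1 - 2 * \<tau>r) - L" by simp
          qed (use beta in simp)
          then have "L * (\<tau> - \<beta>) \<le> (\<tau> * (1 + \<xi>) - \<beta> * (1 + \<xi>)) * (1 - 2 * \<tau>r)"
            by (simp add: algebra_simps)
          then have "L * (\<tau> - \<beta>) \<le> (\<xi> - \<beta> * (1 + \<xi>)) * (1 - 2 * \<tau>r)" unfolding xi .
          ultimately have "L * (A - \<beta> - \<tau>r) \<le> (A - 1 - \<beta> * (1 + \<xi>)) * (1 - 2 * \<tau>r)"
            by (simp add: algebra_simps)
          also have "\<dots> \<le> ?U * (1 - 2 * \<tau>r)"
            using sum_ge(3)[OF e] Vpos by (intro mult_right_mono) auto
          finally show ?thesis using e by simp
        qed
      qed
      also have "\<dots> \<le> ?U * (1 + f * \<theta> - Y)" using U1 Y f by (intro mult_left_mono) auto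
      finally show ?thesis using f by (simp add: algebra_simps)
    qed
  qed
qed

end

end

text \<open>With plus signs only, a tail or quotient is at most the reciprocal of its digit, so u =
  1/R and v = 1/r are used without the shift 3/11; r is the least odd integer that is at least
  R.\<close>

locale regular_constants =
  fixes r R u v \<xi> L :: real
  assumes pos: "0 < u" "u \<le> 1/4" "0 < v" "v \<le> u" "0 < \<xi>" "\<xi> \<le> 1/2"
    and rm: "5 \<le> r" "4 \<le> R"
    and L: "0 \<le> L" "L \<le> 1 - 2 * v"
    and u: "u + u * u \<le> 2 * v" "u * \<xi> \<le> (1 + \<xi>) * v"
    and odd_near: "L * (r + u) \<le> r - (2 + u * \<xi>)"
    and odd_next_odd: "L * (r + v) \<le> (r - (1 + \<xi>) * v) * (1 - 2 * v)"
    and odd_next_even: "L * (r + u) \<le> (r - (1 + \<xi>) * v) * (1 - u - u * u)"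
    and even_near: "L * (R + 2 * u) \<le> R - (1 + u * \<xi>)"
begin

lemma L_le: "L \<le> 1 - u" "L \<le> 1"
  using L u pos zero_le_square[of u] by linarith+

context
  fixes \<beta> X \<theta> Y :: real
  assumes beta: "0 \<le> \<beta>" "\<beta> \<le> u" and X: "- (\<beta> * (1 + \<xi>)) \<le> X" "X \<le> \<beta> * \<xi>"
    and theta: "0 \<le> \<theta>" "\<theta> \<le> u" and Y: "0 \<le> Y" "Y \<le> \<theta>"
    and next_digit: "\<theta> \<le> v \<or> Y \<le> \<theta> * u"
    and prev_digit: "\<beta> \<le> v \<or> X \<ge> - (\<beta> * \<xi>)"
begin

lemma beta_xi: "0 \<le> \<beta> * \<xi>" "\<beta> * \<xi> \<le> u * \<xi>" "\<beta> * \<xi> \<le> \<beta>" "u * \<xi> \<le> 1/8"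
proof -
  show "0 \<le> \<beta> * \<xi>" "\<beta> * \<xi> \<le> u * \<xi>" using beta pos by (auto intro: mult_right_mono)
  show "\<beta> * \<xi> \<le> \<beta>" using beta pos by (intro mult_left_le) auto
  show "u * \<xi> \<le> 1/8" using mult_mono[of u "1/4" \<xi> "1/2"] pos by simp
qed

lemma diff_nonneg: "0 \<le> \<beta> - X"
  using X beta_xi by linarith

lemma sum_ge: "\<beta> + X \<ge> - (u * \<xi>)"
  using X beta_xi by (simp add: algebra_simps)

lemma X_ge: "X \<ge> - ((1 + \<xi>) * v)"
  using prev_digit
proof
  assume "\<beta> \<le> v"
  then have "\<beta> * (1 + \<xi>) \<le> v * (1 + \<xi>)" using pos by (intro mult_right_mono) auto
  then show ?thesis using X by (simp add: algebra_simps)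
qed (use u beta_xi in linarith)

lemma S_le: "L * (A + \<theta> + \<beta>) \<le> L * (A + 2 * u)"
  using beta theta L by (intro mult_left_mono) auto

lemma odd_vertices:
  assumes A: "A \<ge> r"
  shows "L * (A + \<theta> + \<beta>) \<le> (A - 2 + \<beta> + X) * (1 + \<theta> + Y)"
    and "L * (A + \<theta> + \<beta>) \<le> (A + \<beta> + X) * (1 - \<theta> - Y)"
    and "L * (A + \<theta> + \<beta>) \<le> (A + 2 + \<beta> - X) * (1 - \<theta> + Y)"
    and "L * (A + \<theta> + \<beta>) \<le> (A + \<beta> - X) * (1 + \<theta> - Y)"
proof -
  have near: "L * (A + u) \<le> A - (2 + u * \<xi>)"
    using mult_ge_of_left_end[of L r u "2 + u * \<xi>" 1 A] odd_near A L_le by simp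
  let ?U = "A - 2 + \<beta> + X"
  have U: "?U \<ge> A - (2 + u * \<xi>)" using sum_ge by linarith
  have U1: "?U \<ge> 1" using U A rm beta_xi by linarith
  show "L * (A + \<theta> + \<beta>) \<le> ?U * (1 + \<theta> + Y)"
  proof -
    have "L * (A + \<beta>) \<le> L * (A + u)" using beta L by (intro mult_left_mono) auto
    then have "L * (A + \<beta>) \<le> ?U" using near U by linarith
    moreover have "L * \<theta> \<le> ?U * \<theta>" using U1 L_le theta by (intro mult_right_mono) auto
    ultimately have "L * (A + \<theta> + \<beta>) \<le> ?U * (1 + \<theta>)" by (simp add: algebra_simps)
    also have "\<dots> \<le> ?U * (1 + \<theta> + Y)" using U1 Y by (intro mult_left_mono) auto
    finally show ?thesis .
  qed
  show "L * (A + \<theta> + \<beta>) \<le> (A + \<beta> + X) * (1 - \<theta> - Y)"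
  proof -
    let ?c = "(1 + \<xi>) * v"
    have c: "?c \<le> 1" using mult_mono[of "1 + \<xi>" "3/2" v "1/4"] pos by simp
    \<comment> \<open>V bounds the second factor from below and w bounds \<theta> from above; the
      two parities of the next digit supply different pairs.\<close>
    have *: "L * (A + \<theta> + \<beta>) \<le> (A + \<beta> + X) * (1 - \<theta> - Y)"
      if w: "L * (r + w) \<le> (r - ?c) * V" "L \<le> V" "V \<le> 1 - \<theta> - Y" "\<theta> \<le> w" for w V
    proof -
      have "L * ((A + \<beta>) + w) \<le> ((A + \<beta>) - ?c) * V"
        by (rule mult_ge_of_left_end[OF w(1) _ w(2)]) (use A beta in simp)
      moreover have "L * (A + \<theta> + \<beta>) \<le> L * ((A + \<beta>) + w)" using w L by (intro mult_left_mono) auto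
      ultimately show ?thesis using X_ge w L A rm beta c
        by (intro mult_ge_of_bounds[of "(A + \<beta>) - ?c" V]) auto
    qed
    from next_digit show ?thesis
    proof
      assume "\<theta> \<le> v"
      then show ?thesis using *[OF odd_next_odd] L Y by simp
    next
      assume "Y \<le> \<theta> * u"
      moreover have "\<theta> * u \<le> u * u" using theta pos by (intro mult_right_mono) auto
      ultimately show ?thesis using *[OF odd_next_even] L u theta by simp
    qed
  qed
  show "L * (A + \<theta> + \<beta>) \<le> (A + 2 + \<beta> - X) * (1 - \<theta> + Y)"
  proof -
    have "L * (A + 2 * u) \<le> (1 - u) * (A + 2)" using L_le L A rm pos by (intro mult_mono) auto
    then show ?thesis using S_le[of A] diff_nonneg theta Y A rm pos
      by (intro mult_ge_of_bounds[of "A + 2" "1 - u"]) (auto simp: mult.commute)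
  qed
  show "L * (A + \<theta> + \<beta>) \<le> (A + \<beta> - X) * (1 + \<theta> - Y)"
  proof -
    have "L * u \<le> 1 * 1" using L L_le pos by (intro mult_mono) auto
    moreover have "L * (A + 2 * u) = L * (A + u) + L * u" by (simp add: algebra_simps)
    ultimately have "L * (A + 2 * u) \<le> A" using near mult_pos_pos[OF pos(1,5)] by linarith
    then show ?thesis using S_le[of A] diff_nonneg theta Y A rm
      by (intro mult_ge_of_bounds[of A 1]) auto
  qed
qed

lemma even_vertices:
  assumes A: "A \<ge> R"
  shows "L * (A + \<theta> + \<beta>) \<le> (A - 1 + \<beta> - X) * (1 + \<theta> + Y)"
    and "L * (A + \<theta> + \<beta>) \<le> (A + 1 + \<beta> - X) * (1 - \<theta> - Y)"
    and "L * (A + \<theta> + \<beta>) \<le> (A + 1 + \<beta> + X) * (1 - \<theta> + Y)"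
    and "L * (A + \<theta> + \<beta>) \<le> (A - 1 + \<beta> + X) * (1 + \<theta> - Y)"
proof -
  have near: "L * (A + 2 * u) \<le> A - (1 + u * \<xi>)"
    using mult_ge_of_left_end[of L R "2 * u" "1 + u * \<xi>" 1 A] even_near A L_le by simp
  show "L * (A + \<theta> + \<beta>) \<le> (A - 1 + \<beta> - X) * (1 + \<theta> + Y)"
    using near S_le[of A] diff_nonneg theta Y A rm mult_pos_pos[OF pos(1,5)]
    by (intro mult_ge_of_bounds[of "A - 1" 1]) auto
  show "L * (A + \<theta> + \<beta>) \<le> (A - 1 + \<beta> + X) * (1 + \<theta> - Y)"
    using near S_le[of A] sum_ge theta Y A rm beta_xi(4)
    by (intro mult_ge_of_bounds[of "A - (1 + u * \<xi>)" 1]) auto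
  have "\<theta> + Y \<le> 2 * v"
  proof -
    have "\<theta> * u \<le> u * u" using theta pos by (intro mult_right_mono) auto
    then show ?thesis using next_digit u theta Y by linarith
  qed
  moreover have "L * (A + 2 * u) \<le> (1 - 2 * v) * (A + 1)" using L A rm pos by (intro mult_mono) auto
  ultimately show "L * (A + \<theta> + \<beta>) \<le> (A + 1 + \<beta> - X) * (1 - \<theta> - Y)"
    using S_le[of A] diff_nonneg A rm pos
    by (intro mult_ge_of_bounds[of "A + 1" "1 - 2 * v"]) (auto simp: mult.commute)
  have "L * (A + 2 * u) \<le> (1 - u) * (A + 1 - u * \<xi>)"
    using L L_le A rm pos beta_xi(4) by (intro mult_mono) auto
  then show "L * (A + \<theta> + \<beta>) \<le> (A + 1 + \<beta> + X) * (1 - \<theta> + Y)"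
    using S_le[of A] sum_ge theta Y A rm pos beta_xi(4)
    by (intro mult_ge_of_bounds[of "A + 1 - u * \<xi>" "1 - u"]) (auto simp: mult.commute)
qed

end

end

text \<open>After clearing denominators the conditions on the constants are polynomial inequalities
  in v, which linear reasoning settles once each monomial is known to be nonnegative. The bracketing
  matches the form produced by \<open>algebra_simps\<close>.\<close>

lemma monomials_nonneg:
  fixes v :: real
  assumes "0 \<le> v"
  shows "0 \<le> v * v" "0 \<le> v * (v * v)" "0 \<le> v * (v * (v * v))"
    "0 \<le> v * (v * (v * (v * v)))" "0 \<le> v * (v * (v * (v * (v * v))))"
    "0 \<le> v * (v * (v * (v * (v * (v * v)))))"
    "0 \<le> v * (v * (v * (v * (v * (v * (v * v))))))"
    "0 \<le> v * (v * (v * (v * (v * (v * (v * (v * v)))))))"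
    "0 \<le> v * (v * (v * (v * (v * (v * (v * (v * (v * v))))))))"
    "0 \<le> v * (v * (v * (v * (v * (v * (v * (v * (v * (v * v)))))))))"
    "0 \<le> v * (v * (v * (v * (v * (v * (v * (v * (v * (v * (v * v))))))))))"
    "0 \<le> v * (v * (v * (v * (v * (v * (v * (v * (v * (v * (v * (v * v)))))))))))"
  using assms by auto

text \<open>In all cases \<open>L = T + 4 / r\<^sup>3\<close>. For \<open>R \<ge> 5\<close> the factor \<open>T\<close> is determined by \<open>T (R - 2\<tau>) = R - 3\<close>,
  where \<open>R = 5 + v\<close> is odd or \<open>R = 6 + v\<close> is even; for \<open>R = 4\<close> it has to be a little larger so that
  \<open>T (R - 2\<tau>) \<ge> 4/3\<close>.\<close>

lemma semi_constants_four: "semi_constants 5 4 (11/41) (11/30) (11/52) (11/41) (193/500 + 4/125)"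
  by unfold_locales simp_all

text \<open>Here v = R - 5, r = R and m = R + 1. The quadratic is (5 + v)(52 + 11 v) - 22, which
  comes from (R - 3) / (R - 2\<tau>) with \<tau> = 11 / (52 + 11 v).\<close>

lemma semi_constants_odd:
  fixes v :: real
  assumes v: "v \<ge> 0"
  shows "semi_constants (5 + v) (6 + v) (11 / (52 + 11 * v)) (11 / (41 + 11 * v)) (11 / (52 + 11 * v))
    (11 / (63 + 11 * v)) ((2 + v) * (52 + 11 * v) / (238 + 107 * v + 11 * v^2) + 4 / (5 + v)^3)"
proof -
  have d: "52 + 11 * v > 0" "41 + 11 * v > 0" "63 + 11 * v > 0" "5 + v > 0" "238 + 107 * v + 11 * v^2 > 0"
    using v by (auto intro!: add_pos_nonneg)
  then have n: "52 + 11 * v \<noteq> 0" "41 + 11 * v \<noteq> 0" "63 + 11 * v \<noteq> 0" "5 + v \<noteq> 0"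
    "238 + 107 * v + 11 * v^2 \<noteq> 0" by auto
  note p = monomials_nonneg[OF v]
  show ?thesis
    by unfold_locales
      (use n d v p in \<open>simp add: divide_simps; (simp add: algebra_simps power2_eq_square power3_eq_cube)?; linarith?\<close>)+
qed

text \<open>Here v = R - 6, r = R + 1 and m = R; the quadratic is (6 + v)(63 + 11 v) - 22.\<close>

lemma semi_constants_even:
  fixes v :: real
  assumes v: "v \<ge> 0"
  shows "semi_constants (7 + v) (6 + v) (11 / (63 + 11 * v)) (11 / (52 + 11 * v)) (11 / (74 + 11 * v))
    (11 / (63 + 11 * v)) ((3 + v) * (63 + 11 * v) / (356 + 129 * v + 11 * v^2) + 4 / (7 + v)^3)"
proof -
  have d: "52 + 11 * v > 0" "74 + 11 * v > 0" "63 + 11 * v > 0" "7 + v > 0" "356 + 129 * v + 11 * v^2 > 0"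
    using v by (auto intro!: add_pos_nonneg)
  then have n: "52 + 11 * v \<noteq> 0" "74 + 11 * v \<noteq> 0" "63 + 11 * v \<noteq> 0" "7 + v \<noteq> 0"
    "356 + 129 * v + 11 * v^2 \<noteq> 0" by auto
  note p = monomials_nonneg[OF v]
  show ?thesis
    by unfold_locales
      (use n d v p in \<open>simp add: divide_simps; (simp add: algebra_simps power2_eq_square power3_eq_cube)?; linarith?\<close>)+
qed

text \<open>T = 1 - 2 / (r - 1) is read off from the claim: S_k \<ge> a in the regular case, so |t|
  < a - T a = 2 a / (r - 1).\<close>

lemma regular_constants_odd:
  fixes v :: real
  assumes v: "v \<ge> 0"
  shows "regular_constants (5 + v) (5 + v) (1 / (5 + v)) (1 / (5 + v)) (11 / (41 + 11 * v))
    (1 - 2 / (4 + v) + 4 / (5 + v)^3)"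
proof -
  have d: "41 + 11 * v > 0" "5 + v > 0" "4 + v > 0" using v by auto
  then have n: "41 + 11 * v \<noteq> 0" "5 + v \<noteq> 0" "4 + v \<noteq> 0" by auto
  note p = monomials_nonneg[OF v]
  show ?thesis
    by unfold_locales
      (use n d v p in \<open>simp add: divide_simps; (simp add: algebra_simps power2_eq_square power3_eq_cube)?; linarith?\<close>)+
qed

lemma regular_constants_even:
  fixes v :: real
  assumes v: "v \<ge> 0"
  shows "regular_constants (5 + v) (4 + v) (1 / (4 + v)) (1 / (5 + v)) (11 / (30 + 11 * v))
    (1 - 2 / (4 + v) + 4 / (5 + v)^3)"
proof -
  have d: "30 + 11 * v > 0" "5 + v > 0" "4 + v > 0" using v by auto
  then have n: "30 + 11 * v \<noteq> 0" "5 + v \<noteq> 0" "4 + v \<noteq> 0" by auto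
  note p = monomials_nonneg[OF v]
  show ?thesis
    by unfold_locales
      (use n d v p in \<open>simp add: divide_simps; (simp add: algebra_simps power2_eq_square power3_eq_cube)?; linarith?\<close>)+
qed

section \<open>The digit bounds\<close>

lemma inverse_shift_le:
  fixes x c d :: real
  assumes "d < c" "c \<le> x"
  shows "1 / (x - d) \<le> 1 / (c - d)"
  using assms by (intro divide_left_mono mult_pos_pos) auto

lemma odd_ceil_properties:
  assumes "R \<ge> 4"
  shows "odd_ceil R \<ge> 5" "R \<le> odd_ceil R" "odd j \<Longrightarrow> R \<le> j \<Longrightarrow> odd_ceil R \<le> j"
  using assms by (auto simp: odd_ceil_def) presburger+

lemma semi_constants_exist:
  fixes R :: int
  assumes R: "R \<ge> 4"
  obtains T :: real and m :: int where "0 \<le> T" "real_of_int R - 3 \<le> T * (R - 2 * (1 / (R - 3/11)))"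
    "4/3 \<le> T * (R - 2 * (1 / (R - 3/11)))"
    "semi_constants (odd_ceil R) m (1 / (R - 3/11)) (1 / (R - 14/11)) (1 / (real_of_int (odd_ceil R) - 3/11))
      (1 / (m - 3/11)) (T + 4 / real_of_int (odd_ceil R) ^ 3)"
    "m \<ge> R" "\<And>j. even j \<Longrightarrow> R \<le> j \<Longrightarrow> m \<le> j"
proof -
  have frac: "1 / (x - 3/11) = 11 / (11 * x - 3)" "1 / (x - 14/11) = 11 / (11 * x - 14)" for x :: real
    by (simp_all add: divide_simps)
  have "R = 4 \<or> odd R \<and> R \<ge> 5 \<or> even R \<and> R \<ge> 6" using R by presburger
  then consider "R = 4" | "odd R" "R \<ge> 5" | "even R" "R \<ge> 6" by blast
  then show ?thesis
  proof cases
    case 1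
    show ?thesis
      by (rule that[of "193/500" 4]) (use 1 semi_constants_four in \<open>simp_all add: odd_ceil_def\<close>)
  next
    case 2
    define v where "v = real_of_int R - 5"
    have v: "v \<ge> 0" "real_of_int R = 5 + v" using 2 by (auto simp: v_def)
    have d: "238 + 107 * v + 11 * v^2 > 0" "52 + 11 * v > 0" using v(1) by (auto intro!: add_pos_nonneg)
    have "(2 + v) * (52 + 11 * v) / (238 + 107 * v + 11 * v^2) * (5 + v - 2 * (11 / (52 + 11 * v))) = 2 + v"
      using d by (simp add: divide_simps) (simp add: algebra_simps power2_eq_square)
    moreover have "1 / (real_of_int R - 3/11) = 11 / (52 + 11 * v)" unfolding frac v(2) by (simp add: algebra_simps)
    ultimately have T: "(2 + v) * (52 + 11 * v) / (238 + 107 * v + 11 * v^2) * (R - 2 * (1 / (R - 3/11))) = 2 + v"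
      by (simp only: v(2))
    show ?thesis
    proof (rule that[of "(2 + v) * (52 + 11 * v) / (238 + 107 * v + 11 * v^2)" "R + 1"])
      show "semi_constants (odd_ceil R) (R + 1) (1 / (R - 3/11)) (1 / (R - 14/11)) (1 / (real_of_int (odd_ceil R) - 3/11))
        (1 / (real_of_int (R + 1) - 3/11)) ((2 + v) * (52 + 11 * v) / (238 + 107 * v + 11 * v^2) + 4 / real_of_int (odd_ceil R) ^ 3)"
        using semi_constants_odd[OF v(1)] 2 unfolding frac by (simp add: odd_ceil_def v(2) algebra_simps)
      show "m \<ge> R + 1" if "even m" "R \<le> m" for m using that 2 by presburger
    qed (simp_all only: T, use d v in simp_all)
  next
    case 3
    define v where "v = real_of_int R - 6"
    have v: "v \<ge> 0" "real_of_int R = 6 + v" using 3 by (auto simp: v_def)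
    have d: "356 + 129 * v + 11 * v^2 > 0" "63 + 11 * v > 0" using v(1) by (auto intro!: add_pos_nonneg)
    have "(3 + v) * (63 + 11 * v) / (356 + 129 * v + 11 * v^2) * (6 + v - 2 * (11 / (63 + 11 * v))) = 3 + v"
      using d by (simp add: divide_simps) (simp add: algebra_simps power2_eq_square)
    moreover have "1 / (real_of_int R - 3/11) = 11 / (63 + 11 * v)" unfolding frac v(2) by (simp add: algebra_simps)
    ultimately have T: "(3 + v) * (63 + 11 * v) / (356 + 129 * v + 11 * v^2) * (R - 2 * (1 / (R - 3/11))) = 3 + v"
      by (simp only: v(2))
    show ?thesis
    proof (rule that[of "(3 + v) * (63 + 11 * v) / (356 + 129 * v + 11 * v^2)" R])
      show "semi_constants (odd_ceil R) R (1 / (R - 3/11)) (1 / (R - 14/11)) (1 / (real_of_int (odd_ceil R) - 3/11))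
        (1 / (R - 3/11)) ((3 + v) * (63 + 11 * v) / (356 + 129 * v + 11 * v^2) + 4 / real_of_int (odd_ceil R) ^ 3)"
        using semi_constants_even[OF v(1)] 3 unfolding frac by (simp add: odd_ceil_def v(2) algebra_simps)
    qed (simp_all only: T, use d v in simp_all)
  qed
qed

lemma regular_constants_odd_ceil:
  fixes R :: int
  assumes R: "R \<ge> 4"
  shows "regular_constants (odd_ceil R) R (1 / R) (1 / odd_ceil R) (1 / (R - 14/11))
    ((1 - 2 / (real_of_int (odd_ceil R) - 1)) + 4 / real_of_int (odd_ceil R) ^ 3)"
proof -
  have frac: "1 / (x - 14/11) = 11 / (11 * x - 14)" for x :: real
    by (simp add: divide_simps)
  show ?thesis
  proof (cases "odd R")
    case True
    then have "R \<ge> 5" using R by presburger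
    define v where "v = real_of_int R - 5"
    have v: "v \<ge> 0" "real_of_int R = 5 + v" using \<open>R \<ge> 5\<close> by (auto simp: v_def)
    show ?thesis using regular_constants_odd[OF v(1)] True unfolding frac
      by (simp add: odd_ceil_def v(2) algebra_simps)
  next
    case False
    define v where "v = real_of_int R - 4"
    have v: "v \<ge> 0" "real_of_int R = 4 + v" using R by (auto simp: v_def)
    show ?thesis using regular_constants_even[OF v(1)] False unfolding frac
      by (simp add: odd_ceil_def v(2) algebra_simps)
  qed
qed

context large_digits
begin

lemma beta_le_index: "\<forall>\<^sub>F k in sequentially. \<beta> k \<le> 1 / (ra k - 3/11)"
  by (rule eventually_SucI) (rule beta_le)

lemma semi_vertices_ge:
  fixes r m :: int
  assumes const: "semi_constants r m (1 / (R - 3/11)) \<xi> (1 / (r - 3/11)) (1 / (m - 3/11)) L"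
    and r: "r \<ge> R" "\<And>j. odd j \<Longrightarrow> R \<le> j \<Longrightarrow> r \<le> j"
    and m: "m \<ge> R" "\<And>j. even j \<Longrightarrow> R \<le> j \<Longrightarrow> m \<le> j"
  shows "\<forall>\<^sub>F k in sequentially. vertices_ge \<mu> y_star L k"
proof (rule eventually_SucI)
  interpret semi_constants r m "1 / (R - 3/11)" \<xi> "1 / (r - 3/11)" "1 / (m - 3/11)" L
    by (rule const)
  let ?\<tau> = "1 / (real_of_int R - 3/11)"
  have shrink: "x \<le> 1 / (real_of_int c - 3/11)"
    if "x \<le> 1 / (real_of_int i - 3/11)" "c \<le> i" "c \<ge> R" for x :: real and i c :: int
    using that inverse_shift_le[of "3/11" "real_of_int c" "real_of_int i"] R_ge by simp
  note tail1 = eventually_SucD[OF tail_le] and Y1 = eventually_SucD[OF Y_bounds]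
  note digit1 = eventually_SucD[OF digits_ge] and digit2 = eventually_SucD[OF eventually_SucD[OF digits_ge]]
  note digit3 = eventually_SucD[OF digit2]
  show "\<forall>\<^sub>F k in sequentially. vertices_ge \<mu> y_star L (Suc k)"
    using digits_ge digit1 digit2 digit3 beta_le_index X_bounds tail1 eventually_SucD[OF tail1] Y1
  proof eventually_elim
    case (elim k)
    have beta: "0 \<le> \<beta> k" "\<beta> k \<le> ?\<tau>" using beta_nonneg shrink elim by auto
    have theta: "0 \<le> \<theta> (Suc k)" "\<theta> (Suc k) \<le> ?\<tau>" using tail_pos less_imp_le shrink elim by auto
    have theta': "\<theta> (Suc (Suc k)) \<le> ?\<tau>" using shrink elim by blast
    have next_odd: "\<theta> (Suc k) \<le> 1 / (r - 3/11)" "Y (Suc k) \<ge> \<theta> (Suc k) * (1 - ?\<tau>)"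
      if "odd (a (Suc (Suc k)))"
    proof -
      show "\<theta> (Suc k) \<le> 1 / (r - 3/11)" using shrink elim that r by blast
      have "\<theta> (Suc k) * (1 - ?\<tau>) \<le> \<theta> (Suc k) * (1 - \<theta> (Suc (Suc k)))"
        using theta theta' by (intro mult_left_mono) auto
      then show "Y (Suc k) \<ge> \<theta> (Suc k) * (1 - ?\<tau>)" using elim that by linarith
    qed
    have next_even: "\<theta> (Suc k) \<le> 1 / (m - 3/11)" "Y (Suc k) \<le> \<theta> (Suc k) * ?\<tau>"
      if "even (a (Suc (Suc k)))"
    proof -
      show "\<theta> (Suc k) \<le> 1 / (m - 3/11)" using shrink elim that m by blast
      have "\<theta> (Suc k) * \<theta> (Suc (Suc k)) \<le> \<theta> (Suc k) * ?\<tau>"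
        using theta theta' by (intro mult_left_mono) auto
      then show "Y (Suc k) \<le> \<theta> (Suc k) * ?\<tau>" using elim that by linarith
    qed
    have Y: "0 \<le> Y (Suc k)" "Y (Suc k) \<le> \<theta> (Suc k)" using elim by auto
    \<comment> \<open>If the next digit is odd, each summand is at most 1 / (r - 3/11); if it is
      even, Y is of second order and \<open>tau(1)\<close> covers the sum.\<close>
    have sum: "\<theta> (Suc k) + Y (Suc k) \<le> 2 * (1 / (r - 3/11))"
    proof (cases "odd (a (Suc (Suc k)))")
      case True
      then show ?thesis using next_odd(1) Y by linarith
    next
      case False
      have "\<theta> (Suc k) * ?\<tau> \<le> ?\<tau> * ?\<tau>" using theta pos by (intro mult_right_mono) auto
      then show ?thesis using next_even(2) False theta tau(1) by linarith
    qed
    have X: "- (\<beta> k * (1 + \<xi>)) \<le> X k" "X k \<le> \<beta> k * \<xi>" using elim by auto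
    note facts = re_cases[of k] re_cases[of "Suc k"] beta X theta Y sum
    show ?case
    proof (cases "odd (a (Suc k))")
      case True
      then have A: "ra (Suc k) \<ge> r" using r elim by simp
      have nd: "Y (Suc k) \<ge> \<theta> (Suc k) * (1 - ?\<tau>) \<or> \<theta> (Suc k) \<le> 1 / (m - 3/11)"
        using next_odd next_even by blast
      show ?thesis by (rule vertices_ge_odd[OF True]) (rule odd_vertices[OF facts A nd])+
    next
      case False
      then have A: "ra (Suc k) \<ge> m" using m elim by simp
      have nd: "\<theta> (Suc k) \<le> 1 / (r - 3/11) \<or> Y (Suc k) \<le> \<theta> (Suc k) * ?\<tau>"
        using next_odd next_even by blast
      have pd: "\<beta> k \<le> 1 / (r - 3/11) \<or> X k \<ge> - (\<beta> k * \<xi>)"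
        using shrink elim r by blast
      show ?thesis by (rule vertices_ge_even) (use False in simp, (rule even_vertices[OF facts A nd pd])+)
    qed
  qed
qed

lemma regular_vertices_ge:
  fixes r :: int
  assumes const: "regular_constants r R (1 / R) (1 / r) \<xi> L"
    and r: "r \<ge> R" "\<And>j. odd j \<Longrightarrow> R \<le> j \<Longrightarrow> r \<le> j"
    and reg: "\<And>k. \<epsilon> (Suc k) = 1"
  shows "\<forall>\<^sub>F k in sequentially. vertices_ge \<mu> y_star L k"
proof (rule eventually_SucI)
  interpret regular_constants r R "1 / R" "1 / r" \<xi> L by (rule const)
  have shrink: "x \<le> 1 / real_of_int c" if "x * real_of_int i \<le> 1" "x \<ge> 0" "c \<le> i" "c \<ge> R"
    for x :: real and i c :: int
  proof -
    have "x * real_of_int c \<le> x * real_of_int i" using that by (intro mult_left_mono) auto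
    then show ?thesis using that R_ge by (simp add: pos_le_divide_eq)
  qed
  have tail_le_inv: "\<theta> k * ra (Suc k) \<le> 1" for k
  proof -
    have "0 \<le> \<theta> k * \<theta> (Suc k)" using tail_pos[of k] tail_pos[of "Suc k"] by simp
    then show ?thesis using tail_mult[of k] by (simp add: reg algebra_simps)
  qed
  have "\<beta> (Suc k) * ra (Suc k) \<le> 1" for k
  proof -
    have "0 \<le> \<beta> (Suc k) * \<beta> k" using beta_nonneg by simp
    then show ?thesis using beta_mult[of k] by (simp add: reg algebra_simps)
  qed
  then have beta_le_inv: "\<forall>\<^sub>F k in sequentially. \<beta> k * ra k \<le> 1"
    by (intro eventually_SucI[of "\<lambda>k. \<beta> k * ra k \<le> 1"] always_eventually allI)
  note Y1 = eventually_SucD[OF Y_bounds]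
  note digit1 = eventually_SucD[OF digits_ge] and digit2 = eventually_SucD[OF eventually_SucD[OF digits_ge]]
  note digit3 = eventually_SucD[OF digit2]
  show "\<forall>\<^sub>F k in sequentially. vertices_ge \<mu> y_star L (Suc k)"
    using digits_ge digit1 digit2 digit3 beta_le_inv X_bounds Y1
  proof eventually_elim
    case (elim k)
    have beta: "0 \<le> \<beta> k" "\<beta> k \<le> 1 / R" using beta_nonneg shrink elim by auto
    have theta: "0 \<le> \<theta> (Suc k)" "\<theta> (Suc k) \<le> 1 / R"
      using tail_pos[of "Suc k"] shrink[OF tail_le_inv[of "Suc k"]] elim by auto
    have theta': "\<theta> (Suc (Suc k)) \<le> 1 / R"
      by (rule shrink[OF tail_le_inv]) (use tail_pos[of "Suc (Suc k)"] elim in auto)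
    have Y: "0 \<le> Y (Suc k)" "Y (Suc k) \<le> \<theta> (Suc k)" using elim by auto
    have X: "- (\<beta> k * (1 + \<xi>)) \<le> X k" "X k \<le> \<beta> k * \<xi>" using elim by auto
    have nd: "\<theta> (Suc k) \<le> 1 / r \<or> Y (Suc k) \<le> \<theta> (Suc k) * (1 / R)"
    proof (cases "odd (a (Suc (Suc k)))")
      case True
      then show ?thesis using shrink[OF tail_le_inv, of "Suc k" r] theta elim r by blast
    next
      case False
      have "\<theta> (Suc k) * \<theta> (Suc (Suc k)) \<le> \<theta> (Suc k) * (1 / R)"
        using theta theta' by (intro mult_left_mono) auto
      then show ?thesis using False elim by auto
    qed
    have pd: "\<beta> k \<le> 1 / r \<or> X k \<ge> - (\<beta> k * \<xi>)"
      using shrink beta elim r by blast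
    note facts = beta X theta Y nd pd
    show ?case
    proof (cases "odd (a (Suc k))")
      case True
      then have A: "ra (Suc k) \<ge> r" using r elim by simp
      show ?thesis
        by (rule vertices_ge_odd[OF True]; unfold reg of_int_1 mult_1) (rule odd_vertices[OF facts A])+
    next
      case False
      then have A: "ra (Suc k) \<ge> R" using elim by simp
      have ev: "even (a (Suc k))" using False by simp
      show ?thesis
        by (rule vertices_ge_even[OF ev]; unfold reg of_int_1 mult_1) (rule even_vertices[OF facts A])+
    qed
  qed
qed

text \<open>M is a quarter of the vertex level, so the permitted loss 1 / r^3 costs 4 / r^3 there;
  this explains the level demanded of \<gamma>_*.\<close>

lemma digit_bound_of_vertices:
  assumes vert: "\<forall>\<^sub>F k in sequentially. vertices_ge \<mu> y_star (T + 4 / r ^ 3) k"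
    and T: "0 \<le> T + 4 / r ^ 3" "T + 4 / r ^ 3 \<le> 1" "\<forall>\<^sub>F k in sequentially. 4/3 \<le> T * S k"
    and \<gamma>: "\<gamma> \<notin> homogeneous_values \<alpha>"
      "inhom_const \<alpha> \<gamma> > inhom_const \<alpha> (gamma_star a \<epsilon> \<alpha>) - ereal (1 / r ^ 3)"
  shows "\<forall>\<^sub>F k in sequentially. T * S k < ra (Suc k) - \<bar>t_digit a \<epsilon> \<gamma> (Suc k)\<bar>"
proof (rule digit_bound[OF \<gamma>(1) _ T(3)])
  have "ereal ((T + 4 / r ^ 3) / 4) \<le> inhom_const \<alpha> (gamma_star a \<epsilon> \<alpha>)"
    unfolding gamma_star_eq
    by (rule inhom_const_base_point_ge[OF digit_tail_star even_sign moderate_star vert T(1,2)])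
  then have le: "ereal ((T + 4 / r ^ 3) / 4) - ereal (1 / r ^ 3)
      \<le> inhom_const \<alpha> (gamma_star a \<epsilon> \<alpha>) - ereal (1 / r ^ 3)"
    by (intro ereal_minus_mono) auto
  have "ereal ((T + 4 / r ^ 3) / 4) - ereal (1 / r ^ 3) = ereal (T / 4)"
    by (simp add: add_divide_distrib)
  from le_less_trans[OF le[unfolded this] \<gamma>(2)] show "ereal (T / 4) < inhom_const \<alpha> \<gamma>" .
qed

lemma even_t_digit: "even (a (Suc k) + t_digit a \<epsilon> \<gamma> (Suc k))"
  using even_t[of k \<gamma>] by (simp add: t\<^sub>\<gamma>_def)

text \<open>From S \<ge> a - 2\<tau> and T R \<ge> R - 3 one gets T S \<ge> R - 3 + (1 - 3/R)(a -
  R); subtracting this from a leaves exactly 3 a / R.\<close>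

lemma semi_digit_bound:
  assumes "\<gamma> \<notin> homogeneous_values \<alpha>"
    and "inhom_const \<alpha> \<gamma> > inhom_const \<alpha> (gamma_star a \<epsilon> \<alpha>) - ereal (1 / of_int (odd_ceil R) ^ 3)"
  shows "\<forall>\<^sub>F k in sequentially. \<bar>t_digit a \<epsilon> \<gamma> k\<bar> < 3 * ra k / R"
proof (rule eventually_SucI)
  let ?\<tau> = "1 / (real_of_int R - 3/11)"
  let ?r = "real_of_int (odd_ceil R)"
  have R4: "real_of_int R \<ge> 4" using R_ge by simp
  obtain T :: real and m :: int where T: "0 \<le> T" "real_of_int R - 3 \<le> T * (R - 2 * ?\<tau>)" "4/3 \<le> T * (R - 2 * ?\<tau>)"
    and const: "semi_constants ?r m ?\<tau> (1 / (R - 14/11)) (1 / (?r - 3/11)) (1 / (m - 3/11)) (T + 4 / ?r ^ 3)"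
    and m: "m \<ge> R" "\<And>j. even j \<Longrightarrow> R \<le> j \<Longrightarrow> m \<le> j"
    by (rule semi_constants_exist[OF R_ge]) blast
  note oc = odd_ceil_properties[OF R_ge]
  have vert: "\<forall>\<^sub>F k in sequentially. vertices_ge \<mu> y_star (T + 4 / ?r ^ 3) k"
    using semi_vertices_ge[OF const[folded \<xi>_def] oc(2,3) m] .
  have S: "\<forall>\<^sub>F k in sequentially. S k \<ge> ra (Suc k) - 2 * ?\<tau> \<and> a (Suc k) \<ge> R"
    using eventually_SucD[OF tail_le] beta_le_index digits_ge eventually_SucD[OF digits_ge]
      eventually_SucD[OF eventually_SucD[OF digits_ge]]
  proof eventually_elim
    case (elim k)
    have "\<theta> (Suc k) \<le> ?\<tau>" "\<beta> k \<le> ?\<tau>"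
      using elim inverse_shift_le[of "3/11" R "ra (Suc (Suc k))"] inverse_shift_le[of "3/11" R "ra k"] R4
      by auto
    then show ?case
      using elim re_cases[of k] re_cases[of "Suc k"] tail_pos[of "Suc k"] beta_nonneg[of k]
      by (auto simp: S_def)
  qed
  have TS: "\<forall>\<^sub>F k in sequentially. T * S k \<ge> T * (R - 2 * ?\<tau>) + T * (ra (Suc k) - R) \<and> ra (Suc k) \<ge> R"
    using S
  proof eventually_elim
    case (elim k)
    have "T * (ra (Suc k) - 2 * ?\<tau>) \<le> T * S k" using elim T(1) by (intro mult_left_mono) auto
    moreover have "T * (ra (Suc k) - 2 * ?\<tau>) = T * (R - 2 * ?\<tau>) + T * (ra (Suc k) - R)"
      by (simp only: distrib_left[symmetric]) simp
    ultimately show ?case using elim by simp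
  qed
  have T43: "\<forall>\<^sub>F k in sequentially. 4/3 \<le> T * S k"
    using TS
  proof eventually_elim
    case (elim k)
    have "0 \<le> T * (ra (Suc k) - R)" using T(1) elim by simp
    then show ?case using elim T(3) by linarith
  qed
  have L: "0 \<le> T + 4 / ?r ^ 3" "T + 4 / ?r ^ 3 \<le> 1"
    using semi_constants.L(1)[OF const] semi_constants.L_le_one[OF const] .
  have TR: "T * R \<ge> R - 3"
  proof -
    have "T * (R - 2 * ?\<tau>) \<le> T * R" using T(1) R4 by (intro mult_left_mono) auto
    then show ?thesis using T(2) by linarith
  qed
  show "\<forall>\<^sub>F k in sequentially. \<bar>t_digit a \<epsilon> \<gamma> (Suc k)\<bar> < 3 * ra (Suc k) / R"
    using digit_bound_of_vertices[OF vert L T43 assms] TS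
  proof eventually_elim
    case (elim k)
    have "(R - 3) / R * (ra (Suc k) - R) \<le> T * (ra (Suc k) - R)"
      using TR R4 elim by (intro mult_right_mono) (auto simp: pos_divide_le_eq)
    moreover have "(R - 3) / R * (ra (Suc k) - R) = ra (Suc k) - R - 3 * ra (Suc k) / R + 3"
      using R4 by (simp add: field_simps)
    ultimately show ?case using elim T(2) by linarith
  qed
qed

lemma regular_digit_bound:
  assumes reg: "\<And>k. \<epsilon> (Suc k) = 1"
    and \<gamma>: "\<gamma> \<notin> homogeneous_values \<alpha>"
      "inhom_const \<alpha> \<gamma> > inhom_const \<alpha> (gamma_star a \<epsilon> \<alpha>) - ereal (1 / of_int (odd_ceil R) ^ 3)"
  shows "\<forall>\<^sub>F k in sequentially. \<bar>t_digit a \<epsilon> \<gamma> k\<bar> < 2 * ra k / (odd_ceil R - 1)"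
proof (rule eventually_SucI)
  let ?r = "real_of_int (odd_ceil R)"
  let ?T = "1 - 2 / (?r - 1)"
  note oc = odd_ceil_properties[OF R_ge]
  have r5: "?r \<ge> 5" using oc(1) by simp
  have T: "?T \<ge> 1/2" using r5 by (simp add: field_simps)
  have const: "regular_constants ?r R (1 / R) (1 / ?r) \<xi> (?T + 4 / ?r ^ 3)"
    using regular_constants_odd_ceil[OF R_ge] by (simp add: \<xi>_def)
  have vert: "\<forall>\<^sub>F k in sequentially. vertices_ge \<mu> y_star (?T + 4 / ?r ^ 3) k"
    using regular_vertices_ge[OF const oc(2,3) reg] .
  have L: "0 \<le> ?T + 4 / ?r ^ 3" "?T + 4 / ?r ^ 3 \<le> 1"
    using regular_constants.L(1)[OF const] regular_constants.L_le(2)[OF const] .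
  have TS: "\<forall>\<^sub>F k in sequentially. ?T * S k \<ge> ?T * ra (Suc k) \<and> ra (Suc k) \<ge> 4"
    using digits_Suc_ge
  proof eventually_elim
    case (elim k)
    have "S k \<ge> ra (Suc k)"
      using tail_pos[of "Suc k"] beta_nonneg[of k] by (simp add: S_def reg)
    then have "?T * ra (Suc k) \<le> ?T * S k" using T by (intro mult_left_mono) auto
    then show ?case using elim by simp
  qed
  have T43: "\<forall>\<^sub>F k in sequentially. 4/3 \<le> ?T * S k"
    using TS
  proof eventually_elim
    case (elim k)
    have "1/2 * 4 \<le> ?T * ra (Suc k)" using T elim by (intro mult_mono) auto
    then show ?case using elim by linarith
  qed
  show "\<forall>\<^sub>F k in sequentially. \<bar>t_digit a \<epsilon> \<gamma> (Suc k)\<bar> < 2 * ra (Suc k) / (odd_ceil R - 1)"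
    using digit_bound_of_vertices[OF vert L T43 \<gamma>] TS
  proof eventually_elim
    case (elim k)
    have "?T * ra (Suc k) = ra (Suc k) - 2 * ra (Suc k) / (?r - 1)" by (simp add: left_diff_distrib)
    then show ?case using elim by simp
  qed
qed

end

theorem theorem7:
  fixes \<alpha> \<gamma> :: real and a \<epsilon> :: "nat \<Rightarrow> int" and R :: int
  assumes "\<alpha> \<notin> \<rat>"
    and "semi_regular_expansion a \<epsilon> \<alpha>"
    and "liminf (\<lambda>i. ereal (of_int (a i))) = ereal (of_int R)"
    and "R \<ge> 4"
    and "\<gamma> \<notin> homogeneous_values \<alpha>"
    and "inhom_const \<alpha> \<gamma>
           > inhom_const \<alpha> (gamma_star a \<epsilon> \<alpha>) - ereal (1 / of_int (odd_ceil R) ^ 3)"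
  shows "(nearest_integer_expansion a \<epsilon> \<alpha> \<longrightarrow>
            (\<forall>\<^sub>F i in sequentially.
               real_of_int \<bar>t_digit a \<epsilon> \<gamma> i\<bar> < 3 * of_int (a i) / of_int R) \<and>
            (\<forall>\<^sub>F k in sequentially. a k = R \<longrightarrow>
               (odd (a k) \<longrightarrow> t_digit a \<epsilon> \<gamma> k \<in> {1, -1}) \<and>
               (even (a k) \<longrightarrow> t_digit a \<epsilon> \<gamma> k \<in> {0, 2, -2}))) \<and>
         (regular_expansion a \<epsilon> \<alpha> \<longrightarrow>
            (\<forall>\<^sub>F i in sequentially.
               real_of_int \<bar>t_digit a \<epsilon> \<gamma> i\<bar> < 2 * of_int (a i) / of_int (odd_ceil R - 1)) \<and>
            (\<forall>\<^sub>F k in sequentially. a k = R \<longrightarrow>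
               (odd (a k) \<longrightarrow> t_digit a \<epsilon> \<gamma> k \<in> {1, -1}) \<and>
               (even (a k) \<longrightarrow> t_digit a \<epsilon> \<gamma> k = 0)))"
proof -
  interpret semi_regular a \<epsilon> \<alpha> by unfold_locales (fact assms)+
  have "ereal (real_of_int (R - 1)) < liminf (\<lambda>i. ereal (of_int (a i)))"
    unfolding assms(3) by simp
  from less_LiminfD[OF this] have "\<forall>\<^sub>F k in sequentially. a k \<ge> R"
    by eventually_elim simp
  then interpret large_digits a \<epsilon> \<alpha> R by unfold_locales (use assms in auto)
  have R4: "real_of_int R \<ge> 4" using assms(4) by simp
  let ?t = "t_digit a \<epsilon> \<gamma>"
  have parity: "\<forall>\<^sub>F k in sequentially. even (a k + ?t k)"
    by (intro eventually_SucI[of "\<lambda>k. even (a k + ?t k)"] always_eventually allI even_t_digit)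
  show ?thesis
  proof (intro conjI impI)
    show semi: "\<forall>\<^sub>F i in sequentially. real_of_int \<bar>?t i\<bar> < 3 * of_int (a i) / of_int R"
      by (rule semi_digit_bound[OF assms(5,6)])
    show "\<forall>\<^sub>F k in sequentially. a k = R \<longrightarrow> (odd (a k) \<longrightarrow> ?t k \<in> {1, -1}) \<and>
        (even (a k) \<longrightarrow> ?t k \<in> {0, 2, -2})"
      using semi parity
    proof eventually_elim
      case (elim k)
      show ?case
      proof (intro impI)
        assume "a k = R"
        then have "real_of_int \<bar>?t k\<bar> < 3" using elim(1) R4 by simp
        then have "\<bar>?t k\<bar> < 3" by linarith
        then have "?t k \<in> {-2, -1, 0, 1, 2}" by auto
        then show "(odd (a k) \<longrightarrow> ?t k \<in> {1, -1}) \<and> (even (a k) \<longrightarrow> ?t k \<in> {0, 2, -2})"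
          using elim(2) by auto
      qed
    qed
  next
    assume "regular_expansion a \<epsilon> \<alpha>"
    then have "\<epsilon> (Suc k) = 1" for k by (simp add: regular_expansion_def)
    from regular_digit_bound[OF this assms(5,6)]
    show reg: "\<forall>\<^sub>F i in sequentially. real_of_int \<bar>?t i\<bar> < 2 * of_int (a i) / of_int (odd_ceil R - 1)"
      by simp
    show "\<forall>\<^sub>F k in sequentially. a k = R \<longrightarrow> (odd (a k) \<longrightarrow> ?t k \<in> {1, -1}) \<and>
        (even (a k) \<longrightarrow> ?t k = 0)"
      using reg parity
    proof eventually_elim
      case (elim k)
      show ?case
      proof (intro impI)
        assume R: "a k = R"
        show "(odd (a k) \<longrightarrow> ?t k \<in> {1, -1}) \<and> (even (a k) \<longrightarrow> ?t k = 0)"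
        proof (cases "odd R")
          case True
          \<comment> \<open>For odd R the bound 2R / (R - 1) is below 3, so |t| \<le> 2 and parity
            leaves 1 and -1.\<close>
          have "2 * real_of_int R / (R - 1) < 3" using R4 by (simp add: field_simps)
          then have "real_of_int \<bar>?t k\<bar> < 3" using elim(1) R True by (simp add: odd_ceil_def)
          then have "\<bar>?t k\<bar> < 3" by linarith
          then have "?t k \<in> {-2, -1, 0, 1, 2}" by auto
          then show ?thesis using elim(2) R True by auto
        next
          case False
          \<comment> \<open>For even R one has R_* - 1 = R, so the bound is exactly 2 and parity
            leaves only 0.\<close>
          then have "real_of_int \<bar>?t k\<bar> < 2" using elim(1) R R4 by (simp add: odd_ceil_def)
          then have "\<bar>?t k\<bar> < 2" by linarith
          then have "?t k \<in> {-1, 0, 1}" by auto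
          then show ?thesis using elim(2) R False by auto
        qed
      qed
    qed
  qed
qed

end
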